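(* Let $\mathbb G$ be a stratified group equipped with a homogeneous distance $d$, let $\Sigma\subset\mathbb G$ be a $p$-dimensional $C^1$ submanifold and let $\Sigma_c=\{x\in\Sigma: d_\Sigma(x)<D(p)\}$ denote the subset of points with degree less than $D(p)$. Then $$\mathcal H^{D(p)}(\Sigma_c)=0,$$ where $\mathcal H^{D(p)}$ is the $D(p)$-dimensional Hausdorff measure with respect to $d$.
   Context: Stratified group: a connected, simply connected nilpotent Lie group $\mathbb G$ with Lie algebra $\mathcal G=V_1\oplus\dots\oplus V_\iota$, $V_{i+1}=[V_1,V_i]$ for $i\ge1$, $V_{\iota+1}=\{0\}$. Put $n_j=\dim V_j$, $m_0=0$, $m_j=n_1+\dots+n_j$, $n=m_\iota$; the degree $d_j$ of $j\in\{1,\dots,n\}$ is defined by $m_{d_j-1}<j\le m_{d_j}$. A graded metric $g$ (left invariant Riemannian metric with the $V_k$ mutually orthogonal) is fixed; a graded basis $(X_1,\dots,X_n)$ is a $g$-orthonormal basis of $\mathcal G$ such that $X_{m_{j-1}+1},\dots,X_{m_j}$ is a basis of $V_j$ for all $j$. $\mathbb G$ is identified with $\mathbb R^n$ via $(x_1,\dots,x_n)\leftrightarrow\exp(\sum_i x_iX_i)$. Dilations: $\delta_r(x_1,\dots,x_n)=(r^{d_1}x_1,\dots,r^{d_n}x_n)$. A homogeneous distance $d$ is a continuous distance on $\mathbb G$ with $d(zx,zy)=d(x,y)$ and $d(\delta_rx,\delta_ry)=r\,d(x,y)$ for all $x,y,z$, $r>0$. $I_p$ is the set of $\alpha=(\alpha_1,\dots,\alpha_p)$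 with $1\le\alpha_1<\dots<\alpha_p\le n$, $d(\alpha)=d_{\alpha_1}+\dots+d_{\alpha_p}$, and $D(p)=\max_{\alpha\in I_p}d(\alpha)$. For $x\in\Sigma$, let $\tau_\Sigma(x)$ be a tangent $p$-vector (wedge of the vectors of a basis of $T_x\Sigma$), written $\tau_\Sigma(x)=\sum_{\alpha\in I_p}c_\alpha\,(X_{\alpha_1}\wedge\dots\wedge X_{\alpha_p})(x)$; the degree of $\Sigma$ at $x$ is $d_\Sigma(x)=\max\{d(\alpha):c_\alpha\ne0\}$. *)

theory Defs
  imports "HOL-Analysis.Analysis"
begin

section \<open>Maps of class \<open>C\<^sup>k\<close> on open sets\<close>

text \<open>Meant for open \<open>S\<close>. As the domain is finite-dimensional, \<open>C\<^sup>k\<^sup>+\<^sup>1\<close> regularity is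
  differentiability together with \<open>C\<^sup>k\<close> regularity of all directional derivatives.\<close>

primrec Ck_on ::
  "nat \<Rightarrow> ('a::euclidean_space \<Rightarrow> 'b::euclidean_space) \<Rightarrow> 'a set \<Rightarrow> bool" where
  "Ck_on 0 f S \<longleftrightarrow> continuous_on S f"
| "Ck_on (Suc k) f S \<longleftrightarrow>
     (\<forall>x\<in>S. f differentiable (at x)) \<and>
     (\<forall>v. Ck_on k (\<lambda>x. frechet_derivative f (at x) v) S)"


section \<open>Stratified groups\<close>

text \<open>
  The group is identified with its Lie algebra through the exponential map, so a single type
  \<open>'a\<close> plays both roles; the unit is \<open>0\<close>, the Lie algebra is the tangent space at \<open>0\<close>, and the
  tangent space at every point is \<open>'a\<close> again. That the coordinates are exponential means that
  \<open>t \<mapsto> t x\<close>, whose velocity at \<open>0\<close> is \<open>x\<close>, is the one-parameter subgroup generated by \<open>x\<close>;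
  in particular \<open>exp(x)\<close> has inverse \<open>exp(-x)\<close>. Being diffeomorphic to a vector space, the
  group is connected and simply connected.\<close>

definition lie_group_in_exp_coords :: "('a::euclidean_space \<Rightarrow> 'a \<Rightarrow> 'a) \<Rightarrow> bool" where
  "lie_group_in_exp_coords mul \<longleftrightarrow>
     group mul 0 uminus \<and>
     (\<forall>k. Ck_on k (\<lambda>(x, y). mul x y) UNIV) \<and>
     (\<forall>x s t. mul (s *\<^sub>R x) (t *\<^sub>R x) = (s + t) *\<^sub>R x)"

definition left_inv_field :: "('a::euclidean_space \<Rightarrow> 'a \<Rightarrow> 'a) \<Rightarrow> 'a \<Rightarrow> 'a \<Rightarrow> 'a" where
  "left_inv_field mul v x = frechet_derivative (mul x) (at 0) v"

definition vector_field_bracket ::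
  "('a::euclidean_space \<Rightarrow> 'a) \<Rightarrow> ('a \<Rightarrow> 'a) \<Rightarrow> 'a \<Rightarrow> 'a" where
  "vector_field_bracket Y Z x =
     frechet_derivative Z (at x) (Y x) - frechet_derivative Y (at x) (Z x)"

definition lie_bracket :: "('a::euclidean_space \<Rightarrow> 'a \<Rightarrow> 'a) \<Rightarrow> 'a \<Rightarrow> 'a \<Rightarrow> 'a" where
  "lie_bracket mul v w =
     vector_field_bracket (left_inv_field mul v) (left_inv_field mul w) 0"

text \<open>\<open>V 0\<close> and the layers beyond \<open>Suc \<iota>\<close> are irrelevant. Nilpotency is a consequence of the
  stratification.\<close>

definition stratified_group ::
  "('a::euclidean_space \<Rightarrow> 'a \<Rightarrow> 'a) \<Rightarrow> (nat \<Rightarrow> 'a set) \<Rightarrow> nat \<Rightarrow> bool" where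
  "stratified_group mul V \<iota> \<longleftrightarrow>
     lie_group_in_exp_coords mul \<and>
     (\<forall>j\<in>{1..\<iota>}. subspace (V j)) \<and>
     (\<forall>x. \<exists>!u. u \<in> (\<Pi>\<^sub>E j\<in>{1..\<iota>}. V j) \<and> x = (\<Sum>j=1..\<iota>. u j)) \<and>
     (\<forall>i\<in>{1..\<iota>}. V (Suc i) = span {lie_bracket mul v w | v w. v \<in> V 1 \<and> w \<in> V i}) \<and>
     V (Suc \<iota>) = {0}"

text \<open>The value at the unit of the left invariant Riemannian metric is the inner product of \<open>'a\<close>.\<close>

definition graded_metric :: "(nat \<Rightarrow> 'a::euclidean_space set) \<Rightarrow> nat \<Rightarrow> bool" where
  "graded_metric V \<iota> \<longleftrightarrow>
     (\<forall>i\<in>{1..\<iota>}. \<forall>j\<in>{1..\<iota>}. i \<noteq> j \<longrightarrow> (\<forall>v\<in>V i. \<forall>w\<in>V j. orthogonal v w))"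

definition layer_sum :: "(nat \<Rightarrow> 'a::euclidean_space set) \<Rightarrow> nat \<Rightarrow> nat" where
  "layer_sum V j = (\<Sum>i=1..j. dim (V i))"

definition degree_of :: "(nat \<Rightarrow> 'a::euclidean_space set) \<Rightarrow> nat \<Rightarrow> nat" where
  "degree_of V j = (THE k. layer_sum V (k - 1) < j \<and> j \<le> layer_sum V k)"

definition graded_basis :: "(nat \<Rightarrow> 'a::euclidean_space set) \<Rightarrow> nat \<Rightarrow> (nat \<Rightarrow> 'a) \<Rightarrow> bool" where
  "graded_basis V \<iota> X \<longleftrightarrow>
     (\<forall>i\<in>{1..layer_sum V \<iota>}. \<forall>j\<in>{1..layer_sum V \<iota>}. X i \<bullet> X j = (if i = j then 1 else 0)) \<and>
     (\<forall>j\<in>{1..\<iota>}. span (X ` {layer_sum V (j - 1) + 1..layer_sum V j}) = V j)"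

text \<open>As the basis is orthonormal, the \<open>i\<close>-th coordinate of \<open>x\<close> is \<open>x \<bullet> X i\<close>.\<close>

definition dilation ::
  "(nat \<Rightarrow> 'a::euclidean_space set) \<Rightarrow> nat \<Rightarrow> (nat \<Rightarrow> 'a) \<Rightarrow> real \<Rightarrow> 'a \<Rightarrow> 'a" where
  "dilation V \<iota> X r x = (\<Sum>i=1..layer_sum V \<iota>. (r ^ degree_of V i * (x \<bullet> X i)) *\<^sub>R X i)"

definition homogeneous_distance ::
  "('a::euclidean_space \<Rightarrow> 'a \<Rightarrow> 'a) \<Rightarrow> (nat \<Rightarrow> 'a set) \<Rightarrow> nat \<Rightarrow> (nat \<Rightarrow> 'a) \<Rightarrow>
   ('a \<Rightarrow> 'a \<Rightarrow> real) \<Rightarrow> bool" where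
  "homogeneous_distance mul V \<iota> X d \<longleftrightarrow>
     Metric_space UNIV d \<and>
     continuous_on UNIV (\<lambda>(x, y). d x y) \<and>
     (\<forall>x y z. d (mul z x) (mul z y) = d x y) \<and>
     (\<forall>x y r. r > 0 \<longrightarrow> d (dilation V \<iota> X r x) (dilation V \<iota> X r y) = r * d x y)"


section \<open>Hausdorff measure\<close>

definition ediam :: "('a \<Rightarrow> 'a \<Rightarrow> real) \<Rightarrow> 'a set \<Rightarrow> ennreal" where
  "ediam d U = (SUP (x, y)\<in>U \<times> U. ennreal (d x y))"

text \<open>The dimension \<open>k\<close> is a natural number and no normalising factor is included. Empty covering
  sets contribute \<open>0\<close>, which matters only for \<open>k = 0\<close>.\<close>

definition hausdorff_content ::
  "('a \<Rightarrow> 'a \<Rightarrow> real) \<Rightarrow> nat \<Rightarrow> real \<Rightarrow> 'a set \<Rightarrow> ennreal" where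
  "hausdorff_content d k \<epsilon> A =
     (INF U\<in>{U :: nat \<Rightarrow> 'a set. A \<subseteq> (\<Union>i. U i) \<and> (\<forall>i. ediam d (U i) \<le> ennreal \<epsilon>)}.
        (\<Sum>i. if U i = {} then 0 else ediam d (U i) ^ k))"

definition hausdorff_measure :: "('a \<Rightarrow> 'a \<Rightarrow> real) \<Rightarrow> nat \<Rightarrow> 'a set \<Rightarrow> ennreal" where
  "hausdorff_measure d k A = (SUP \<epsilon>\<in>{0<..}. hausdorff_content d k \<epsilon> A)"


section \<open>Submanifolds and their tangent \<open>p\<close>-vectors\<close>

text \<open>Embedded submanifolds without boundary, described by slice charts.\<close>

definition C1_submanifold :: "nat \<Rightarrow> 'a::euclidean_space set \<Rightarrow> bool" where
  "C1_submanifold p S \<longleftrightarrow>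
     (\<forall>x\<in>S. \<exists>U W \<Phi> \<Psi> (L :: 'a set).
        open U \<and> x \<in> U \<and> open W \<and>
        homeomorphism U W \<Phi> \<Psi> \<and> Ck_on 1 \<Phi> U \<and> Ck_on 1 \<Psi> W \<and>
        subspace L \<and> dim L = p \<and> \<Phi> ` (S \<inter> U) = W \<inter> L)"

definition tangent_space :: "'a::euclidean_space set \<Rightarrow> 'a \<Rightarrow> 'a set" where
  "tangent_space S x =
     {v. \<exists>(\<gamma> :: real \<Rightarrow> 'a) \<epsilon>. \<epsilon> > 0 \<and> \<gamma> ` {-\<epsilon><..<\<epsilon>} \<subseteq> S \<and> Ck_on 1 \<gamma> {-\<epsilon><..<\<epsilon>} \<and>
         \<gamma> 0 = x \<and> (\<gamma> has_vector_derivative v) (at 0)}"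

text \<open>A \<open>p\<close>-vector is modelled as an alternating \<open>p\<close>-linear function on the dual space:
  \<open>w\<^sub>1 \<and> \<dots> \<and> w\<^sub>p\<close> maps covectors \<open>\<xi>\<^sub>1, \<dots>, \<xi>\<^sub>p\<close> to the determinant of \<open>(\<xi>\<^sub>i(w\<^sub>j))\<close>. The type
  \<open>'a pvector\<close> contains other functions as well. Only the values of \<open>w\<close> and \<open>\<xi>\<close> on \<open>{1..p}\<close>
  matter.\<close>

type_synonym 'a pvector = "(nat \<Rightarrow> ('a \<Rightarrow>\<^sub>L real)) \<Rightarrow> real"

definition wedge :: "nat \<Rightarrow> (nat \<Rightarrow> 'a::euclidean_space) \<Rightarrow> 'a pvector" where
  "wedge p w =
     (\<lambda>\<xi>. \<Sum>\<sigma> | \<sigma> permutes {1..p}.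
        of_int (sign \<sigma>) * (\<Prod>i=1..p. blinfun_apply (\<xi> i) (w (\<sigma> i))))"

definition multi_indices :: "nat \<Rightarrow> nat \<Rightarrow> (nat \<Rightarrow> nat) set" where
  "multi_indices n p = {\<alpha> \<in> {1..p} \<rightarrow>\<^sub>E {1..n}. strict_mono_on {1..p} \<alpha>}"

definition multi_degree ::
  "(nat \<Rightarrow> 'a::euclidean_space set) \<Rightarrow> nat \<Rightarrow> (nat \<Rightarrow> nat) \<Rightarrow> nat" where
  "multi_degree V p \<alpha> = (\<Sum>k=1..p. degree_of V (\<alpha> k))"

definition max_degree :: "(nat \<Rightarrow> 'a::euclidean_space set) \<Rightarrow> nat \<Rightarrow> nat \<Rightarrow> nat" where
  "max_degree V \<iota> p = Max (multi_degree V p ` multi_indices (layer_sum V \<iota>) p)"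

text \<open>The coefficients \<open>c\<^sub>\<alpha>\<close> of a \<open>p\<close>-vector at \<open>x\<close> with respect to the basis
  \<open>(X\<^bsub>\<alpha>1\<^esub> \<and> \<dots> \<and> X\<^bsub>\<alpha>p\<^esub>)(x)\<close> built from the left invariant fields.\<close>

definition pvector_coeffs ::
  "('a::euclidean_space \<Rightarrow> 'a \<Rightarrow> 'a) \<Rightarrow> nat \<Rightarrow> (nat \<Rightarrow> 'a) \<Rightarrow> nat \<Rightarrow> 'a \<Rightarrow> 'a pvector \<Rightarrow>
   (nat \<Rightarrow> nat) \<Rightarrow> real" where
  "pvector_coeffs mul n X p x \<tau> =
     (THE c. c \<in> extensional (multi_indices n p) \<and>
        \<tau> = (\<lambda>\<xi>. \<Sum>\<alpha>\<in>multi_indices n p.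
                  c \<alpha> * wedge p (\<lambda>k. left_inv_field mul (X (\<alpha> k)) x) \<xi>))"

definition is_tangent_pvector ::
  "nat \<Rightarrow> 'a::euclidean_space set \<Rightarrow> 'a \<Rightarrow> 'a pvector \<Rightarrow> bool" where
  "is_tangent_pvector p S x \<tau> \<longleftrightarrow>
     (\<exists>w. inj_on w {1..p} \<and> independent (w ` {1..p}) \<and>
          span (w ` {1..p}) = tangent_space S x \<and> \<tau> = wedge p w)"

text \<open>Tangent \<open>p\<close>-vectors at a point are nonzero multiples of each other, so the degree does not
  depend on the chosen one.\<close>

definition point_degree ::
  "('a::euclidean_space \<Rightarrow> 'a \<Rightarrow> 'a) \<Rightarrow> (nat \<Rightarrow> 'a set) \<Rightarrow> nat \<Rightarrow> (nat \<Rightarrow> 'a) \<Rightarrow> nat \<Rightarrow>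
   'a set \<Rightarrow> 'a \<Rightarrow> nat" where
  "point_degree mul V \<iota> X p S x =
     (let n = layer_sum V \<iota>;
          c = pvector_coeffs mul n X p x (SOME \<tau>. is_tangent_pvector p S x \<tau>)
      in Max {multi_degree V p \<alpha> | \<alpha>. \<alpha> \<in> multi_indices n p \<and> c \<alpha> \<noteq> 0})"

end

theory Submission
  imports Defs
begin

text \<open>
  Let \<open>p \<ge> 1\<close>; for \<open>p = 0\<close> all degrees are \<open>0\<close>. Let \<open>l\<close> be the threshold degree: fewer than \<open>p\<close> vectors of the graded basis have degree above
  \<open>l\<close>, and at least \<open>p\<close> have degree \<open>l\<close> or more. Choosing \<open>p\<close> basis vectors greedily from the
  top shows \<open>D(p) = l p + \<Sum>\<^sub>i max(d\<^sub>i - l, 0)\<close>. Write \<open>E\<^sub>m\<close> for the span of the basis vectors of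
  degree at least \<open>m\<close>, and \<open>W\<^sub>x\<close> for the tangent space at \<open>x\<close> translated to the unit. If \<open>W\<^sub>x\<close>
  projects onto \<open>E\<^sub>l\<^sub>+\<^sub>1\<close> and injectively into \<open>E\<^sub>l\<close>, then the coordinate covectors of degree
  above \<open>l\<close> restrict to independent functionals on \<open>W\<^sub>x\<close> and can be completed by some of degree
  \<open>l\<close> to a basis of its dual. The corresponding coefficient of the tangent \<open>p\<close>-vector is a
  nonzero determinant, and the degree is \<open>D(p)\<close> (\<open>point_degree_ge\<close>). Hence at a point of lower
  degree one of two rank defects occurs: the projection to \<open>E\<^sub>l\<^sub>+\<^sub>1\<close> is not onto, or the
  projection to \<open>E\<^sub>l\<close> is not injective on \<open>W\<^sub>x\<close>.

  Each defect makes the number of \<open>d\<close>-balls of radius \<open>\<epsilon>\<close> in a cover small compared with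
  \<open>\<epsilon>\<close> to the power \<open>-D(p)\<close> (\<open>chart_cover_estimate\<close>, \<open>degenerate_piece_null\<close>). The parameter
  domain of a chart is first cut into about \<open>R\<^sup>-\<^sup>p\<close> pieces of size \<open>R = A \<epsilon>\<^sup>l\<close>. Translated to the
  unit, such a piece stays within \<open>s = B \<epsilon>\<^sup>l\<close> of \<open>W\<^sub>x\<close>, since the chart is \<open>C\<^sup>1\<close>. Left translates of
  the anisotropic box with sides proportional to \<open>\<epsilon>\<close> to the powers \<open>d\<^sub>i\<close> can only meet when
  their centres have \<open>d\<close>-distance less than \<open>\<epsilon>\<close>, by homogeneity and left invariance of \<open>d\<close>. So
  the centres of a maximal disjoint family of such translates with centres in the piece give a
  cover by \<open>d\<close>-balls, whose number is at most a constant times a volume divided by \<open>\<epsilon>\<close> to the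
  power \<open>\<Sum>\<^sub>i d\<^sub>i\<close> (\<open>box_packing_cover\<close>). Because \<open>x y = x + y + o(|x|)\<close> as \<open>y \<rightarrow> 0\<close>, multiplying by
  a small box widens the piece by comparable amounts only, so all translates lie in a tube
  about the projection of \<open>W\<^sub>x\<close> to \<open>E\<^sub>m\<close>, and the volume of the tube is governed by the dimension
  \<open>k\<close> of that projection
  (\<open>subspace_tube_volume\<close>).

  With \<open>A = B = 1\<close> the total is of order \<open>\<epsilon>\<close> to the power \<open>-D(p)\<close>. When the projection to
  \<open>E\<^sub>l\<^sub>+\<^sub>1\<close> is not onto, the choice \<open>A = 1\<close>, \<open>B = \<delta>\<close>, \<open>m = l + 1\<close> gains a factor \<open>\<delta>\<close>, because the tube
  is thin in at least one direction of \<open>E\<^sub>l\<^sub>+\<^sub>1\<close>. When the projection to \<open>E\<^sub>l\<close> is not injective,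
  the choice \<open>A = 1/\<delta>\<close>, \<open>B = 1\<close>, \<open>m = l\<close> gains \<open>\<delta>\<close>, because a piece of size \<open>R\<close> then spreads in
  at most \<open>p - 1\<close> directions of \<open>E\<^sub>l\<close> while only \<open>R\<^sup>-\<^sup>p\<close> pieces are needed. As \<open>\<delta>\<close> is
  arbitrary, both sets are null.
\<close>

section \<open>Null sets of the Hausdorff measure\<close>

lemma hausdorff_measure_eq_0I:
  assumes "\<And>\<epsilon> \<eta> :: real. 0 < \<epsilon> \<Longrightarrow> 0 < \<eta> \<Longrightarrow>
    \<exists>U. A \<subseteq> (\<Union>i::nat. U i) \<and> (\<forall>i. ediam d (U i) \<le> ennreal \<epsilon>) \<and>
      (\<Sum>i. if U i = {} then 0 else ediam d (U i) ^ k) \<le> ennreal \<eta>"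
  shows "hausdorff_measure d k A = 0"
proof -
  have "hausdorff_content d k \<epsilon> A = 0" if "0 < \<epsilon>" for \<epsilon>
  proof -
    have "hausdorff_content d k \<epsilon> A \<le> 0 + ennreal \<eta>" if "0 < \<eta>" for \<eta>
    proof -
      obtain U where "A \<subseteq> (\<Union>i::nat. U i)" "\<forall>i. ediam d (U i) \<le> ennreal \<epsilon>"
        and U: "(\<Sum>i. if U i = {} then 0 else ediam d (U i) ^ k) \<le> ennreal \<eta>"
        using assms[OF \<open>0 < \<epsilon>\<close> \<open>0 < \<eta>\<close>] by blast
      then have "hausdorff_content d k \<epsilon> A \<le> (\<Sum>i. if U i = {} then 0 else ediam d (U i) ^ k)"
        unfolding hausdorff_content_def by (intro INF_lower) auto
      then show ?thesis using U by simp
    qed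
    then have "hausdorff_content d k \<epsilon> A \<le> 0"
      by (rule ennreal_le_epsilon)
    then show ?thesis by simp
  qed
  then have "hausdorff_measure d k A \<le> 0"
    unfolding hausdorff_measure_def by (intro SUP_least) simp
  then show ?thesis by simp
qed

lemma hausdorff_measure_eq_0E:
  assumes "hausdorff_measure d k A = 0" "0 < \<epsilon>" "0 < (\<eta>::real)"
  obtains U where "A \<subseteq> (\<Union>i::nat. U i)" "\<And>i. ediam d (U i) \<le> ennreal \<epsilon>"
    "(\<Sum>i. if U i = {} then 0 else ediam d (U i) ^ k) < ennreal \<eta>"
proof -
  have "hausdorff_content d k \<epsilon> A \<le> hausdorff_measure d k A"
    unfolding hausdorff_measure_def using assms(2) by (intro SUP_upper) auto
  then have "hausdorff_content d k \<epsilon> A < ennreal \<eta>"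
    using assms by simp
  then show ?thesis
    unfolding hausdorff_content_def INF_less_iff using that by auto
qed

lemma hausdorff_measure_0_mono:
  assumes "hausdorff_measure d k B = 0" "A \<subseteq> B"
  shows "hausdorff_measure d k A = 0"
proof (rule hausdorff_measure_eq_0I)
  fix \<epsilon> \<eta> :: real assume "0 < \<epsilon>" "0 < \<eta>"
  from hausdorff_measure_eq_0E[OF assms(1) this] obtain U where
    "B \<subseteq> (\<Union>i::nat. U i)" "\<And>i. ediam d (U i) \<le> ennreal \<epsilon>"
    "(\<Sum>i. if U i = {} then 0 else ediam d (U i) ^ k) < ennreal \<eta>" by blast
  then show "\<exists>U. A \<subseteq> (\<Union>i::nat. U i) \<and> (\<forall>i. ediam d (U i) \<le> ennreal \<epsilon>) \<and>
      (\<Sum>i. if U i = {} then 0 else ediam d (U i) ^ k) \<le> ennreal \<eta>"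
    using assms(2) by (intro exI[of _ U]) auto
qed

lemma hausdorff_measure_0_UN:
  assumes "\<And>m::nat. hausdorff_measure d k (A m) = 0"
  shows "hausdorff_measure d k (\<Union>m. A m) = 0"
proof (rule hausdorff_measure_eq_0I)
  fix \<epsilon> \<eta> :: real assume "0 < \<epsilon>" "0 < \<eta>"
  have "\<exists>U. A m \<subseteq> (\<Union>i::nat. U i) \<and> (\<forall>i. ediam d (U i) \<le> ennreal \<epsilon>) \<and>
      (\<Sum>i. if U i = {} then 0 else ediam d (U i) ^ k) < ennreal (\<eta> * (1/2) ^ Suc m)" for m
  proof -
    have "0 < \<eta> * (1/2) ^ Suc m" using \<open>0 < \<eta>\<close> by simp
    show ?thesis
      by (rule hausdorff_measure_eq_0E[OF assms[of m] \<open>0 < \<epsilon>\<close> \<open>0 < \<eta> * (1/2) ^ Suc m\<close>])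
        (intro exI conjI allI)
  qed
  then have "\<forall>m. \<exists>U. A m \<subseteq> (\<Union>i::nat. U i) \<and> (\<forall>i. ediam d (U i) \<le> ennreal \<epsilon>) \<and>
      (\<Sum>i. if U i = {} then 0 else ediam d (U i) ^ k) < ennreal (\<eta> * (1/2) ^ Suc m)" by (rule allI)
  from choice[OF this] obtain U where U: "A m \<subseteq> (\<Union>i::nat. U m i)"
      "ediam d (U m i) \<le> ennreal \<epsilon>"
      "(\<Sum>i. if U m i = {} then 0 else ediam d (U m i) ^ k) < ennreal (\<eta> * (1/2) ^ Suc m)" for m i
    by blast
  define V where "V = (\<lambda>j. case_prod U (prod_decode j))"
  have "(\<Union>m. A m) \<subseteq> (\<Union>j. V j)"
  proof
    fix x assume "x \<in> (\<Union>m. A m)"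
    then obtain m i where "x \<in> U m i" using U(1) by blast
    then show "x \<in> (\<Union>j. V j)"
      by (intro UN_I[of "prod_encode (m, i)"]) (auto simp: V_def)
  qed
  moreover have "ediam d (V j) \<le> ennreal \<epsilon>" for j
    by (simp add: V_def U(2) split: prod.split)
  moreover have "(\<Sum>j. if V j = {} then 0 else ediam d (V j) ^ k) \<le> ennreal \<eta>"
  proof -
    let ?f = "\<lambda>(m, i). if U m i = {} then 0 else ediam d (U m i) ^ k"
    have "(\<Sum>j. if V j = {} then 0 else ediam d (V j) ^ k) = (\<Sum>j. ?f (prod_decode j))"
      by (intro arg_cong[where f=suminf]) (auto simp: V_def fun_eq_iff split: prod.split)
    also have "\<dots> = (\<Sum>m. \<Sum>i. ?f (m, i))"
      by (rule suminf_ennreal_2dimen) simp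
    also have "\<dots> \<le> (\<Sum>m. ennreal (\<eta> * (1/2) ^ Suc m))"
      using U(3) by (intro suminf_le) (auto intro: less_imp_le)
    also have "\<dots> = ennreal (\<Sum>m. \<eta> * (1/2) ^ Suc m)"
    proof (rule suminf_ennreal2)
      show "0 \<le> \<eta> * (1/2) ^ Suc m" for m using \<open>0 < \<eta>\<close> by simp
      show "summable (\<lambda>m. \<eta> * (1/2) ^ Suc m)"
        by (intro summable_mult sums_summable[OF power_half_series])
    qed
    also have "(\<Sum>m. \<eta> * (1/2) ^ Suc m) = \<eta>"
      using sums_mult[OF power_half_series, of \<eta>] by (simp add: sums_iff)
    finally show ?thesis .
  qed
  ultimately show "\<exists>V. (\<Union>m. A m) \<subseteq> (\<Union>j::nat. V j) \<and> (\<forall>j. ediam d (V j) \<le> ennreal \<epsilon>) \<and>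
      (\<Sum>j. if V j = {} then 0 else ediam d (V j) ^ k) \<le> ennreal \<eta>"
    by blast
qed

lemma hausdorff_measure_0_empty: "hausdorff_measure d k {} = 0"
proof (rule hausdorff_measure_eq_0I)
  fix \<epsilon> \<eta> :: real
  show "\<exists>U. {} \<subseteq> (\<Union>i::nat. U i) \<and> (\<forall>i. ediam d (U i) \<le> ennreal \<epsilon>) \<and>
      (\<Sum>i. if U i = {} then 0 else ediam d (U i) ^ k) \<le> ennreal \<eta>"
    by (rule exI[of _ "\<lambda>_. {}"]) (auto simp: ediam_def bot_ennreal)
qed

lemma hausdorff_measure_0_Un:
  assumes "hausdorff_measure d k A = 0" "hausdorff_measure d k B = 0"
  shows "hausdorff_measure d k (A \<union> B) = 0"
proof -
  have "hausdorff_measure d k (\<Union>m::nat. if m = 0 then A else B) = 0"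
    by (rule hausdorff_measure_0_UN) (use assms in auto)
  moreover have "(\<Union>m::nat. if m = 0 then A else B) = A \<union> B"
    by (auto split: if_splits)
  ultimately show ?thesis by simp
qed

text \<open>By the Lindeloef property a locally null set is a countable union of null sets, so the
  main estimate is only needed inside one chart.\<close>

lemma hausdorff_measure_0_local:
  fixes A :: "'a::second_countable_topology set"
  assumes "\<And>x. x \<in> A \<Longrightarrow> \<exists>T. open T \<and> x \<in> T \<and> hausdorff_measure d k (A \<inter> T) = 0"
  shows "hausdorff_measure d k A = 0"
proof -
  let ?F = "{T. open T \<and> hausdorff_measure d k (A \<inter> T) = 0}"
  obtain F' where F': "F' \<subseteq> ?F" "countable F'" "\<Union>F' = \<Union>?F"
    using Lindelof[of ?F] by blast
  have "A \<subseteq> \<Union>?F" using assms by blast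
  have "hausdorff_measure d k (\<Union>m. A \<inter> from_nat_into (insert {} F') m) = 0"
  proof (rule hausdorff_measure_0_UN)
    fix m
    have "from_nat_into (insert {} F') m \<in> insert {} F'"
      by (rule from_nat_into) simp
    then show "hausdorff_measure d k (A \<inter> from_nat_into (insert {} F') m) = 0"
      using F'(1) hausdorff_measure_0_empty[of d k] by auto
  qed
  moreover have "A \<subseteq> (\<Union>m. A \<inter> from_nat_into (insert {} F') m)"
    using \<open>A \<subseteq> \<Union>?F\<close> F' range_from_nat_into[of "insert {} F'"] by auto
  ultimately show ?thesis by (rule hausdorff_measure_0_mono)
qed

text \<open>A ball of radius \<open>\<epsilon>\<close> has diameter at most \<open>2 \<epsilon>\<close>, which costs only a factor \<open>2\<^sup>k\<close>; the
  counting estimates below produce covers in this form.\<close>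

lemma hausdorff_measure_0_ball_covers:
  assumes "Metric_space UNIV d" and "0 < k"
    and cover: "\<And>\<eta>. 0 < \<eta> \<Longrightarrow> \<exists>\<epsilon>0>0. \<forall>\<epsilon>. 0 < \<epsilon> \<longrightarrow> \<epsilon> < \<epsilon>0 \<longrightarrow>
      (\<exists>Z. finite Z \<and> A \<subseteq> (\<Union>z\<in>Z. {y. d z y < \<epsilon>}) \<and> real (card Z) * \<epsilon> ^ k \<le> \<eta>)"
  shows "hausdorff_measure d k A = 0"
proof (rule hausdorff_measure_eq_0I)
  have triangle: "d x z \<le> d x y + d y z" and commute: "d x y = d y x" for x y z
    using Metric_space.triangle[OF assms(1)] Metric_space.commute[OF assms(1)] by simp_all
  fix \<epsilon> \<eta> :: real assume "0 < \<epsilon>" "0 < \<eta>"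
  have "0 < \<eta> / 2 ^ k" using \<open>0 < \<eta>\<close> by simp
  from cover[OF this] obtain \<epsilon>0 where "\<epsilon>0 > 0" and \<epsilon>0: "\<And>\<epsilon>. 0 < \<epsilon> \<Longrightarrow> \<epsilon> < \<epsilon>0 \<Longrightarrow>
      \<exists>Z. finite Z \<and> A \<subseteq> (\<Union>z\<in>Z. {y. d z y < \<epsilon>}) \<and> real (card Z) * \<epsilon> ^ k \<le> \<eta> / 2 ^ k"
    by blast
  define e where "e = min (\<epsilon> / 2) (\<epsilon>0 / 2)"
  have e: "0 < e" "e < \<epsilon>0" "2 * e \<le> \<epsilon>"
    using \<open>\<epsilon>0 > 0\<close> \<open>0 < \<epsilon>\<close> by (auto simp: e_def)
  from \<epsilon>0[OF e(1,2)] obtain Z where "finite Z" and Z: "A \<subseteq> (\<Union>z\<in>Z. {y. d z y < e})"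
    "real (card Z) * e ^ k \<le> \<eta> / 2 ^ k" by blast
  obtain h where h: "bij_betw h {..<card Z} Z"
    using ex_bij_betw_nat_finite[OF \<open>finite Z\<close>] by (auto simp: atLeast0LessThan)
  define U where "U = (\<lambda>i. if i < card Z then {y. d (h i) y < e} else {})"
  have diam: "ediam d (U i) \<le> ennreal (2 * e)" for i
  proof -
    have "d x y \<le> 2 * e" if "x \<in> U i" "y \<in> U i" for x y
    proof -
      have "d x y \<le> d (h i) x + d (h i) y"
        using triangle[of x y "h i"] by (simp add: commute)
      then show ?thesis using that by (auto simp: U_def split: if_splits)
    qed
    then show ?thesis
      unfolding ediam_def by (auto intro!: SUP_least ennreal_leI)
  qed
  have "A \<subseteq> (\<Union>i. U i)"
  proof
    fix x assume "x \<in> A"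
    then obtain z where "z \<in> Z" "d z x < e" using Z(1) by blast
    then obtain i where "i < card Z" "h i = z"
      using bij_betw_imp_surj_on[OF h] by (metis imageE lessThan_iff)
    then show "x \<in> (\<Union>i. U i)" using \<open>d z x < e\<close> by (auto simp: U_def intro!: UN_I[of i])
  qed
  moreover have "ediam d (U i) \<le> ennreal \<epsilon>" for i
    using diam[of i] e by (meson ennreal_leI order_trans)
  moreover have "(\<Sum>i. if U i = {} then 0 else ediam d (U i) ^ k) \<le> ennreal \<eta>"
  proof -
    have "(\<Sum>i. if U i = {} then 0 else ediam d (U i) ^ k) =
      (\<Sum>i<card Z. if U i = {} then 0 else ediam d (U i) ^ k)"
      by (rule suminf_finite) (auto simp: U_def)
    also have "\<dots> \<le> (\<Sum>i<card Z. ennreal (2 * e) ^ k)"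
      by (intro sum_mono) (auto intro: power_mono diam)
    also have "\<dots> = ennreal (real (card Z) * (2 * e) ^ k)"
      using e by (subst ennreal_mult) (auto simp: ennreal_power ennreal_of_nat_eq_real_of_nat)
    also have "\<dots> \<le> ennreal \<eta>"
      using Z(2) by (intro ennreal_leI) (simp add: power_mult_distrib field_simps)
    finally show ?thesis .
  qed
  ultimately show "\<exists>U. A \<subseteq> (\<Union>i::nat. U i) \<and> (\<forall>i. ediam d (U i) \<le> ennreal \<epsilon>) \<and>
      (\<Sum>i. if U i = {} then 0 else ediam d (U i) ^ k) \<le> ennreal \<eta>"
    by blast
qed

section \<open>Volumes, packings and coverings\<close>

text \<open>Cover \<open>S\<close> by countably many nonoverlapping cubes of almost the same total volume. The
  image of the part of \<open>S\<close> in one cube of side \<open>s\<close> has diameter at most \<open>B n s\<close>, where \<open>n\<close> is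
  the dimension, and so lies in a cube of side \<open>2 B n s\<close>. The constant is far from sharp, but
  all volume comparisons below (rotations, left translations) only need some constant.\<close>

lemma measure_lipschitz_image_le:
  fixes f :: "'a::euclidean_space \<Rightarrow> 'a"
  assumes S: "compact S" and B: "0 < B"
    and lip: "\<And>x y. x \<in> S \<Longrightarrow> y \<in> S \<Longrightarrow> norm (f x - f y) \<le> B * norm (x - y)"
  shows "measure lebesgue (f ` S) \<le> (2 * B * DIM('a)) ^ DIM('a) * measure lebesgue S"
proof (rule field_le_epsilon)
  let ?n = "DIM('a)"
  let ?L = "(2 * B * ?n) ^ ?n"
  fix e :: real assume "0 < e"
  have Lpos: "?L > 0" using B by simp
  have "S \<in> lmeasurable" using S by (rule lmeasurable_compact)
  have "B-lipschitz_on S f"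
    using lip B by (intro lipschitz_onI) (auto simp: dist_norm)
  then have fS: "f ` S \<in> lmeasurable"
    using S by (intro lmeasurable_compact compact_continuous_image lipschitz_on_continuous_on)
  obtain T where T: "open T" "S \<subseteq> T" "T - S \<in> lmeasurable" "emeasure lebesgue (T - S) < ennreal (e / ?L)"
    using sets_lebesgue_outer_open[of S "e / ?L"] \<open>S \<in> lmeasurable\<close> \<open>0 < e\<close> Lpos
    by (auto simp: fmeasurableD)
  then have Tless: "measure lebesgue T \<le> measure lebesgue S + e / ?L" and "T \<in> lmeasurable"
  proof -
    have "T = S \<union> (T - S)" using T(2) by blast
    then show "T \<in> lmeasurable"
      using \<open>S \<in> lmeasurable\<close> T(3) by (metis fmeasurable.Un)
    have "measure lebesgue (T - S) \<le> e / ?L"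
      using T(3,4) \<open>0 < e\<close> Lpos
      by (metis divide_nonneg_pos emeasure_eq_measure2 ennreal_le_iff less_imp_le)
    moreover have "measure lebesgue T \<le> measure lebesgue S + measure lebesgue (T - S)"
      using \<open>T = S \<union> (T - S)\<close> \<open>S \<in> lmeasurable\<close> T(3) by (metis fmeasurableD measure_Un_le)
    ultimately show "measure lebesgue T \<le> measure lebesgue S + e / ?L" by simp
  qed
  have "\<exists>r>0. x \<in> S \<longrightarrow> ball x r \<subseteq> T" for x
    using T(1,2) open_contains_ball by (metis subset_iff zero_less_one)
  then obtain R where R: "\<And>x. R x > 0" "\<And>x. x \<in> S \<Longrightarrow> ball x (R x) \<subseteq> T" by metis
  have gauge: "gauge (\<lambda>x. ball x (R x))" using R(1) by (simp add: gauge_def)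
  obtain c where c: "c > 0" "S \<subseteq> cbox (-c *\<^sub>R One) (c *\<^sub>R One)"
  proof -
    obtain b where b: "\<And>x. x \<in> S \<Longrightarrow> norm x \<le> b"
      using compact_imp_bounded[OF S] bounded_iff by blast
    have "\<bar>x \<bullet> i\<bar> \<le> \<bar>b\<bar> + 1" if "x \<in> S" "i \<in> Basis" for x i
      using Basis_le_norm[OF that(2), of x] b[OF that(1)] by linarith
    then show ?thesis
      by (intro that[of "\<bar>b\<bar> + 1"]) (force simp: mem_box abs_le_iff)+
  qed
  have ne: "box (-c *\<^sub>R One) (c *\<^sub>R One :: 'a) \<noteq> {}"
    using c(1) by (simp add: box_ne_empty)
  obtain \<D> where cD: "countable \<D>"
     and cb: "\<And>K. K \<in> \<D> \<Longrightarrow> interior K \<noteq> {} \<and> (\<exists>c d. K = cbox c d)"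
     and pw: "pairwise (\<lambda>A B. interior A \<inter> interior B = {}) \<D>"
     and Ksub: "\<And>K. K \<in> \<D> \<Longrightarrow> \<exists>x \<in> S \<inter> K. K \<subseteq> ball x (R x)"
     and exN: "\<And>u v. cbox u v \<in> \<D> \<Longrightarrow>
        \<exists>n. \<forall>i \<in> Basis. v \<bullet> i - u \<bullet> i = ((c *\<^sub>R One) \<bullet> i - (-c *\<^sub>R One) \<bullet> i) / 2^n"
     and SD: "S \<subseteq> \<Union>\<D>"
    using covering_lemma [OF c(2) ne gauge] by metis
  have cube: "\<exists>z u v s. K = cbox u v \<and> s > 0 \<and> (\<forall>i\<in>Basis. v \<bullet> i - u \<bullet> i = s) \<and> z \<in> S \<and> z \<in> K"
    if K: "K \<in> \<D>" for K
  proof -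
    obtain u v where uv: "K = cbox u v" using cb[OF K] by blast
    obtain z where z: "z \<in> S" "z \<in> K" using Ksub[OF K] by blast
    obtain n where "\<And>i. i \<in> Basis \<Longrightarrow> v \<bullet> i - u \<bullet> i = 2 * c / 2^n"
      using exN[of u v] K uv by auto
    then show ?thesis
      using uv z c(1) by (intro exI[of _ z] exI[of _ u] exI[of _ v] exI[of _ "2 * c / 2^n"]) auto
  qed
  then obtain z u v s where cube: "\<And>K. K \<in> \<D> \<Longrightarrow> K = cbox (u K) (v K)" "\<And>K. K \<in> \<D> \<Longrightarrow> s K > 0"
     "\<And>K i. K \<in> \<D> \<Longrightarrow> i \<in> Basis \<Longrightarrow> v K \<bullet> i - u K \<bullet> i = s K"
     "\<And>K. K \<in> \<D> \<Longrightarrow> z K \<in> S" "\<And>K. K \<in> \<D> \<Longrightarrow> z K \<in> K"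
    by metis
  have measK: "measure lebesgue K = s K ^ ?n" if K: "K \<in> \<D>" for K
  proof -
    have "\<forall>i\<in>Basis. u K \<bullet> i \<le> v K \<bullet> i"
      using cube(2,3)[OF K] by (metis diff_ge_0_iff_ge less_imp_le)
    then have "measure lebesgue (cbox (u K) (v K)) = (\<Prod>i\<in>Basis. (v K - u K) \<bullet> i)"
      by (simp add: measure_completion content_cbox inner_diff_left)
    also have "\<dots> = s K ^ ?n"
      using cube(3)[OF K] by (simp add: inner_diff_left)
    finally show ?thesis using cube(1)[OF K] by simp
  qed
  define Q where "Q K = cbox (f (z K) - (B * ?n * s K) *\<^sub>R One) (f (z K) + (B * ?n * s K) *\<^sub>R One)" for K
  have measQ: "measure lebesgue (Q K) = ?L * measure lebesgue K" if K: "K \<in> \<D>" for K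
  proof -
    have "0 \<le> B * ?n * s K" using B cube(2)[OF K] by simp
    then have "measure lebesgue (Q K) = (\<Prod>i\<in>(Basis::'a set). 2 * B * ?n * s K)"
      unfolding Q_def
      by (subst measure_completion)
        (auto simp: content_cbox inner_diff_left inner_add_left power_mult_distrib intro!: prod.cong)
    then show ?thesis by (simp add: measK[OF K] power_mult_distrib)
  qed
  have fQ: "f ` S \<subseteq> \<Union>(Q ` \<D>)"
  proof
    fix y assume "y \<in> f ` S"
    then obtain x where x: "x \<in> S" "y = f x" by blast
    then obtain K where K: "K \<in> \<D>" "x \<in> K" using SD by blast
    have "norm (x - z K) \<le> (\<Sum>i\<in>Basis. \<bar>(x - z K) \<bullet> i\<bar>)" by (rule norm_le_l1)
    also have "\<dots> \<le> (\<Sum>i\<in>(Basis::'a set). s K)"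
    proof (rule sum_mono)
      fix i :: 'a assume i: "i \<in> Basis"
      have "u K \<bullet> i \<le> x \<bullet> i" "x \<bullet> i \<le> v K \<bullet> i" "u K \<bullet> i \<le> z K \<bullet> i" "z K \<bullet> i \<le> v K \<bullet> i"
        using K(2) cube(5)[OF K(1)] cube(1)[OF K(1)] i by (metis mem_box(2))+
      then show "\<bar>(x - z K) \<bullet> i\<bar> \<le> s K"
        using cube(3)[OF K(1) i] by (simp add: inner_diff_left abs_le_iff)
    qed
    finally have "norm (x - z K) \<le> ?n * s K" by simp
    then have "B * norm (x - z K) \<le> B * (?n * s K)"
      using B by (intro mult_left_mono) auto
    then have "norm (f x - f (z K)) \<le> B * ?n * s K"
      using lip[OF x(1) cube(4)[OF K(1)]] by (simp add: mult.assoc)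
    then have "\<bar>(f x - f (z K)) \<bullet> i\<bar> \<le> B * ?n * s K" if "i \<in> Basis" for i
      using Basis_le_norm[OF that] order_trans by blast
    then have "f x \<in> Q K"
      unfolding Q_def mem_box by (auto simp: inner_diff_left inner_add_left abs_le_iff algebra_simps)
    then show "y \<in> \<Union>(Q ` \<D>)" using x K by blast
  qed
  have KT: "K \<subseteq> T" if "K \<in> \<D>" for K
    using Ksub[OF that] R(2) by blast
  have sumK: "(\<Sum>K\<in>\<D>'. measure lebesgue K) \<le> measure lebesgue T" if D': "\<D>' \<subseteq> \<D>" "finite \<D>'" for \<D>'
  proof -
    have "(\<Sum>K\<in>\<D>'. measure lebesgue K) = measure lebesgue (\<Union>\<D>')"
    proof (rule measure_negligible_finite_Union[symmetric, OF D'(2)])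
      show "K \<in> lmeasurable" if "K \<in> \<D>'" for K
        using cb that D' by blast
      show "pairwise (\<lambda>S T. negligible (S \<inter> T)) \<D>'"
      proof (rule pairwiseI)
        fix A C assume AC: "A \<in> \<D>'" "C \<in> \<D>'" "A \<noteq> C"
        have "interior A \<inter> interior C = {}"
          using pw AC D' by (auto simp: pairwise_def)
        moreover obtain a1 a2 c1 c2 where "A = cbox a1 a2" "C = cbox c1 c2"
          using cb AC D' by (metis subsetD)
        ultimately have "A \<inter> C \<subseteq> (cbox a1 a2 - box a1 a2) \<union> (cbox c1 c2 - box c1 c2)"
          by auto
        moreover have "negligible ((cbox a1 a2 - box a1 a2) \<union> (cbox c1 c2 - box c1 c2))"
          by (intro negligible_Un negligible_frontier_interval)
        ultimately show "negligible (A \<inter> C)" using negligible_subset by blast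
      qed
    qed
    also have "\<dots> \<le> measure lebesgue T"
    proof (rule measure_mono_fmeasurable)
      show "\<Union>\<D>' \<subseteq> T" using KT D' by blast
      show "\<Union>\<D>' \<in> sets lebesgue"
        using D' cb by (intro sets.finite_Union) (auto, metis lmeasurable_cbox fmeasurableD subsetD)
    qed fact
    finally show ?thesis .
  qed
  have bound: "measure lebesgue (\<Union>D') \<le> ?L * measure lebesgue T"
    if D': "D' \<subseteq> Q ` \<D>" "finite D'" for D'
  proof -
    obtain E where E: "E \<subseteq> \<D>" "finite E" "D' = Q ` E"
      using D' by (metis finite_subset_image)
    have "measure lebesgue (\<Union>D') \<le> (\<Sum>K\<in>E. measure lebesgue (Q K))"
      unfolding E(3) using E(2) by (intro measure_UNION_le) (auto simp: Q_def)
    also have "\<dots> = ?L * (\<Sum>K\<in>E. measure lebesgue K)"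
      using E(1) measQ by (simp add: sum_distrib_left subset_iff)
    also have "\<dots> \<le> ?L * measure lebesgue T"
      using sumK[OF E(1,2)] Lpos by simp
    finally show ?thesis .
  qed
  have cQ: "countable (Q ` \<D>)" using cD by blast
  have lQ: "D \<in> lmeasurable" if "D \<in> Q ` \<D>" for D using that by (auto simp: Q_def)
  have "measure lebesgue (\<Union>(Q ` \<D>)) \<le> ?L * measure lebesgue T"
    "\<Union>(Q ` \<D>) \<in> lmeasurable"
    by (rule measure_Union_bound[OF cQ lQ bound] fmeasurable_Union_bound[OF cQ lQ bound]; assumption)+
  then have "measure lebesgue (f ` S) \<le> ?L * measure lebesgue T"
    using measure_mono_fmeasurable[OF fQ] fS by (meson fmeasurableD order_trans)
  also have "\<dots> \<le> ?L * (measure lebesgue S + e / ?L)"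
    using Tless Lpos by simp
  also have "\<dots> = ?L * measure lebesgue S + e"
    using Lpos B by (simp add: distrib_left)
  finally show "measure lebesgue (f ` S) \<le> ?L * measure lebesgue S + e" .
qed

definition orthonormal_on :: "'i set \<Rightarrow> ('i \<Rightarrow> 'a::euclidean_space) \<Rightarrow> bool" where
  "orthonormal_on I e \<longleftrightarrow> (\<forall>i\<in>I. \<forall>j\<in>I. e i \<bullet> e j = (if i = j then 1 else 0))"

text \<open>A box with axes along a frame \<open>e\<close>. The half-lengths are indexed like the frame, so that
  frames can be pieced together from several subspaces.\<close>

definition ortho_box :: "'i set \<Rightarrow> ('i \<Rightarrow> 'a::euclidean_space) \<Rightarrow> ('i \<Rightarrow> real) \<Rightarrow> 'a set" where
  "ortho_box I e t = {x. \<forall>i\<in>I. \<bar>x \<bullet> e i\<bar> \<le> t i}"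

text \<open>The isometry that takes the standard basis to the frame takes a coordinate box to this
  one. It and its inverse are Lipschitz with constant 1.\<close>

lemma ortho_box_measure:
  fixes e :: "'i \<Rightarrow> 'a::euclidean_space" and t :: "'i \<Rightarrow> real"
  assumes I: "finite I" "card I = DIM('a)" "orthonormal_on I e" and t: "\<And>i. i \<in> I \<Longrightarrow> 0 \<le> t i"
  shows "compact (ortho_box I e t)"
    and "measure lebesgue (ortho_box I e t) \<le> (4 * real DIM('a)) ^ DIM('a) * (\<Prod>i\<in>I. t i)"
    and "(\<Prod>i\<in>I. t i) \<le> real DIM('a) ^ DIM('a) * measure lebesgue (ortho_box I e t)"
proof -
  let ?n = "DIM('a)"
  obtain g where g: "bij_betw g (Basis :: 'a set) I"
    using finite_same_card_bij[of "Basis :: 'a set" I] I by auto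
  have gI: "g b \<in> I" if "b \<in> Basis" for b using g that by (rule bij_betwE[rule_format])
  have ortho: "e (g b) \<bullet> e (g c) = (if b = c then 1 else 0)" if "b \<in> Basis" "c \<in> Basis" for b c
    using I(3) gI that bij_betw_imp_inj_on[OF g] by (auto simp: orthonormal_on_def inj_on_def)
  define f where "f x = (\<Sum>b\<in>Basis. (x \<bullet> b) *\<^sub>R e (g b))" for x :: 'a
  have lin: "linear f"
    unfolding f_def by (intro linearI)
      (auto simp: inner_add_left sum.distrib scaleR_add_left scaleR_sum_right)
  have coord: "f x \<bullet> e (g b) = x \<bullet> b" if "b \<in> Basis" for x b
    using that by (simp add: f_def inner_sum_left ortho sum.delta if_distrib cong: if_cong)
  have "f x \<bullet> f x = x \<bullet> x" for x
  proof -
    have "f x \<bullet> f x = (\<Sum>b\<in>Basis. (x \<bullet> b) * (f x \<bullet> e (g b)))"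
      by (subst (2) f_def) (simp add: inner_sum_right)
    also have "\<dots> = (\<Sum>b\<in>Basis. (x \<bullet> b) * (x \<bullet> b))" by (simp add: coord)
    finally show ?thesis by (simp add: euclidean_inner[of x x])
  qed
  then have normf: "norm (f x) = norm x" for x by (simp add: norm_eq_sqrt_inner)
  have normdiff: "norm (f x - f y) = norm (x - y)" for x y
    using normf[of "x - y"] linear_diff[OF lin] by simp
  have "inj f" by (rule injI) (metis normdiff right_minus_eq norm_eq_zero)
  then have "surj f" using lin linear_injective_imp_surjective by blast
  define \<tau> where "\<tau> = (\<Sum>b\<in>Basis. t (g b) *\<^sub>R b)"
  have \<tau>: "\<tau> \<bullet> b = t (g b)" if "b \<in> Basis" for b using that by (simp add: \<tau>_def)
  have boxI: "f x \<in> ortho_box I e t \<longleftrightarrow> x \<in> cbox (-\<tau>) \<tau>" for x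
  proof -
    have "f x \<in> ortho_box I e t \<longleftrightarrow> (\<forall>b\<in>Basis. \<bar>f x \<bullet> e (g b)\<bar> \<le> t (g b))"
      using bij_betw_imp_surj_on[OF g] unfolding ortho_box_def by auto
    also have "\<dots> \<longleftrightarrow> x \<in> cbox (-\<tau>) \<tau>"
      by (auto simp: coord mem_box \<tau> abs_le_iff minus_le_iff)
    finally show ?thesis .
  qed
  have img: "ortho_box I e t = f ` cbox (-\<tau>) \<tau>"
    using boxI \<open>surj f\<close> by (auto simp: image_iff) (metis surjD)
  show comp: "compact (ortho_box I e t)"
    unfolding img using lin by (intro compact_continuous_image linear_continuous_on) 
      (auto simp: linear_conv_bounded_linear)
  have prod: "(\<Prod>b\<in>Basis. t (g b)) = (\<Prod>i\<in>I. t i)"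
    by (rule prod.reindex_bij_betw[OF g])
  have cb: "measure lebesgue (cbox (-\<tau>) \<tau>) = 2 ^ ?n * (\<Prod>i\<in>I. t i)"
  proof -
    have "\<forall>b\<in>Basis. (-\<tau>) \<bullet> b \<le> \<tau> \<bullet> b"
      using t[OF gI] by (simp add: \<tau>)
    then have "measure lebesgue (cbox (-\<tau>) \<tau>) = (\<Prod>b\<in>Basis. 2 * t (g b))"
      by (subst measure_completion) (auto simp: content_cbox inner_add_left \<tau> intro!: prod.cong)
    then show ?thesis by (simp add: prod.distrib prod)
  qed
  have "measure lebesgue (ortho_box I e t) \<le> (2 * 1 * real ?n) ^ ?n * measure lebesgue (cbox (-\<tau>) \<tau>)"
    unfolding img by (rule measure_lipschitz_image_le) (auto simp: normdiff)
  also have "\<dots> = (4 * real ?n) ^ ?n * (\<Prod>i\<in>I. t i)"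
  proof -
    have "(4 * real ?n) ^ ?n = (2 * 1 * real ?n) ^ ?n * 2 ^ ?n"
      by (subst power_mult_distrib[symmetric]) (simp add: mult.commute)
    then show ?thesis unfolding cb by simp
  qed
  finally show "measure lebesgue (ortho_box I e t) \<le> (4 * real ?n) ^ ?n * (\<Prod>i\<in>I. t i)" by simp
  have img': "cbox (-\<tau>) \<tau> = inv f ` ortho_box I e t"
    using \<open>inj f\<close> by (simp add: img image_comp)
  have "2 ^ ?n * (\<Prod>i\<in>I. t i) \<le> (2 * 1 * real ?n) ^ ?n * measure lebesgue (ortho_box I e t)"
    unfolding cb[symmetric] img'
  proof (rule measure_lipschitz_image_le)
    show "norm (inv f x - inv f y) \<le> 1 * norm (x - y)" for x y
      using normdiff[of "inv f x" "inv f y"] \<open>surj f\<close> by (simp add: surj_f_inv_f)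
  qed (use comp in auto)
  then show "(\<Prod>i\<in>I. t i) \<le> real DIM('a) ^ DIM('a) * measure lebesgue (ortho_box I e t)"
    by (simp add: power_mult_distrib)
qed

text \<open>\<open>C\<close> is an orthonormal basis of the orthogonal complement of \<open>P\<close> in \<open>E\<close>.\<close>

lemma adapted_orthonormal_basis:
  fixes P E :: "'a::euclidean_space set"
  assumes "subspace P" "subspace E" "P \<subseteq> E"
  obtains B C where "finite B" "finite C" "B \<inter> C = {}" "B \<subseteq> P" "C \<subseteq> E"
    "\<And>v y. v \<in> C \<Longrightarrow> y \<in> P \<Longrightarrow> y \<bullet> v = 0"
    "orthonormal_on (B \<union> C) (\<lambda>v. v)" "card B = dim P" "card C = dim E - dim P"
proof -
  define Q where "Q = {y \<in> E. \<forall>x\<in>P. orthogonal x y}"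
  have sQ: "subspace Q"
    using assms(2) by (auto simp: Q_def subspace_def orthogonal_clauses)
  obtain B where B: "B \<subseteq> P" "pairwise orthogonal B" "\<And>x. x \<in> B \<Longrightarrow> norm x = 1"
      "independent B" "card B = dim P" "span B = P"
    using orthonormal_basis_subspace[OF assms(1)] by metis
  obtain C where C: "C \<subseteq> Q" "pairwise orthogonal C" "\<And>x. x \<in> C \<Longrightarrow> norm x = 1"
      "independent C" "card C = dim Q" "span C = Q"
    using orthonormal_basis_subspace[OF sQ] by metis
  have dimQ: "dim Q + dim P = dim E"
    unfolding Q_def by (rule dim_subspace_orthogonal_to_vectors[OF assms])
  have BC: "x \<bullet> y = 0" if "x \<in> P" "y \<in> C" for x y
    using that C(1) by (auto simp: Q_def orthogonal_def)
  have disj: "B \<inter> C = {}"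
  proof -
    have "v \<bullet> v = 0 \<and> norm v = 1" if "v \<in> B" "v \<in> C" for v
      using BC[of v v] B(1,3) that by auto
    then show ?thesis by (metis disjoint_iff inner_eq_zero_iff norm_zero zero_neq_one)
  qed
  have on: "orthonormal_on (B \<union> C) (\<lambda>v. v)"
    unfolding orthonormal_on_def
  proof (intro ballI)
    fix v w assume vw: "v \<in> B \<union> C" "w \<in> B \<union> C"
    show "v \<bullet> w = (if v = w then 1 else 0)"
    proof (cases "v = w")
      case True
      then show ?thesis using vw B(3) C(3) by (auto simp: norm_eq_1)
    next
      case False
      then show ?thesis
        using vw B(1,2) C(2) BC by (auto simp: pairwise_def orthogonal_def) (metis inner_commute subsetD)+
    qed
  qed
  show ?thesis
  proof (rule that[of B C])
    show "finite B" "finite C" using B(4) C(4) by (auto intro: independent_imp_finite)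
    show "C \<subseteq> E" using C(1) by (auto simp: Q_def)
    show "card C = dim E - dim P" using C(5) dimQ by simp
  qed (use B disj on BC in auto)
qed

text \<open>Take a set \<open>Z\<close> of maximal cardinality whose cells are pairwise disjoint. Comparing volumes
  bounds its size, and by maximality the cell of every point of \<open>K\<close> meets a cell of a point of
  \<open>Z\<close>. Which points count as close is thus encoded in the cells; this serves both for Euclidean
  cubes and for left translates of anisotropic boxes.\<close>

lemma packing_net:
  fixes Pc :: "'b \<Rightarrow> 'a::euclidean_space set"
  assumes v: "0 < v" and T: "T \<in> lmeasurable"
    and Pc: "\<And>z. z \<in> K \<Longrightarrow> Pc z \<in> lmeasurable" "\<And>z. z \<in> K \<Longrightarrow> v \<le> measure lebesgue (Pc z)"
      "\<And>z. z \<in> K \<Longrightarrow> Pc z \<subseteq> T"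
  obtains Z where "finite Z" "Z \<subseteq> K" "real (card Z) * v \<le> measure lebesgue T"
    "\<And>w. w \<in> K \<Longrightarrow> \<exists>z\<in>Z. Pc z \<inter> Pc w \<noteq> {}"
proof -
  define sep where "sep Z \<longleftrightarrow> finite Z \<and> Z \<subseteq> K \<and> disjoint_family_on Pc Z" for Z
  have bound: "real (card Z) * v \<le> measure lebesgue T" if "sep Z" for Z
  proof -
    have Z: "finite Z" "Z \<subseteq> K" "disjoint_family_on Pc Z" using that by (auto simp: sep_def)
    have "real (card Z) * v = (\<Sum>z\<in>Z. v)" by simp
    also have "\<dots> \<le> (\<Sum>z\<in>Z. measure lebesgue (Pc z))"
      using Z Pc by (intro sum_mono) auto
    also have "\<dots> = measure lebesgue (\<Union>z\<in>Z. Pc z)"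
      using Z Pc(1) by (intro measure_UNION'[symmetric])
        (auto simp: disjoint_family_on_def pairwise_def disjnt_def)
    also have "\<dots> \<le> measure lebesgue T"
    proof (rule measure_mono_fmeasurable[OF _ _ T])
      show "(\<Union>z\<in>Z. Pc z) \<subseteq> T" using Z(2) Pc(3) by blast
      show "(\<Union>z\<in>Z. Pc z) \<in> sets lebesgue" using Z Pc(1) by (intro sets.finite_UN) auto
    qed
    finally show ?thesis .
  qed
  have "\<exists>Z. sep Z \<and> (\<forall>Y. sep Y \<longrightarrow> card Y \<le> card Z)"
  proof (rule ex_has_greatest_nat[of sep "{}" card "Suc (nat \<lceil>measure lebesgue T / v\<rceil>)"])
    show "sep {}" by (simp add: sep_def disjoint_family_on_def)
    show "\<forall>Y. sep Y \<longrightarrow> card Y < Suc (nat \<lceil>measure lebesgue T / v\<rceil>)"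
    proof (intro allI impI)
      fix Y assume "sep Y"
      then have "real (card Y) \<le> measure lebesgue T / v"
        using bound[of Y] v by (simp add: field_simps)
      then show "card Y < Suc (nat \<lceil>measure lebesgue T / v\<rceil>)" by linarith
    qed
  qed
  then obtain Z where Z: "sep Z" and max: "\<And>Y. sep Y \<Longrightarrow> card Y \<le> card Z" by blast
  have "\<exists>z\<in>Z. Pc z \<inter> Pc w \<noteq> {}" if w: "w \<in> K" for w
  proof (rule ccontr)
    assume no: "\<not> (\<exists>z\<in>Z. Pc z \<inter> Pc w \<noteq> {})"
    have "Pc w \<noteq> {}" using Pc(2)[OF w] v by auto
    then have "w \<notin> Z" using no by auto
    moreover have "sep (insert w Z)"
      using Z w no by (auto simp: sep_def disjoint_family_on_def)
    ultimately show False using max[of "insert w Z"] Z by (simp add: sep_def)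
  qed
  then show ?thesis using that[of Z] Z bound[of Z] by (auto simp: sep_def)
qed

text \<open>Cubes of side comparable to \<open>R\<close> around separated points of \<open>L\<close> lie in a slab of thickness
  \<open>R\<close> in the directions orthogonal to \<open>L\<close>. Its volume is of order \<open>R\<close> to the codimension of \<open>L\<close>,
  which leaves the power \<open>dim L\<close>. The centres must lie in \<open>S\<close>, as the rank condition is only
  available there.\<close>

lemma subspace_ball_covering_number:
  fixes L :: "'a::euclidean_space set"
  assumes L: "subspace L"
  shows "\<exists>C>0. \<forall>S R. S \<subseteq> L \<inter> cball a r \<longrightarrow> 0 < R \<longrightarrow> R \<le> 1 \<longrightarrow>
      (\<exists>Z. finite Z \<and> Z \<subseteq> S \<and> real (card Z) * R ^ dim L \<le> C \<and> S \<subseteq> (\<Union>z\<in>Z. ball z R))"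
proof -
  let ?n = "DIM('a)"
  have n: "0 < ?n" by simp
  obtain B D where BD: "finite B" "finite D" "B \<inter> D = {}" "B \<subseteq> L"
    "\<And>v y. v \<in> D \<Longrightarrow> y \<in> L \<Longrightarrow> y \<bullet> v = 0"
    "orthonormal_on (B \<union> D) (\<lambda>v. v)" "card B = dim L" "card D = ?n - dim L"
    using adapted_orthonormal_basis[OF L subspace_UNIV subset_UNIV] by (metis dim_UNIV)
  have le: "dim L \<le> ?n" using dim_subset_UNIV by blast
  define A where "A = norm a + \<bar>r\<bar> + 1"
  have A: "0 < A" by (simp add: A_def add_nonneg_pos)
  define K where "K = (4 * real ?n) ^ ?n * A ^ dim L * (3 * real ?n) ^ ?n"
  show ?thesis
  proof (intro exI[of _ "K + 1"] conjI allI impI)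
    show "0 < K + 1" using A by (simp add: K_def add_nonneg_pos)
    fix S R assume S: "S \<subseteq> L \<inter> cball a r" and R: "0 < R" "R \<le> (1::real)"
    \<comment> \<open>The cubes below then lie in balls of radius \<open>R / 3\<close>, so the centres of two cubes that
      meet are less than \<open>R\<close> apart.\<close>
    define \<rho> where "\<rho> = R / (3 * ?n)"
    have \<rho>: "0 < \<rho>" using R by (simp add: \<rho>_def)
    define Pc :: "'a \<Rightarrow> 'a set" where "Pc = (\<lambda>z. cbox (z - \<rho> *\<^sub>R One) (z + \<rho> *\<^sub>R One))"
    have Pc_dist: "norm (x - z) \<le> R / 3" if "x \<in> Pc z" for x z
    proof -
      have "\<bar>(x - z) \<bullet> i\<bar> \<le> \<rho>" if "i \<in> Basis" for i
        using \<open>x \<in> Pc z\<close> that by (auto simp: Pc_def mem_box inner_diff_left inner_add_left abs_le_iff)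
      then have "(\<Sum>i\<in>Basis. \<bar>(x - z) \<bullet> i\<bar>) \<le> (\<Sum>i\<in>(Basis::'a set). \<rho>)"
        by (rule sum_mono)
      then have "norm (x - z) \<le> ?n * \<rho>"
        using norm_le_l1[of "x - z"] by simp
      then show ?thesis using n by (simp add: \<rho>_def)
    qed
    define t where "t v = (if v \<in> B then A else R)" for v :: 'a
    define T where "T = ortho_box (B \<union> D) (\<lambda>v. v) t"
    have card: "card (B \<union> D) = ?n"
      using BD le by (simp add: card_Un_disjoint)
    have tpos: "0 \<le> t v" for v using A R by (simp add: t_def)
    have fin: "finite (B \<union> D)" using BD(1,2) by simp
    note T_facts = ortho_box_measure[OF fin card BD(6), of t, OF tpos, folded T_def]
    have "compact T" and T2: "measure lebesgue T \<le> (4 * real ?n) ^ ?n * (\<Prod>v\<in>B \<union> D. t v)"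
      using T_facts(1,2) by auto
    have "(\<Prod>v\<in>B \<union> D. t v) = (\<Prod>v\<in>B. t v) * (\<Prod>v\<in>D. t v)"
      using BD by (intro prod.union_disjoint) auto
    also have "(\<Prod>v\<in>B. t v) = A ^ dim L"
      using BD by (simp add: t_def)
    also have "(\<Prod>v\<in>D. t v) = (\<Prod>v\<in>D. R)"
      using BD by (intro prod.cong) (auto simp: t_def)
    finally have prod: "(\<Prod>v\<in>B \<union> D. t v) = A ^ dim L * R ^ (?n - dim L)"
      using BD by simp
    have PcT: "Pc z \<subseteq> T" if z: "z \<in> S" for z
    proof
      fix x assume x: "x \<in> Pc z"
      show "x \<in> T"
        unfolding T_def ortho_box_def
      proof (intro CollectI ballI)
        fix v assume v: "v \<in> B \<union> D"
        have nv: "norm v = 1" using BD(6) v by (auto simp: orthonormal_on_def norm_eq_1)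
        have *: "\<bar>y \<bullet> v\<bar> \<le> norm y" for y
          using Cauchy_Schwarz_ineq2[of y v] nv by simp
        show "\<bar>x \<bullet> v\<bar> \<le> t v"
        proof (cases "v \<in> B")
          case True
          have "norm z \<le> norm a + \<bar>r\<bar>"
          proof -
            have "dist a z \<le> r" using z S by auto
            then show ?thesis using norm_triangle_sub[of z a] by (simp add: dist_norm norm_minus_commute)
          qed
          moreover have "norm x \<le> norm z + norm (x - z)"
            by (metis norm_triangle_sub)
          ultimately show ?thesis
            using True *[of x] Pc_dist[OF x] R by (simp add: t_def A_def)
        next
          case False
          then have "x \<bullet> v = (x - z) \<bullet> v"
            using v BD(5) z S by (auto simp: inner_diff_left)
          then show ?thesis
            using False *[of "x - z"] Pc_dist[OF x] R by (simp add: t_def)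
        qed
      qed
    qed
    have measPc: "measure lebesgue (Pc z) = (2 * \<rho>) ^ ?n" for z
      unfolding Pc_def using \<rho>
      by (subst measure_completion) (auto simp: content_cbox inner_diff_left inner_add_left power_mult_distrib intro!: prod.cong)
    obtain Z where Z: "finite Z" "Z \<subseteq> S" "real (card Z) * (2 * \<rho>) ^ ?n \<le> measure lebesgue T"
      "\<And>w. w \<in> S \<Longrightarrow> \<exists>z\<in>Z. Pc z \<inter> Pc w \<noteq> {}"
    proof (rule packing_net[of "(2 * \<rho>) ^ ?n" T S Pc])
      show "T \<in> lmeasurable" using \<open>compact T\<close> by (rule lmeasurable_compact)
      show "Pc z \<in> lmeasurable" for z by (simp add: Pc_def)
    qed (use \<rho> PcT measPc in auto)
    have "S \<subseteq> (\<Union>z\<in>Z. ball z R)"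
    proof
      fix w assume "w \<in> S"
      then obtain z x where zx: "z \<in> Z" "x \<in> Pc z" "x \<in> Pc w" using Z(4) by blast
      have "norm (z - w) \<le> norm (x - z) + norm (x - w)"
        using norm_triangle_ineq4[of "x - w" "x - z"] by simp
      then have "dist z w < R"
        using Pc_dist[OF zx(2)] Pc_dist[OF zx(3)] R by (simp add: dist_norm)
      then show "w \<in> (\<Union>z\<in>Z. ball z R)" using zx(1) by auto
    qed
    moreover have "real (card Z) * R ^ dim L \<le> K + 1"
    proof -
      have "real (card Z) * \<rho> ^ ?n \<le> real (card Z) * (2 * \<rho>) ^ ?n"
        using \<rho> by (intro mult_left_mono power_mono) auto
      also have "\<dots> \<le> (4 * real ?n) ^ ?n * (A ^ dim L * R ^ (?n - dim L))"
        using Z(3) T2 prod by simp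
      finally have "real (card Z) * R ^ ?n \<le> K * R ^ (?n - dim L)"
        using n by (simp add: \<rho>_def K_def power_divide field_simps)
      moreover have "R ^ ?n = R ^ dim L * R ^ (?n - dim L)"
        using le by (simp flip: power_add)
      ultimately have "real (card Z) * R ^ dim L * R ^ (?n - dim L) \<le> K * R ^ (?n - dim L)"
        by (simp add: mult.assoc)
      then have "real (card Z) * R ^ dim L \<le> K"
        using R by (simp add: mult_le_cancel_right)
      then show ?thesis by simp
    qed
    ultimately show "\<exists>Z. finite Z \<and> Z \<subseteq> S \<and> real (card Z) * R ^ dim L \<le> K + 1 \<and> S \<subseteq> (\<Union>z\<in>Z. ball z R)"
      using Z by blast
  qed
qed

section \<open>Uniform estimates for families of continuously differentiable maps\<close>

lemma Ck_on_1D: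
  assumes "Ck_on 1 f S"
  shows "\<And>x. x \<in> S \<Longrightarrow> (f has_derivative frechet_derivative f (at x)) (at x)"
    and "\<And>v. continuous_on S (\<lambda>x. frechet_derivative f (at x) v)"
  using assms by (auto simp: frechet_derivative_works[symmetric])

lemma norm_linear_le_Basis:
  assumes "linear h" "\<And>i. i \<in> Basis \<Longrightarrow> norm (h i) \<le> c"
  shows "norm (h v) \<le> real DIM('a) * c * norm (v :: 'a::euclidean_space)"
proof -
  have "h v = (\<Sum>i\<in>Basis. (v \<bullet> i) *\<^sub>R h i)"
    by (subst euclidean_representation[of v, symmetric])
      (simp only: linear_sum[OF assms(1)] linear_scale[OF assms(1)])
  also have "norm \<dots> \<le> (\<Sum>i\<in>(Basis::'a set). norm v * c)"
    using Basis_le_norm assms(2) by (intro sum_norm_le) (auto intro!: mult_mono)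
  finally show ?thesis by (simp add: mult_ac)
qed

lemma linear_family_bounded:
  fixes D :: "'p::metric_space \<Rightarrow> 'a::euclidean_space \<Rightarrow> 'b::real_normed_vector"
  assumes A: "compact A" and lin: "\<And>p. p \<in> A \<Longrightarrow> linear (D p)"
    and cont: "\<And>i. i \<in> Basis \<Longrightarrow> continuous_on A (\<lambda>p. D p i)"
  obtains M where "0 < M" "\<And>p v. p \<in> A \<Longrightarrow> norm (D p v) \<le> M * norm v"
proof -
  have "\<exists>b. \<forall>p\<in>A. norm (D p i) \<le> b" if "i \<in> Basis" for i
    using continuous_on_compact_bound[OF A cont[OF that]] by metis
  then obtain b where b: "\<And>i p. i \<in> Basis \<Longrightarrow> p \<in> A \<Longrightarrow> norm (D p i) \<le> b i" by metis
  define c where "c = (\<Sum>i\<in>Basis. \<bar>b i\<bar>) + 1"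
  have c: "0 < c" by (simp add: c_def sum_nonneg add_nonneg_pos)
  have "norm (D p i) \<le> c" if "i \<in> Basis" "p \<in> A" for i p
  proof -
    have "\<bar>b i\<bar> \<le> (\<Sum>i\<in>Basis. \<bar>b i\<bar>)" using that by (intro member_le_sum) auto
    then show ?thesis using b[OF that] by (simp add: c_def)
  qed
  then have "norm (D p v) \<le> DIM('a) * c * norm v" if "p \<in> A" for p v
    using norm_linear_le_Basis[OF lin] that by blast
  then show ?thesis using that[of "DIM('a) * c"] c by simp
qed

text \<open>Continuity of the finitely many columns gives uniform continuity in the operator norm.\<close>

lemma linear_family_uniformly_continuous:
  fixes D :: "'p::metric_space \<Rightarrow> 'a::euclidean_space \<Rightarrow> 'b::real_normed_vector"
  assumes A: "compact A" and lin: "\<And>p. p \<in> A \<Longrightarrow> linear (D p)"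
    and cont: "\<And>i. i \<in> Basis \<Longrightarrow> continuous_on A (\<lambda>p. D p i)" and \<eta>: "0 < (\<eta>::real)"
  obtains \<rho> where "0 < \<rho>"
    "\<And>p q v. p \<in> A \<Longrightarrow> q \<in> A \<Longrightarrow> dist p q < \<rho> \<Longrightarrow> norm (D p v - D q v) \<le> \<eta> * norm v"
proof -
  define c where "c = \<eta> / DIM('a)"
  have c: "0 < c" using \<eta> by (simp add: c_def)
  have "\<exists>r>0. \<forall>p\<in>A. \<forall>q\<in>A. dist p q < r \<longrightarrow> dist (D p i) (D q i) < c" if "i \<in> Basis" for i
    using compact_uniformly_continuous[OF cont[OF that] A] c
    unfolding uniformly_continuous_on_def by (metis dist_commute)
  then obtain r where r: "\<And>i. i \<in> Basis \<Longrightarrow> r i > 0"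
    "\<And>i p q. i \<in> Basis \<Longrightarrow> p \<in> A \<Longrightarrow> q \<in> A \<Longrightarrow> dist p q < r i \<Longrightarrow> dist (D p i) (D q i) < c"
    by metis
  define \<rho> where "\<rho> = Min (r ` Basis)"
  have "0 < \<rho>" using r(1) by (simp add: \<rho>_def)
  moreover have "norm (D p v - D q v) \<le> \<eta> * norm v" if p: "p \<in> A" "q \<in> A" "dist p q < \<rho>" for p q v
  proof -
    have "norm (D p i - D q i) \<le> c" if i: "i \<in> Basis" for i
    proof -
      have "\<rho> \<le> r i" using i by (simp add: \<rho>_def)
      then show ?thesis using r(2)[OF i p(1,2)] p(3) by (simp add: dist_norm)
    qed
    moreover have "linear (\<lambda>v. D p v - D q v)" using lin p by (intro linear_compose_sub) auto
    ultimately have "norm (D p v - D q v) \<le> DIM('a) * c * norm v"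
      using norm_linear_le_Basis[of "\<lambda>v. D p v - D q v" c v] by blast
    then show ?thesis by (simp add: c_def)
  qed
  ultimately show ?thesis using that by blast
qed

lemma linear_family_continuous_apply:
  fixes D :: "'p::topological_space \<Rightarrow> 'a::euclidean_space \<Rightarrow> 'b::real_normed_vector"
  assumes lin: "\<And>p. p \<in> A \<Longrightarrow> linear (D p)"
    and cont: "\<And>i. i \<in> Basis \<Longrightarrow> continuous_on A (\<lambda>p. D p i)" and g: "continuous_on A g"
  shows "continuous_on A (\<lambda>p. D p (g p))"
proof -
  have eq: "D p (g p) = (\<Sum>i\<in>Basis. (g p \<bullet> i) *\<^sub>R D p i)" if "p \<in> A" for p
    by (subst euclidean_representation[of "g p", symmetric])
      (simp only: linear_sum[OF lin[OF that]] linear_scale[OF lin[OF that]])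
  have "continuous_on A (\<lambda>p. \<Sum>i\<in>Basis. (g p \<bullet> i) *\<^sub>R D p i)"
    using cont g by (intro continuous_intros) auto
  then show ?thesis using eq by (simp cong: continuous_on_cong)
qed

lemma uniform_lipschitz:
  fixes F :: "'p::metric_space \<Rightarrow> 'a::euclidean_space \<Rightarrow> 'b::real_normed_vector"
  assumes A: "compact A" and C: "compact C" "convex C"
    and der: "\<And>b c. b \<in> A \<Longrightarrow> c \<in> C \<Longrightarrow> (F b has_derivative DF b c) (at c)"
    and cont: "\<And>i. i \<in> Basis \<Longrightarrow> continuous_on (A \<times> C) (\<lambda>(b, c). DF b c i)"
  obtains M where "0 < M"
    "\<And>b c c'. b \<in> A \<Longrightarrow> c \<in> C \<Longrightarrow> c' \<in> C \<Longrightarrow> norm (F b c - F b c') \<le> M * norm (c - c')"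
    "\<And>b c v. b \<in> A \<Longrightarrow> c \<in> C \<Longrightarrow> norm (DF b c v) \<le> M * norm v"
proof -
  have lin: "linear (case_prod DF p)" if "p \<in> A \<times> C" for p
    using has_derivative_linear[OF der[of "fst p" "snd p"]] that by (auto simp: case_prod_unfold)
  have cont': "continuous_on (A \<times> C) (\<lambda>p. case_prod DF p i)" if "i \<in> Basis" for i
    using cont[OF that] by (simp add: case_prod_unfold)
  obtain M where M: "0 < M" "\<And>p v. p \<in> A \<times> C \<Longrightarrow> norm (case_prod DF p v) \<le> M * norm v"
    using linear_family_bounded[OF compact_Times[OF A C(1)] lin cont'] by blast
  have b: "norm (DF b c v) \<le> M * norm v" if "b \<in> A" "c \<in> C" for b c v
    using M(2)[of "(b, c)"] that by simp
  have "norm (F b c - F b c') \<le> M * norm (c - c')" if "b \<in> A" "c \<in> C" "c' \<in> C" for b c c'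
  proof (rule differentiable_bound[OF C(2)])
    show "(F b has_derivative DF b x) (at x within C)" if "x \<in> C" for x
      using der \<open>b \<in> A\<close> that has_derivative_at_withinI by blast
    show "onorm (DF b x) \<le> M" if "x \<in> C" for x
      using M(1) b[OF \<open>b \<in> A\<close> that] by (intro onorm_bound) auto
  qed fact+
  then show ?thesis using that M(1) b by blast
qed

text \<open>Mean value inequality for \<open>c \<mapsto> F b c - DF b b c\<close> on the segment from \<open>b\<close> to \<open>c\<close>. The point
  is that one \<open>\<rho>\<close> serves all base points \<open>b\<close>.\<close>

lemma uniform_first_order:
  fixes F :: "'a::euclidean_space \<Rightarrow> 'a \<Rightarrow> 'b::real_normed_vector"
  assumes C: "compact C" "convex C"
    and der: "\<And>b c. b \<in> C \<Longrightarrow> c \<in> C \<Longrightarrow> (F b has_derivative DF b c) (at c)"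
    and cont: "\<And>i. i \<in> Basis \<Longrightarrow> continuous_on (C \<times> C) (\<lambda>(b, c). DF b c i)" and \<eta>: "0 < (\<eta>::real)"
  obtains \<rho> where "0 < \<rho>"
    "\<And>b c. b \<in> C \<Longrightarrow> c \<in> C \<Longrightarrow> norm (c - b) < \<rho> \<Longrightarrow>
      norm (F b c - F b b - DF b b (c - b)) \<le> \<eta> * norm (c - b)"
proof -
  have lin: "linear (case_prod DF p)" if "p \<in> C \<times> C" for p
    using has_derivative_linear[OF der[of "fst p" "snd p"]] that by (auto simp: case_prod_unfold)
  have cont': "continuous_on (C \<times> C) (\<lambda>p. case_prod DF p i)" if "i \<in> Basis" for i
    using cont[OF that] by (simp add: case_prod_unfold)
  obtain \<rho> where \<rho>: "0 < \<rho>" "\<And>p q v. p \<in> C \<times> C \<Longrightarrow> q \<in> C \<times> C \<Longrightarrow> dist p q < \<rho> \<Longrightarrow>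
      norm (case_prod DF p v - case_prod DF q v) \<le> \<eta> * norm v"
    using linear_family_uniformly_continuous[OF compact_Times[OF C(1) C(1)] lin cont' \<eta>] by blast
  have "norm (F b c - F b b - DF b b (c - b)) \<le> \<eta> * norm (c - b)"
    if bc: "b \<in> C" "c \<in> C" "norm (c - b) < \<rho>" for b c
  proof -
    have "norm (F b c - F b b - DF b b (c - b)) \<le> norm (c - b) * \<eta>"
    proof (rule differentiable_bound_linearization[where f'="DF b" and S="closed_segment b c"])
      show "b + t *\<^sub>R (c - b) \<in> closed_segment b c" if "t \<in> {0..1}" for t
        using that by (auto simp: in_segment algebra_simps intro!: exI[of _ t])
      fix x assume x: "x \<in> closed_segment b c"
      then have xC: "x \<in> C" using C(2) bc closed_segment_subset by blast
      show "(F b has_derivative DF b x) (at x within closed_segment b c)"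
        using der[OF bc(1) xC] has_derivative_at_withinI by blast
      have "norm (x - b) \<le> norm (c - b)" using segment_bound(1)[OF x] by simp
      then have "dist (b, x) (b, b) < \<rho>" using bc(3) by (simp add: dist_Pair_Pair dist_norm)
      then have "norm (DF b x v - DF b b v) \<le> \<eta> * norm v" for v
        using \<rho>(2)[of "(b, x)" "(b, b)" v] bc xC by simp
      then show "onorm (DF b x - DF b b) \<le> \<eta>"
        using \<eta> by (intro onorm_bound) auto
    qed simp
    then show ?thesis by (simp add: mult.commute)
  qed
  then show ?thesis using that \<rho>(1) by blast
qed

section \<open>Groups with a homogeneous distance\<close>

lemma orthonormal_on_independent:
  fixes e :: "'i \<Rightarrow> 'a::euclidean_space"
  assumes "orthonormal_on I e"
  shows "inj_on e I" and "independent (e ` I)"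
proof -
  have ip: "e i \<bullet> e j = (if i = j then 1 else 0)" if "i \<in> I" "j \<in> I" for i j
    using assms that by (auto simp: orthonormal_on_def)
  show "inj_on e I" by (intro inj_onI) (metis ip zero_neq_one)
  show "independent (e ` I)"
  proof (rule pairwise_orthogonal_independent)
    show "pairwise orthogonal (e ` I)" using ip by (auto simp: pairwise_def orthogonal_def)
    show "0 \<notin> e ` I" using ip by force
  qed
qed

lemma orthonormal_on_subset: "orthonormal_on I e \<Longrightarrow> J \<subseteq> I \<Longrightarrow> orthonormal_on J e"
  unfolding orthonormal_on_def by blast

lemma orthonormal_expansion:
  fixes e :: "'i \<Rightarrow> 'a::euclidean_space"
  assumes I: "finite I" "card I = DIM('a)" "orthonormal_on I e"
  shows "(\<Sum>i\<in>I. (x \<bullet> e i) *\<^sub>R e i) = x"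
proof -
  let ?r = "x - (\<Sum>i\<in>I. (x \<bullet> e i) *\<^sub>R e i)"
  have ip: "e i \<bullet> e j = (if i = j then 1 else 0)" if "i \<in> I" "j \<in> I" for i j
    using I(3) that by (auto simp: orthonormal_on_def)
  have inj: "inj_on e I" and "independent (e ` I)"
    using orthonormal_on_independent[OF I(3)] by auto
  then have "span (e ` I) = UNIV"
    using I inj by (metis card_image dim_UNIV card_eq_dim subset_UNIV independent_imp_finite UNIV_I subset_antisym top_greatest)
  moreover have "?r \<bullet> e i = 0" if "i \<in> I" for i
    using that I(1) by (simp add: ip inner_diff_left inner_sum_left if_distrib sum.delta cong: if_cong)
  then have "?r \<bullet> y = 0" if "y \<in> span (e ` I)" for y
    using that orthogonal_to_span[of y "e ` I" ?r] by (auto simp: orthogonal_def)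
  ultimately have "?r \<bullet> ?r = 0" by blast
  then show ?thesis by simp
qed

lemma norm_le_sum_orthonormal:
  fixes e :: "'i \<Rightarrow> 'a::euclidean_space"
  assumes I: "finite I" "card I = DIM('a)" "orthonormal_on I e"
    and "\<And>i. i \<in> I \<Longrightarrow> \<bar>x \<bullet> e i\<bar> \<le> c"
  shows "norm x \<le> real DIM('a) * c"
proof -
  have "norm x = norm (\<Sum>i\<in>I. (x \<bullet> e i) *\<^sub>R e i)"
    using orthonormal_expansion[OF I] by simp
  also have "\<dots> \<le> (\<Sum>i\<in>I. c)"
  proof (intro sum_norm_le)
    fix i assume "i \<in> I"
    then show "norm ((x \<bullet> e i) *\<^sub>R e i) \<le> c"
      using assms(4) I(3) by (auto simp: orthonormal_on_def norm_eq_1[THEN iffD2])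
  qed
  finally show ?thesis using I by simp
qed

text \<open>The part of the structure that the covering argument rests on, in coordinates: \<open>X\<close> is an
  orthonormal basis with degrees \<open>deg\<close>, and homogeneity of \<open>d\<close> is stated for the distance to the
  unit.\<close>

locale homogeneous_group =
  fixes mul :: "'a::euclidean_space \<Rightarrow> 'a \<Rightarrow> 'a" and d :: "'a \<Rightarrow> 'a \<Rightarrow> real"
    and n :: nat and X :: "nat \<Rightarrow> 'a" and deg :: "nat \<Rightarrow> nat"
  assumes grp: "group mul 0 uminus"
    and C1: "Ck_on 1 (\<lambda>(x, y). mul x y) UNIV"
    and metric: "Metric_space UNIV d"
    and cont_d: "continuous_on UNIV (\<lambda>(x, y). d x y)"
    and left_invariant: "\<And>x y z. d (mul z x) (mul z y) = d x y"
    and dim_n: "n = DIM('a)"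
    and basis: "orthonormal_on {1..n} X"
    and deg_pos: "\<And>i. i \<in> {1..n} \<Longrightarrow> 1 \<le> deg i"
    and homogeneous: "\<And>r x. 0 < r \<Longrightarrow>
      d 0 (\<Sum>i=1..n. (r ^ deg i * (x \<bullet> X i)) *\<^sub>R X i) = r * d 0 x"
begin

lemma card_n: "card {1..n} = DIM('a)" by (simp add: dim_n)

lemmas expansion = orthonormal_expansion[OF finite_atLeastAtMost card_n basis]
lemmas norm_le_coords = norm_le_sum_orthonormal[OF finite_atLeastAtMost card_n basis]

lemma X_inner: "i \<in> {1..n} \<Longrightarrow> j \<in> {1..n} \<Longrightarrow> X i \<bullet> X j = (if i = j then 1 else 0)"
  using basis by (auto simp: orthonormal_on_def)

lemma coord_sum: "i \<in> {1..n} \<Longrightarrow> (\<Sum>j=1..n. c j *\<^sub>R X j) \<bullet> X i = c i"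
  by (simp add: inner_sum_left X_inner if_distrib sum.delta cong: if_cong)

lemma norm_X: "i \<in> {1..n} \<Longrightarrow> norm (X i) = 1"
  by (simp add: norm_eq_1 X_inner)

lemma coord_le_norm: "i \<in> {1..n} \<Longrightarrow> \<bar>x \<bullet> X i\<bar> \<le> norm x"
  using Cauchy_Schwarz_ineq2[of x "X i"] norm_X by simp

lemma d_triangle: "d x z \<le> d x y + d y z"
  using Metric_space.triangle[OF metric] by simp
lemma d_commute: "d x y = d y x"
  using Metric_space.commute[OF metric] by simp
lemma d_self: "d x x = 0"
  using Metric_space.mdist_zero[OF metric] by simp

lemma mul_assoc: "mul (mul x y) z = mul x (mul y z)"
  using grp by (simp add: group_def semigroup_def)
lemma mul_0_left: "mul 0 x = x" using grp by (simp add: group.group_left_neutral)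
lemma mul_uminus_left: "mul (- x) x = 0" using grp by (simp add: group.left_inverse)
lemma mul_0_right: "mul x 0 = x"
  by (metis group.left_cancel[OF grp] mul_0_left mul_assoc mul_uminus_left)
lemma mul_uminus_right: "mul x (- x) = 0"
  by (metis group.left_cancel[OF grp] mul_0_left mul_0_right mul_assoc mul_uminus_left)
lemma mul_uminus_cancel: "mul (- x) (mul x y) = y"
  by (metis mul_assoc mul_0_left mul_uminus_left)
lemma mul_cancel_uminus: "mul x (mul (- x) y) = y"
  by (metis mul_assoc mul_0_left mul_uminus_right)

definition dmul1 :: "'a \<Rightarrow> 'a \<Rightarrow> 'a \<Rightarrow> 'a" where
  "dmul1 x y u = frechet_derivative (\<lambda>(x, y). mul x y) (at (x, y)) (u, 0)"
definition dmul2 :: "'a \<Rightarrow> 'a \<Rightarrow> 'a \<Rightarrow> 'a" where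
  "dmul2 x y u = frechet_derivative (\<lambda>(x, y). mul x y) (at (x, y)) (0, u)"

lemma mul_deriv: "((\<lambda>(x, y). mul x y) has_derivative
    frechet_derivative (\<lambda>(x, y). mul x y) (at p)) (at p)"
  using Ck_on_1D(1)[OF C1] by simp

lemma dmul1: "((\<lambda>x. mul x y) has_derivative dmul1 x y) (at x)"
proof -
  have "((\<lambda>x. (x, y)) has_derivative (\<lambda>u. (u, 0))) (at x)"
    by (auto intro!: derivative_eq_intros)
  from diff_chain_at[OF this mul_deriv] show ?thesis by (simp add: o_def dmul1_def[abs_def])
qed

lemma dmul2: "((\<lambda>y. mul x y) has_derivative dmul2 x y) (at y)"
proof -
  have "((\<lambda>y. (x, y)) has_derivative (\<lambda>u. (0, u))) (at y)"
    by (auto intro!: derivative_eq_intros)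
  from diff_chain_at[OF this mul_deriv] show ?thesis by (simp add: o_def dmul2_def[abs_def])
qed

lemma cont_dmul1: "continuous_on A (\<lambda>(x, y). dmul1 x y u)"
  and cont_dmul2: "continuous_on A (\<lambda>(x, y). dmul2 x y u)"
  using Ck_on_1D(2)[OF C1] unfolding dmul1_def dmul2_def case_prod_unfold
  by (auto intro: continuous_on_subset[OF _ subset_UNIV])

lemma cont_mul: "continuous_on A (\<lambda>(x, y). mul x y)"
  by (meson UNIV_I continuous_at_imp_continuous_on has_derivative_continuous mul_deriv)

text \<open>The derivative of \<open>w \<mapsto> w b\<close> is the identity for \<open>b = 0\<close> and depends continuously on \<open>b\<close>,
  uniformly for bounded \<open>w\<close>; both sides vanish at \<open>w = 0\<close>. The bound is linear in \<open>w\<close>, which may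
  be much smaller than \<open>b\<close>.\<close>

lemma mul_close_to_addition:
  assumes "0 < (\<eta>::real)"
  obtains \<rho> where "0 < \<rho>" "\<And>w b. norm w \<le> 1 \<Longrightarrow> norm b < \<rho> \<Longrightarrow> norm (mul w b - w - b) \<le> \<eta> * norm w"
proof -
  let ?A = "cball (0::'a) 1 \<times> cball (0::'a) 1"
  have lin: "linear (case_prod dmul1 p)" for p
    using has_derivative_linear[OF dmul1] by (simp add: case_prod_unfold)
  have cont: "continuous_on ?A (\<lambda>p. case_prod dmul1 p i)" for i
    using cont_dmul1[of ?A i] by (simp add: case_prod_unfold)
  obtain \<rho> where \<rho>: "0 < \<rho>" "\<And>p q v. p \<in> ?A \<Longrightarrow> q \<in> ?A \<Longrightarrow> dist p q < \<rho> \<Longrightarrow>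
      norm (case_prod dmul1 p v - case_prod dmul1 q v) \<le> \<eta> * norm v"
    using linear_family_uniformly_continuous[OF compact_Times[OF compact_cball compact_cball] lin cont assms]
    by blast
  have id: "dmul1 x 0 v = v" for x v
  proof -
    have "((\<lambda>x. mul x 0) has_derivative (\<lambda>v. v)) (at x)" by (simp add: mul_0_right)
    then show ?thesis using has_derivative_unique[OF dmul1] by metis
  qed
  have "norm (mul w b - w - b) \<le> \<eta> * norm w" if w: "norm w \<le> 1" and b: "norm b < min \<rho> 1" for w b
  proof -
    have "norm ((mul w b - w) - (mul 0 b - 0)) \<le> \<eta> * norm (w - 0)"
    proof (rule differentiable_bound[of "cball 0 1" "\<lambda>w. mul w b - w" "\<lambda>x v. dmul1 x b v - v"])
      fix x :: 'a assume x: "x \<in> cball 0 1"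
      show "((\<lambda>w. mul w b - w) has_derivative (\<lambda>v. dmul1 x b v - v)) (at x within cball 0 1)"
        by (intro has_derivative_diff has_derivative_at_withinI[OF dmul1] has_derivative_ident)
      have "norm (dmul1 x b v - v) \<le> \<eta> * norm v" for v
        using \<rho>(2)[of "(x, b)" "(x, 0)" v] x b by (simp add: id dist_Pair_Pair dist_norm)
      then show "onorm (\<lambda>v. dmul1 x b v - v) \<le> \<eta>" using assms by (intro onorm_bound) auto
    qed (use w in auto)
    then show ?thesis by (simp add: mul_0_left)
  qed
  then show ?thesis using that[of "min \<rho> 1"] \<rho>(1) by simp
qed

definition hbox :: "real \<Rightarrow> real \<Rightarrow> 'a set" where
  "hbox c \<epsilon> = ortho_box {1..n} X (\<lambda>i. c * \<epsilon> ^ deg i)"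

text \<open>Near the unit this is continuity of \<open>d\<close>; dilating by \<open>\<epsilon>\<close> carries it to all scales.\<close>

lemma hbox_subset_ball:
  obtains c where "0 < c" "c \<le> 1" "\<And>\<epsilon> x. 0 < \<epsilon> \<Longrightarrow> x \<in> hbox c \<epsilon> \<Longrightarrow> d 0 x < \<epsilon> / 2"
proof -
  have n: "0 < real n" by (simp add: dim_n)
  have "continuous_on UNIV (\<lambda>x. case_prod d (0, x))"
    by (rule continuous_on_compose2[OF cont_d]) (auto intro!: continuous_intros)
  then have "continuous_on UNIV (\<lambda>x. d 0 x)" by simp
  then have "isCont (\<lambda>x. d 0 x) 0" by (simp add: continuous_on_eq_continuous_at)
  then obtain \<rho> where \<rho>: "\<rho> > 0" "\<And>x. norm x < \<rho> \<Longrightarrow> d 0 x < 1 / 2"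
    unfolding continuous_at_eps_delta dist_norm
    by (metis d_self diff_zero abs_less_iff half_gt_zero_iff real_norm_def zero_less_one)
  define c where "c = min 1 (\<rho> / (2 * n))"
  have c: "0 < c" "c \<le> 1" using \<rho>(1) n by (auto simp: c_def)
  have nc: "n * c < \<rho>"
  proof -
    have "n * c \<le> n * (\<rho> / (2 * n))" using n by (intro mult_left_mono) (auto simp: c_def)
    then show ?thesis using n \<rho>(1) by simp
  qed
  have "d 0 x < \<epsilon> / 2" if \<epsilon>: "0 < \<epsilon>" and x: "x \<in> hbox c \<epsilon>" for \<epsilon> x
  proof -
    define y where "y = (\<Sum>i=1..n. ((x \<bullet> X i) / \<epsilon> ^ deg i) *\<^sub>R X i)"
    have yi: "y \<bullet> X i = (x \<bullet> X i) / \<epsilon> ^ deg i" if "i \<in> {1..n}" for i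
      unfolding y_def using that by (rule coord_sum)
    have "\<bar>y \<bullet> X i\<bar> \<le> c" if "i \<in> {1..n}" for i
      using that x \<epsilon> by (auto simp: yi hbox_def ortho_box_def field_simps)
    then have "norm y \<le> n * c" using norm_le_coords[of y c] by (simp add: dim_n)
    then have "d 0 y < 1 / 2" using \<rho>(2) nc by simp
    moreover have "(\<Sum>i=1..n. (\<epsilon> ^ deg i * (y \<bullet> X i)) *\<^sub>R X i) = x"
      using \<epsilon> by (intro trans[OF sum.cong expansion[of x]]) (auto simp: yi)
    ultimately show ?thesis using homogeneous[OF \<epsilon>, of y] \<epsilon> by simp
  qed
  then show ?thesis using that c by blast
qed

text \<open>If the translates of the box by \<open>z\<close> and \<open>w\<close> meet, then \<open>d z w < \<epsilon>\<close> by left invariance.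
  Each translate has volume at least a fixed multiple of that of the box, since the box is
  recovered from it by a left translation that is Lipschitz, uniformly for \<open>z\<close> in the unit ball.
  So \<open>packing_net\<close> applies with these translates as cells.\<close>

lemma box_packing_cover:
  "\<exists>c \<kappa>. 0 < c \<and> c \<le> 1 \<and> 0 < \<kappa> \<and>
    (\<forall>\<epsilon> K T. 0 < \<epsilon> \<longrightarrow> \<epsilon> \<le> 1 \<longrightarrow> K \<subseteq> cball 0 1 \<longrightarrow> T \<in> lmeasurable \<longrightarrow>
      (\<forall>w\<in>K. \<forall>b\<in>hbox c \<epsilon>. mul w b \<in> T) \<longrightarrow>
      (\<exists>Z. finite Z \<and> Z \<subseteq> K \<and> real (card Z) * (\<kappa> * (\<Prod>i=1..n. \<epsilon> ^ deg i)) \<le> measure lebesgue T \<and>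
        K \<subseteq> (\<Union>z\<in>Z. {y. d z y < \<epsilon>})))"
proof -
  have n: "0 < real n" by (simp add: dim_n)
  obtain c where c: "0 < c" "c \<le> 1" "\<And>\<epsilon> x. 0 < \<epsilon> \<Longrightarrow> x \<in> hbox c \<epsilon> \<Longrightarrow> d 0 x < \<epsilon> / 2"
    using hbox_subset_ball by blast
  have "compact ((\<lambda>(x, y). mul x y) ` (cball 0 1 \<times> cball 0 (real n)))"
    by (intro compact_continuous_image cont_mul compact_Times compact_cball)
  then obtain r where r: "\<And>x y. norm x \<le> 1 \<Longrightarrow> norm y \<le> n \<Longrightarrow> norm (mul x y) \<le> r"
    unfolding compact_eq_bounded_closed bounded_iff by fastforce
  obtain B where B: "0 < B" "\<And>x y y'. norm x \<le> 1 \<Longrightarrow> norm y \<le> r \<Longrightarrow> norm y' \<le> r \<Longrightarrow>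
      norm (mul x y - mul x y') \<le> B * norm (y - y')"
  proof (rule uniform_lipschitz[of "cball 0 1" "cball 0 r" mul dmul2, OF compact_cball compact_cball convex_cball dmul2 cont_dmul2])
    fix M assume M: "0 < M" "\<And>b c c'. b \<in> cball 0 1 \<Longrightarrow> c \<in> cball 0 r \<Longrightarrow> c' \<in> cball 0 r \<Longrightarrow>
      norm (mul b c - mul b c') \<le> M * norm (c - c')"
    show thesis by (rule that[OF M(1) M(2)]) (simp_all add: mem_cball_0)
  qed
  \<comment> \<open>The two denominators are the constants of \<open>ortho_box_measure\<close> and of
    \<open>measure_lipschitz_image_le\<close>.\<close>
  define \<kappa> where "\<kappa> = c ^ n / (real n ^ n * (2 * B * n) ^ n)"
  show ?thesis
  proof (rule exI[of _ c], rule exI[of _ \<kappa>], intro conjI allI impI)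
    show \<kappa>: "0 < \<kappa>" using c B n by (simp add: \<kappa>_def)
    fix \<epsilon> :: real and K T :: "'a set"
    assume \<epsilon>: "0 < \<epsilon>" "\<epsilon> \<le> 1" and K: "K \<subseteq> cball 0 1" and T: "T \<in> lmeasurable"
      and KT: "\<forall>w\<in>K. \<forall>b\<in>hbox c \<epsilon>. mul w b \<in> T"
    let ?Q = "\<Prod>i=1..n. \<epsilon> ^ deg i"
    have tpos: "0 \<le> c * \<epsilon> ^ deg i" for i using c \<epsilon> by simp
    note hb = ortho_box_measure[OF finite_atLeastAtMost card_n basis, of "\<lambda>i. c * \<epsilon> ^ deg i", OF tpos, folded hbox_def]
    have hbn: "norm b \<le> n" if "b \<in> hbox c \<epsilon>" for b
    proof -
      have "\<bar>b \<bullet> X i\<bar> \<le> 1" if "i \<in> {1..n}" for i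
      proof -
        have "\<bar>b \<bullet> X i\<bar> \<le> c * \<epsilon> ^ deg i"
          using that \<open>b \<in> hbox c \<epsilon>\<close> by (auto simp: hbox_def ortho_box_def)
        also have "\<dots> \<le> 1 * 1" using c \<epsilon> by (intro mult_mono power_le_one) auto
        finally show ?thesis by simp
      qed
      then show ?thesis using norm_le_coords[of b 1] by (simp add: dim_n)
    qed
    define P where "P w = mul w ` hbox c \<epsilon>" for w
    have compP: "compact (P w)" for w
      unfolding P_def
      by (intro compact_continuous_image[OF _ hb(1)] continuous_at_imp_continuous_on ballI
          has_derivative_continuous[OF dmul2])
    have measP: "\<kappa> * ?Q \<le> measure lebesgue (P w)" if w: "w \<in> K" for w
    proof -
      have w1: "norm w \<le> 1" using K w by (auto simp: mem_cball_0)
      have "hbox c \<epsilon> = mul (- w) ` P w"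
        unfolding P_def image_comp o_def mul_uminus_cancel by simp
      also have "measure lebesgue \<dots> \<le> (2 * B * n) ^ n * measure lebesgue (P w)"
        unfolding dim_n
      proof (rule measure_lipschitz_image_le[OF compP B(1)])
        fix x y assume "x \<in> P w" "y \<in> P w"
        then show "norm (mul (- w) x - mul (- w) y) \<le> B * norm (x - y)"
          using w1 r hbn by (intro B(2)) (auto simp: P_def)
      qed
      finally have *: "measure lebesgue (hbox c \<epsilon>) \<le> (2 * B * n) ^ n * measure lebesgue (P w)" .
      have "c ^ n * ?Q \<le> real n ^ n * measure lebesgue (hbox c \<epsilon>)"
        using hb(3) by (simp add: prod.distrib dim_n)
      also have "\<dots> \<le> real n ^ n * ((2 * B * n) ^ n * measure lebesgue (P w))"
        using * by (rule mult_left_mono) simp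
      finally have "c ^ n * ?Q \<le> real n ^ n * ((2 * B * n) ^ n * measure lebesgue (P w))" .
      then show ?thesis using n B by (simp add: \<kappa>_def field_simps)
    qed
    have "0 < \<kappa> * ?Q" using \<kappa> \<epsilon> by (simp add: prod_pos)
    then obtain Z where Z: "finite Z" "Z \<subseteq> K" "real (card Z) * (\<kappa> * ?Q) \<le> measure lebesgue T"
        "\<And>w. w \<in> K \<Longrightarrow> \<exists>z\<in>Z. P z \<inter> P w \<noteq> {}"
    proof (rule packing_net[of "\<kappa> * ?Q" T K P])
      show "P z \<in> lmeasurable" for z using compP by (rule lmeasurable_compact)
      show "P z \<subseteq> T" if "z \<in> K" for z using KT that by (auto simp: P_def)
    qed (use T measP in auto)
    have "K \<subseteq> (\<Union>z\<in>Z. {y. d z y < \<epsilon>})"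
    proof
      fix w assume "w \<in> K"
      then obtain z b b' where z: "z \<in> Z" "b \<in> hbox c \<epsilon>" "b' \<in> hbox c \<epsilon>" "mul z b = mul w b'"
        using Z(4) unfolding P_def by blast
      have "d z w \<le> d z (mul z b) + d (mul w b') w" using d_triangle[of z w "mul z b"] z(4) by simp
      also have "d z (mul z b) = d 0 b" using left_invariant[of z 0 b] by (simp add: mul_0_right)
      also have "d (mul w b') w = d 0 b'" using left_invariant[of w 0 b'] d_commute by (simp add: mul_0_right)
      finally have "d z w < \<epsilon>" using c(3)[OF \<epsilon>(1) z(2)] c(3)[OF \<epsilon>(1) z(3)] by simp
      then show "w \<in> (\<Union>z\<in>Z. {y. d z y < \<epsilon>})" using z(1) by auto
    qed
    then show "\<exists>Z. finite Z \<and> Z \<subseteq> K \<and> real (card Z) * (\<kappa> * ?Q) \<le> measure lebesgue T \<and>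
        K \<subseteq> (\<Union>z\<in>Z. {y. d z y < \<epsilon>})" using Z by blast
  qed fact+
qed

end

section \<open>Volumes of tubes in graded coordinates\<close>

context homogeneous_group
begin

definition high :: "nat \<Rightarrow> nat set" where "high m = {i \<in> {1..n}. m \<le> deg i}"
definition low :: "nat \<Rightarrow> nat set" where "low m = {i \<in> {1..n}. deg i < m}"

definition high_proj :: "nat \<Rightarrow> 'a \<Rightarrow> 'a" where
  "high_proj m x = (\<Sum>i\<in>high m. (x \<bullet> X i) *\<^sub>R X i)"

lemma high_low: "finite (high m)" "finite (low m)" "high m \<inter> low m = {}" "low m \<union> high m = {1..n}"
  "high m \<subseteq> {1..n}" "low m \<subseteq> {1..n}"
  by (auto simp: high_def low_def)

lemma linear_proj: "linear (high_proj m)"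
  unfolding high_proj_def
  by (intro linearI) (auto simp: inner_add_left sum.distrib scaleR_add_left scaleR_sum_right)

lemma proj_inner_X: "i \<in> {1..n} \<Longrightarrow> high_proj m x \<bullet> X i = (if m \<le> deg i then x \<bullet> X i else 0)"
proof -
  assume i: "i \<in> {1..n}"
  have "high_proj m x \<bullet> X i = (\<Sum>j\<in>high m. if j = i then x \<bullet> X j else 0)"
    unfolding high_proj_def inner_sum_left using high_low(5)[of m] i
    by (intro sum.cong) (auto simp: X_inner subset_iff)
  then show ?thesis using i by (simp add: high_low(1)) (auto simp: high_def)
qed

lemma proj_inner_commute: "high_proj m x \<bullet> y = x \<bullet> high_proj m y"
  by (simp add: high_proj_def inner_sum_left inner_sum_right inner_commute mult.commute)

lemma proj_idem: "high_proj m (high_proj m x) = high_proj m x"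
  unfolding high_proj_def[of m "high_proj m x"] using high_low(5)[of m]
  by (subst high_proj_def, intro sum.cong) (auto simp: proj_inner_X high_def)

lemma norm_proj_le: "norm (high_proj m x) \<le> norm x"
proof -
  have "norm (high_proj m x) * norm (high_proj m x) = high_proj m x \<bullet> x"
    by (metis proj_inner_commute proj_idem norm_cauchy_schwarz power2_norm_eq_inner power2_eq_square)
  also have "\<dots> \<le> norm (high_proj m x) * norm x" by (rule norm_cauchy_schwarz)
  finally show ?thesis by (metis mult_le_cancel_left_pos norm_ge_zero norm_le_zero_iff not_less norm_zero order_le_less)
qed

lemma subspace_range_proj: "subspace (range (high_proj m))"
  using linear_proj linear_subspace_image subspace_UNIV by blast

lemma proj_X: "i \<in> high m \<Longrightarrow> high_proj m (X i) = X i"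
proof -
  assume i: "i \<in> high m"
  have "high_proj m (X i) = (\<Sum>j\<in>high m. if j = i then X i else 0)"
    unfolding high_proj_def using i high_low(5)[of m] by (intro sum.cong) (auto simp: X_inner subset_iff)
  then show ?thesis using i high_low(1) by simp
qed

lemma X_high: "inj_on X (high m)" "independent (X ` high m)" "X ` high m \<subseteq> range (high_proj m)"
proof -
  have "orthonormal_on (high m) X" using basis high_low(5) by (rule orthonormal_on_subset)
  then show "inj_on X (high m)" "independent (X ` high m)" by (rule orthonormal_on_independent)+
  show "X ` high m \<subseteq> range (high_proj m)" using proj_X by (metis image_subsetI rangeI)
qed

lemma dim_range_proj: "dim (range (high_proj m)) = card (high m)"
proof -
  have "range (high_proj m) = span (X ` high m)"
  proof
    show "range (high_proj m) \<subseteq> span (X ` high m)"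
      unfolding high_proj_def by (intro image_subsetI span_sum span_scale span_base imageI)
    show "span (X ` high m) \<subseteq> range (high_proj m)"
      using X_high(3) subspace_range_proj by (rule span_minimal)
  qed
  then show ?thesis
    using dim_span_eq_card_independent[OF X_high(2)] X_high(1) by (simp add: card_image del: dim_span)
qed

text \<open>Use the frame that consists of the basis vectors of low degree, an orthonormal basis of
  \<open>P\<close>, and one of the complement of \<open>P\<close> in the range of the projection. The set has size at most
  \<open>2 R\<close> along \<open>P\<close> and \<open>s\<close> along the complement. If \<open>dim P < k\<close>, the bound for dimension \<open>k\<close> is
  only larger, as \<open>s \<le> R\<close>.\<close>

lemma subspace_tube_volume:
  assumes P: "subspace P" "P \<subseteq> range (high_proj m)" "dim P \<le> k" and k: "k \<le> card (high m)"
    and s: "0 < s" "s \<le> R" and t: "\<And>i. i \<in> low m \<Longrightarrow> 0 \<le> t i"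
  obtains T where "T \<in> lmeasurable"
    "{x. (\<forall>i\<in>low m. \<bar>x \<bullet> X i\<bar> \<le> t i) \<and> (\<exists>q\<in>P. norm q \<le> R \<and> norm (high_proj m x - q) \<le> s)} \<subseteq> T"
    "measure lebesgue T \<le> (8 * real n) ^ n * (\<Prod>i\<in>low m. t i) * (R ^ k * s ^ (card (high m) - k))"
proof -
  obtain B C where BC: "finite B" "finite C" "B \<inter> C = {}" "B \<subseteq> P" "C \<subseteq> range (high_proj m)"
    "\<And>v y. v \<in> C \<Longrightarrow> y \<in> P \<Longrightarrow> y \<bullet> v = 0"
    "orthonormal_on (B \<union> C) (\<lambda>v. v)" "card B = dim P" "card C = dim (range (high_proj m)) - dim P"
    using adapted_orthonormal_basis[OF P(1) subspace_range_proj P(2)] by metis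
  have BCr: "B \<union> C \<subseteq> range (high_proj m)" using BC(4,5) P(2) by blast
  have n: "1 \<le> n" by (simp add: dim_n)
  have ip: "v \<bullet> w = (if v = w then 1 else 0)" if "v \<in> B \<union> C" "w \<in> B \<union> C" for v w
    using BC(7) that by (auto simp: orthonormal_on_def)
  have perp: "X i \<bullet> v = 0" if "i \<in> low m" "v \<in> B \<union> C" for i v
  proof -
    have "v \<in> range (high_proj m)" using BCr that(2) by blast
    then obtain u where u: "v = high_proj m u" by blast
    have "high_proj m u \<bullet> X i = 0" using that(1) by (subst proj_inner_X) (auto simp: low_def)
    then show ?thesis using u by (simp add: inner_commute)
  qed
  have inj: "inj_on X (low m)"
    by (intro inj_onI) (metis X_inner high_low(6) subsetD zero_neq_one)
  define J where "J = X ` low m \<union> (B \<union> C)"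
  have disj: "X ` low m \<inter> (B \<union> C) = {}"
  proof (rule ccontr)
    assume "X ` low m \<inter> (B \<union> C) \<noteq> {}"
    then obtain i where "i \<in> low m" "X i \<in> B \<union> C" by blast
    then show False using perp[of i "X i"] ip[of "X i" "X i"] by simp
  qed
  have fin: "finite J" using BC high_low by (simp add: J_def)
  have le: "dim P \<le> card (high m)" using P(3) k by simp
  have "card J = card (low m) + (card B + card C)"
    using disj BC(1-3) inj high_low(2) by (simp add: J_def card_Un_disjoint card_image)
  also have "\<dots> = card (low m) + card (high m)" using BC(8,9) le by (simp add: dim_range_proj)
  also have "\<dots> = n" using high_low[of m] card_Un_disjoint[of "low m" "high m"] by (simp add: Int_commute)
  finally have card: "card J = DIM('a)" by (simp add: dim_n)
  have on: "orthonormal_on J (\<lambda>v. v)"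
    unfolding orthonormal_on_def
  proof (intro ballI)
    fix v w assume "v \<in> J" "w \<in> J"
    then consider (a) i j where "i \<in> low m" "j \<in> low m" "v = X i" "w = X j"
      | (b) i where "i \<in> low m" "v = X i" "w \<in> B \<union> C"
      | (c) i where "i \<in> low m" "w = X i" "v \<in> B \<union> C"
      | (d) "v \<in> B \<union> C" "w \<in> B \<union> C" unfolding J_def by blast
    then show "v \<bullet> w = (if v = w then 1 else 0)"
    proof cases
      case a
      then have "i \<in> {1..n}" "j \<in> {1..n}" using high_low(6) by blast+
      then show ?thesis using a X_inner[of i j] X_inner[of j j] by auto
    next
      case b
      then show ?thesis using perp disj by auto
    next
      case c
      then show ?thesis using perp disj by (auto simp: inner_commute)
    next
      case d
      then show ?thesis by (rule ip)
    qed
  qed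
  define \<tau> where "\<tau> v = (if v \<in> B then 2 * R else if v \<in> C then s else t (inv_into (low m) X v))" for v
  have \<tau>X: "\<tau> (X i) = t i" if "i \<in> low m" for i
    using that disj inj by (auto simp: \<tau>_def)
  have \<tau>pos: "0 \<le> \<tau> v" if "v \<in> J" for v
    using that s t \<tau>X unfolding J_def by (fastforce simp: \<tau>_def)
  have facts: "compact (ortho_box J (\<lambda>v. v) \<tau>)"
    "measure lebesgue (ortho_box J (\<lambda>v. v) \<tau>) \<le> (4 * real n) ^ n * (\<Prod>v\<in>J. \<tau> v)"
    using ortho_box_measure(1,2)[OF fin card on, of \<tau>] \<tau>pos by (simp_all add: dim_n)
  show ?thesis
  proof (rule that)
    show "ortho_box J (\<lambda>v. v) \<tau> \<in> lmeasurable" using facts(1) by (rule lmeasurable_compact)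
    show "{x. (\<forall>i\<in>low m. \<bar>x \<bullet> X i\<bar> \<le> t i) \<and> (\<exists>q\<in>P. norm q \<le> R \<and> norm (high_proj m x - q) \<le> s)}
      \<subseteq> ortho_box J (\<lambda>v. v) \<tau>"
    proof
      fix x assume "x \<in> {x. (\<forall>i\<in>low m. \<bar>x \<bullet> X i\<bar> \<le> t i) \<and> (\<exists>q\<in>P. norm q \<le> R \<and> norm (high_proj m x - q) \<le> s)}"
      then obtain q where x: "\<And>i. i \<in> low m \<Longrightarrow> \<bar>x \<bullet> X i\<bar> \<le> t i"
        and q: "q \<in> P" "norm q \<le> R" "norm (high_proj m x - q) \<le> s" by blast
      have "\<bar>x \<bullet> v\<bar> \<le> \<tau> v" if "v \<in> J" for v
      proof (cases "v \<in> B \<union> C")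
        case False
        then show ?thesis using that x \<tau>X by (auto simp: J_def)
      next
        case True
        then obtain u where "v = high_proj m u" using BCr by blast
        then have xv: "x \<bullet> v = high_proj m x \<bullet> v"
          by (simp add: proj_inner_commute proj_idem)
        have nv: "norm v = 1" using ip[OF True True] by (simp add: norm_eq_1)
        have cs: "\<bar>y \<bullet> v\<bar> \<le> norm y" for y using Cauchy_Schwarz_ineq2[of y v] nv by simp
        show ?thesis
        proof (cases "v \<in> B")
          case True
          have "norm (high_proj m x) \<le> norm q + norm (high_proj m x - q)" by (rule norm_triangle_sub)
          then show ?thesis using True xv cs[of "high_proj m x"] q s by (simp add: \<tau>_def)
        next
          case False
          then have "v \<in> C" using \<open>v \<in> B \<union> C\<close> by blast
          then have "x \<bullet> v = (high_proj m x - q) \<bullet> v" using xv BC(6) q(1) by (simp add: inner_diff_left)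
          then show ?thesis using cs[of "high_proj m x - q"] q(3) False \<open>v \<in> C\<close> by (simp add: \<tau>_def)
        qed
      qed
      then show "x \<in> ortho_box J (\<lambda>v. v) \<tau>" by (simp add: ortho_box_def)
    qed
    have "(\<Prod>v\<in>J. \<tau> v) = (\<Prod>v\<in>X ` low m. \<tau> v) * ((\<Prod>v\<in>B. \<tau> v) * (\<Prod>v\<in>C. \<tau> v))"
      unfolding J_def using disj BC(1-3) high_low(2) by (simp add: prod.union_disjoint)
    also have "(\<Prod>v\<in>X ` low m. \<tau> v) = (\<Prod>i\<in>low m. t i)"
      using inj \<tau>X by (simp add: prod.reindex)
    also have "(\<Prod>v\<in>B. \<tau> v) = (2 * R) ^ dim P" using BC(8) by (simp add: \<tau>_def)
    also have "(\<Prod>v\<in>C. \<tau> v) = (\<Prod>v\<in>C. s)" using BC(3) by (intro prod.cong) (auto simp: \<tau>_def)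
    also have "\<dots> = s ^ (card (high m) - dim P)" using BC(9) by (simp add: dim_range_proj)
    also have "(2 * R) ^ dim P * s ^ (card (high m) - dim P) \<le> 2 ^ n * (R ^ k * s ^ (card (high m) - k))"
    proof -
      have "s ^ (card (high m) - dim P) = s ^ (k - dim P) * s ^ (card (high m) - k)"
        using P(3) k by (simp flip: power_add)
      also have "\<dots> \<le> R ^ (k - dim P) * s ^ (card (high m) - k)"
        using s by (intro mult_right_mono power_mono) auto
      finally have "R ^ dim P * s ^ (card (high m) - dim P) \<le> R ^ dim P * (R ^ (k - dim P) * s ^ (card (high m) - k))"
        using s by (intro mult_left_mono) auto
      also have "\<dots> = (R ^ dim P * R ^ (k - dim P)) * s ^ (card (high m) - k)"
        by (simp only: mult.assoc)
      also have "R ^ dim P * R ^ (k - dim P) = R ^ k"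
        using P(3) by (simp flip: power_add)
      finally have 1: "R ^ dim P * s ^ (card (high m) - dim P) \<le> R ^ k * s ^ (card (high m) - k)" .
      have "dim P \<le> n" unfolding dim_n by (rule dim_subset_UNIV)
      then have 2: "(2::real) ^ dim P \<le> 2 ^ n" by (intro power_increasing) auto
      have "2 ^ dim P * (R ^ dim P * s ^ (card (high m) - dim P)) \<le> 2 ^ n * (R ^ k * s ^ (card (high m) - k))"
        using s by (intro mult_mono[OF 2 1]) auto
      then show ?thesis by (simp add: power_mult_distrib mult.assoc)
    qed
    finally have "(\<Prod>v\<in>J. \<tau> v) \<le> (\<Prod>i\<in>low m. t i) * (2 ^ n * (R ^ k * s ^ (card (high m) - k)))"
      using t by (simp add: mult_left_mono prod_nonneg)
    then have "(4 * real n) ^ n * (\<Prod>v\<in>J. \<tau> v) \<le>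
       (4 * real n) ^ n * ((\<Prod>i\<in>low m. t i) * (2 ^ n * (R ^ k * s ^ (card (high m) - k))))"
      by (rule mult_left_mono) simp
    also have "\<dots> = (8 * real n) ^ n * (\<Prod>i\<in>low m. t i) * (R ^ k * s ^ (card (high m) - k))"
    proof -
      have eq: "(8 * real n) ^ n = (4 * real n) ^ n * 2 ^ n"
        by (subst power_mult_distrib[symmetric]) (simp add: mult.commute)
      show ?thesis unfolding eq by (simp only: mult_ac)
    qed
    finally show "measure lebesgue (ortho_box J (\<lambda>v. v) \<tau>)
      \<le> (8 * real n) ^ n * (\<Prod>i\<in>low m. t i) * (R ^ k * s ^ (card (high m) - k))"
      by (rule order_trans[OF facts(2)])
  qed
qed

end

section \<open>Covering charts with degenerate tangent spaces\<close>

context homogeneous_group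
begin

text \<open>The derivative at \<open>c\<close> of the chart \<open>\<Psi>\<close> followed by the left translation that takes \<open>\<Psi> b\<close>
  to the unit. For \<open>c = b\<close> its image of \<open>L\<close> is the translated tangent space.\<close>

definition chart_deriv :: "('a \<Rightarrow> 'a) \<Rightarrow> 'a \<Rightarrow> 'a \<Rightarrow> 'a \<Rightarrow> 'a" where
  "chart_deriv \<Psi> b c v = dmul2 (- \<Psi> b) (\<Psi> c) (frechet_derivative \<Psi> (at c) v)"

lemma chart_deriv:
  assumes "Ck_on 1 \<Psi> U" "c \<in> U"
  shows "((\<lambda>c. mul (- \<Psi> b) (\<Psi> c)) has_derivative chart_deriv \<Psi> b c) (at c)"
  using diff_chain_at[OF Ck_on_1D(1)[OF assms] dmul2, of "- \<Psi> b"]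
  by (simp add: o_def chart_deriv_def[abs_def])

lemma continuous_on_chart_deriv:
  assumes \<Psi>: "Ck_on 1 \<Psi> U" and C: "C \<subseteq> U"
  shows "continuous_on (C \<times> C) (\<lambda>(b, c). chart_deriv \<Psi> b c v)"
proof -
  have "continuous_on U \<Psi>"
    using Ck_on_1D(1)[OF \<Psi>] has_derivative_continuous continuous_at_imp_continuous_on by blast
  then have c\<Psi>: "continuous_on C \<Psi>" using C continuous_on_subset by blast
  have cg: "continuous_on C (\<lambda>c. frechet_derivative \<Psi> (at c) v)"
    using Ck_on_1D(2)[OF \<Psi>] C continuous_on_subset by blast
  have 1: "continuous_on (C \<times> C) (\<lambda>p. \<Psi> (fst p))" "continuous_on (C \<times> C) (\<lambda>p. \<Psi> (snd p))"
    "continuous_on (C \<times> C) (\<lambda>p. frechet_derivative \<Psi> (at (snd p)) v)"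
    by (rule continuous_on_compose2[OF c\<Psi>] continuous_on_compose2[OF cg];
        force intro: continuous_intros)+
  have "continuous_on (C \<times> C) (\<lambda>p. dmul2 (- \<Psi> (fst p)) (\<Psi> (snd p)) (frechet_derivative \<Psi> (at (snd p)) v))"
  proof (rule linear_family_continuous_apply[where D = "\<lambda>p. dmul2 (- \<Psi> (fst p)) (\<Psi> (snd p))"])
    show "linear (dmul2 (- \<Psi> (fst p)) (\<Psi> (snd p)))" for p
      using dmul2 has_derivative_linear by blast
    fix i :: 'a
    have "continuous_on (C \<times> C) (\<lambda>p. (\<lambda>(x, y). dmul2 x y i) (- \<Psi> (fst p), \<Psi> (snd p)))"
      by (rule continuous_on_compose2[OF cont_dmul2[of UNIV]]) (auto intro!: continuous_intros 1)
    then show "continuous_on (C \<times> C) (\<lambda>p. dmul2 (- \<Psi> (fst p)) (\<Psi> (snd p)) i)" by simp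
  qed (rule 1)
  then show ?thesis by (simp add: case_prod_unfold chart_deriv_def)
qed

text \<open>The alternative on \<open>m\<close>, \<open>A\<close> and \<open>B\<close> describes exactly the two regimes in which the scales
  fit: for small \<open>\<epsilon>\<close> one has \<open>A \<epsilon>\<^sup>l \<le> \<epsilon>\<^sup>j\<close> for all degrees \<open>j < m\<close>, so that in the coordinates
  of low degree a piece of size \<open>A \<epsilon>\<^sup>l\<close> is no longer than the box, and \<open>\<epsilon>\<^sup>m \<le> B \<epsilon>\<^sup>l\<close>, so that in
  the coordinates of high degree the box is no wider than the tube. That \<open>C0\<close> is chosen before
  \<open>A\<close> and \<open>B\<close> lets these be used to gain a small factor.\<close>

lemma chart_cover_estimate:
  assumes \<Psi>: "Ck_on 1 \<Psi> U" and ball: "cball a r \<subseteq> U" and L: "subspace L"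
    and k: "k \<le> card (high m)" and l: "1 \<le> l"
  shows "\<exists>C0>0. \<forall>A B S. 1 \<le> A \<longrightarrow> 0 < B \<longrightarrow> B \<le> 1 \<longrightarrow> m = Suc l \<and> A = 1 \<or> m = l \<and> B = 1 \<longrightarrow>
      S \<subseteq> L \<inter> cball a r \<longrightarrow> (\<forall>b\<in>S. dim (high_proj m ` chart_deriv \<Psi> b b ` L) \<le> k) \<longrightarrow>
      (\<exists>\<epsilon>0>0. \<forall>\<epsilon>. 0 < \<epsilon> \<longrightarrow> \<epsilon> < \<epsilon>0 \<longrightarrow>
        (\<exists>Z. finite Z \<and> \<Psi> ` S \<subseteq> (\<Union>z\<in>Z. {y. d z y < \<epsilon>}) \<and>
          real (card Z) * (A * \<epsilon> ^ l) ^ dim L * (\<Prod>i\<in>high m. \<epsilon> ^ deg i)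
            \<le> C0 * ((A * \<epsilon> ^ l) ^ k * (B * \<epsilon> ^ l) ^ (card (high m) - k))))"
proof -
  let ?C = "cball a r"
  let ?F = "\<lambda>b c. mul (- \<Psi> b) (\<Psi> c)"
  let ?e = "card (high m) - k"
  have n: "1 \<le> real n" by (simp add: dim_n)
  have der: "(?F b has_derivative chart_deriv \<Psi> b c) (at c)" if "c \<in> ?C" for b c
    using chart_deriv[OF \<Psi>] ball that by blast
  have lin: "linear (chart_deriv \<Psi> b c)" if "c \<in> ?C" for b c
    using der[OF that] has_derivative_linear by blast
  note cont = continuous_on_chart_deriv[OF \<Psi> ball]
  obtain M' where M': "0 < M'"
    "\<And>b c c'. b \<in> ?C \<Longrightarrow> c \<in> ?C \<Longrightarrow> c' \<in> ?C \<Longrightarrow> norm (?F b c - ?F b c') \<le> M' * norm (c - c')"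
    "\<And>b c v. b \<in> ?C \<Longrightarrow> c \<in> ?C \<Longrightarrow> norm (chart_deriv \<Psi> b c v) \<le> M' * norm v"
    using uniform_lipschitz[of ?C ?C ?F "chart_deriv \<Psi>", OF compact_cball compact_cball convex_cball der cont]
    by blast
  define M where "M = max 1 M'"
  have M1: "1 \<le> M" by (simp add: M_def)
  have M2: "norm (?F b c) \<le> M * norm (c - b)" if "b \<in> ?C" "c \<in> ?C" for b c
  proof -
    have "norm (?F b c) \<le> M' * norm (c - b)"
      using M'(2)[OF that(1) that(2) that(1)] by (simp add: mul_uminus_left)
    also have "\<dots> \<le> M * norm (c - b)" by (intro mult_right_mono) (auto simp: M_def)
    finally show ?thesis .
  qed
  have M3: "norm (chart_deriv \<Psi> b b v) \<le> M * norm v" if "b \<in> ?C" for b v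
  proof -
    have "norm (chart_deriv \<Psi> b b v) \<le> M' * norm v" using M'(3)[OF that that] .
    also have "\<dots> \<le> M * norm v" by (intro mult_right_mono) (auto simp: M_def)
    finally show ?thesis .
  qed
  obtain c \<kappa> where c: "0 < c" "c \<le> 1" and \<kappa>: "0 < \<kappa>"
    and pack: "\<forall>\<epsilon> K T. 0 < \<epsilon> \<longrightarrow> \<epsilon> \<le> 1 \<longrightarrow> K \<subseteq> cball 0 1 \<longrightarrow> T \<in> lmeasurable \<longrightarrow>
      (\<forall>w\<in>K. \<forall>b\<in>hbox c \<epsilon>. mul w b \<in> T) \<longrightarrow>
      (\<exists>Z. finite Z \<and> Z \<subseteq> K \<and> real (card Z) * (\<kappa> * (\<Prod>i=1..n. \<epsilon> ^ deg i)) \<le> measure lebesgue T \<and>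
        K \<subseteq> (\<Union>z\<in>Z. {y. d z y < \<epsilon>}))"
    using box_packing_cover by (elim exE conjE) (rule that)
  obtain C1 where C1: "0 < C1" "\<forall>S R. S \<subseteq> L \<inter> ?C \<longrightarrow> 0 < R \<longrightarrow> R \<le> 1 \<longrightarrow>
      (\<exists>Z. finite Z \<and> Z \<subseteq> S \<and> real (card Z) * R ^ dim L \<le> C1 \<and> S \<subseteq> (\<Union>z\<in>Z. ball z R))"
    using subspace_ball_covering_number[OF L, of a r] by blast
  define C2 where "C2 = (8 * real n) ^ n * (M + 2) ^ card (low m) * ((M + n + 2) ^ k * (n + 2) ^ ?e) / \<kappa>"
  have C2: "0 < C2" using n M1 \<kappa> by (simp add: C2_def)
  show ?thesis
  proof (rule exI[of _ "C1 * C2"], intro conjI allI impI)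
    show "0 < C1 * C2" using C1 C2 by simp
    fix A B :: real and S
    assume A: "1 \<le> A" and B: "0 < B" "B \<le> 1" and m: "m = Suc l \<and> A = 1 \<or> m = l \<and> B = 1"
      and S: "S \<subseteq> L \<inter> ?C" and rank: "\<forall>b\<in>S. dim (high_proj m ` chart_deriv \<Psi> b b ` L) \<le> k"
    have "0 < B / A" using A B by simp
    then obtain \<rho>1 where \<rho>1: "0 < \<rho>1" "\<And>b c. b \<in> ?C \<Longrightarrow> c \<in> ?C \<Longrightarrow> norm (c - b) < \<rho>1 \<Longrightarrow>
      norm (?F b c - ?F b b - chart_deriv \<Psi> b b (c - b)) \<le> B / A * norm (c - b)"
      using uniform_first_order[of ?C ?F "chart_deriv \<Psi>", OF compact_cball convex_cball der cont] by blast
    have "0 < B / (A * M)" using A B M1 by simp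
    then obtain \<rho>2 where \<rho>2: "0 < \<rho>2"
      "\<And>w b. norm w \<le> 1 \<Longrightarrow> norm b < \<rho>2 \<Longrightarrow> norm (mul w b - w - b) \<le> B / (A * M) * norm w"
      using mul_close_to_addition by blast
    \<comment> \<open>In this order, the bounds on \<open>\<epsilon>\<close> ensure that powers of \<open>\<epsilon>\<close> decrease, that translated
      pieces lie in the unit ball, that the two first-order estimates apply, and that \<open>\<epsilon>\<close> to the
      power \<open>l + 1\<close> is at most \<open>s\<close>.\<close>
    define \<epsilon>0 where "\<epsilon>0 = min 1 (min (1 / (A * M)) (min (\<rho>1 / A) (min (\<rho>2 / n) B)))"
    have "0 < \<epsilon>0" using A B M1 \<rho>1 \<rho>2 n by (simp add: \<epsilon>0_def)
    moreover have "\<exists>Z. finite Z \<and> \<Psi> ` S \<subseteq> (\<Union>z\<in>Z. {y. d z y < \<epsilon>}) \<and>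
          real (card Z) * (A * \<epsilon> ^ l) ^ dim L * (\<Prod>i\<in>high m. \<epsilon> ^ deg i)
            \<le> C1 * C2 * ((A * \<epsilon> ^ l) ^ k * (B * \<epsilon> ^ l) ^ ?e)" if \<epsilon>: "0 < \<epsilon>" "\<epsilon> < \<epsilon>0" for \<epsilon>
    proof -
      have e: "\<epsilon> < 1" "\<epsilon> < 1 / (A * M)" "\<epsilon> < \<rho>1 / A" "\<epsilon> < \<rho>2 / n" "\<epsilon> < B"
        using \<epsilon>(2) by (simp_all add: \<epsilon>0_def)
      define R where "R = A * \<epsilon> ^ l"
      define s where "s = B * \<epsilon> ^ l"
      have el: "0 < \<epsilon> ^ l" "\<epsilon> ^ l \<le> \<epsilon>"
        using \<epsilon>(1) e(1) l power_decreasing[of 1 l \<epsilon>] by auto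
      have AM: "0 < A * M" using A M1 by simp
      have s: "0 < s" using B el by (simp add: s_def)
      have sR: "s \<le> R" unfolding s_def R_def using A B el by (intro mult_right_mono) auto
      have "R \<le> A * \<epsilon>" unfolding R_def using A el by (intro mult_left_mono) auto
      moreover have "A * \<epsilon> < \<rho>1" using e(3) A by (simp add: field_simps)
      moreover have "A * M * \<epsilon> < 1" using e(2) AM by (simp add: field_simps)
      moreover have "A * \<epsilon> \<le> A * M * \<epsilon>" using A M1 \<epsilon>(1) by simp
      moreover have "M * R \<le> M * (A * \<epsilon>)" using M1 \<open>R \<le> A * \<epsilon>\<close> by (intro mult_left_mono) auto
      ultimately have R: "R < \<rho>1" "M * R \<le> 1" "A * \<epsilon> \<le> 1" "R \<le> 1" by (auto simp: mult_ac)
      have R0: "0 < R" using s sR by simp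
      have BA: "B / A * R = s" using A by (simp add: R_def s_def)
      have R_le_low: "R \<le> \<epsilon> ^ deg i" if i: "i \<in> low m" for i
      proof -
        from m show ?thesis
        proof (elim disjE conjE)
          assume "m = Suc l" "A = 1"
          then have "deg i \<le> l" using i by (simp add: low_def)
          then show ?thesis using \<epsilon>(1) e(1) \<open>A = 1\<close> by (simp add: R_def power_decreasing)
        next
          assume "m = l"
          then have "Suc (deg i) \<le> l" using i by (simp add: low_def)
          then have "\<epsilon> ^ l \<le> \<epsilon> ^ Suc (deg i)" using \<epsilon>(1) e(1) by (intro power_decreasing) auto
          then have "R \<le> A * \<epsilon> ^ Suc (deg i)" unfolding R_def using A by (intro mult_left_mono) auto
          also have "\<dots> = A * \<epsilon> * \<epsilon> ^ deg i" by simp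
          also have "\<dots> \<le> 1 * \<epsilon> ^ deg i" using R(3) \<epsilon>(1) by (intro mult_right_mono) auto
          finally show ?thesis by simp
        qed
      qed
      have ems: "\<epsilon> ^ m \<le> s"
      proof -
        from m show ?thesis
        proof (elim disjE conjE)
          assume "m = Suc l"
          then show ?thesis unfolding s_def using e(5) el by simp
        qed (simp add: s_def)
      qed
      have hb: "\<bar>b' \<bullet> X i\<bar> \<le> \<epsilon> ^ deg i" if "b' \<in> hbox c \<epsilon>" "i \<in> {1..n}" for b' i
      proof -
        have "\<bar>b' \<bullet> X i\<bar> \<le> c * \<epsilon> ^ deg i" using that by (auto simp: hbox_def ortho_box_def)
        also have "\<dots> \<le> 1 * \<epsilon> ^ deg i" using c \<epsilon>(1) by (intro mult_right_mono) auto
        finally show ?thesis by simp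
      qed
      define t where "t i = (M + 2) * \<epsilon> ^ deg i" for i
      have t0: "0 \<le> t i" for i using M1 \<epsilon>(1) by (simp add: t_def)
      have local: "\<exists>Z. finite Z \<and> (\<forall>x\<in>S \<inter> ball b R. \<exists>z\<in>Z. d (mul (\<Psi> b) z) (\<Psi> x) < \<epsilon>) \<and>
          real (card Z) * (\<Prod>i\<in>high m. \<epsilon> ^ deg i) \<le> C2 * (R ^ k * s ^ ?e)" if b: "b \<in> S" for b
      proof -
        have bC: "b \<in> ?C" and bL: "b \<in> L" using b S by auto
        define P where "P = high_proj m ` chart_deriv \<Psi> b b ` L"
        have P: "subspace P" "P \<subseteq> range (high_proj m)" "dim P \<le> k"
          unfolding P_def using bspec[OF rank b] L lin[OF bC] linear_proj
          by (auto intro!: linear_subspace_image)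
        have R': "0 < (n + 2) * s" "(n + 2) * s \<le> (M + n + 2) * R"
          using s sR M1 n by (auto intro!: mult_mono)
        obtain T where T: "T \<in> lmeasurable"
          "{x. (\<forall>i\<in>low m. \<bar>x \<bullet> X i\<bar> \<le> t i) \<and>
            (\<exists>q\<in>P. norm q \<le> (M + n + 2) * R \<and> norm (high_proj m x - q) \<le> (n + 2) * s)} \<subseteq> T"
          "measure lebesgue T \<le> (8 * real n) ^ n * (\<Prod>i\<in>low m. t i) *
            (((M + n + 2) * R) ^ k * ((n + 2) * s) ^ ?e)"
          using subspace_tube_volume[OF P k R', of t] t0 by blast
        \<comment> \<open>The piece of size \<open>R\<close> around \<open>\<Psi> b\<close>, translated to the unit.\<close>
        define K where "K = ?F b ` (S \<inter> ball b R)"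
        have KC: "x \<in> ?C" "x \<in> L" "norm (x - b) < R" if "x \<in> S \<inter> ball b R" for x
          using that S by (auto simp: dist_norm norm_minus_commute)
        have KM: "norm (?F b x) \<le> M * R" if x: "x \<in> S \<inter> ball b R" for x
        proof -
          have "norm (?F b x) \<le> M * norm (x - b)" using M2[OF bC KC(1)[OF x]] .
          also have "\<dots> \<le> M * R" using KC(3)[OF x] M1 by (intro mult_left_mono) auto
          finally show ?thesis .
        qed
        have K1: "K \<subseteq> cball 0 1" using KM R(2) by (fastforce simp: K_def mem_cball_0)
        have KT: "mul w b' \<in> T" if w: "w \<in> K" and b': "b' \<in> hbox c \<epsilon>" for w b'
        proof -
          obtain x where x: "x \<in> S \<inter> ball b R" and wx: "w = ?F b x" using w by (auto simp: K_def)
          have wM: "norm w \<le> M * R" using KM[OF x] wx by simp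
          have "\<bar>b' \<bullet> X i\<bar> \<le> \<epsilon>" if i: "i \<in> {1..n}" for i
          proof -
            have "\<epsilon> ^ deg i \<le> \<epsilon> ^ 1" using deg_pos[OF i] \<epsilon>(1) e(1) by (intro power_decreasing) auto
            then show ?thesis using hb[OF b' i] by simp
          qed
          then have "norm b' \<le> n * \<epsilon>" using norm_le_coords[of b' \<epsilon>] by (simp add: dim_n)
          also have "\<dots> < \<rho>2" using e(4) n by (simp add: field_simps)
          finally have "norm (mul w b' - w - b') \<le> B / (A * M) * norm w"
            using \<rho>2(2) wM R(2) by simp
          also have "\<dots> \<le> B / (A * M) * (M * R)" using wM A B M1 by (intro mult_left_mono) auto
          also have "\<dots> = s" using A M1 BA by simp
          finally have E1: "norm (mul w b' - w - b') \<le> s" .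
          define q where "q = high_proj m (chart_deriv \<Psi> b b (x - b))"
          have qP: "q \<in> P" unfolding q_def P_def using bL KC(2)[OF x] L by (auto intro: subspace_diff)
          have "norm q \<le> norm (chart_deriv \<Psi> b b (x - b))" unfolding q_def by (rule norm_proj_le)
          also have "\<dots> \<le> M * norm (x - b)" by (rule M3[OF bC])
          also have "\<dots> \<le> M * R" using KC(3)[OF x] M1 by (intro mult_left_mono) auto
          also have "\<dots> \<le> (M + n + 2) * R" using R0 by (intro mult_right_mono) auto
          finally have q1: "norm q \<le> (M + n + 2) * R" .
          have "norm (w - chart_deriv \<Psi> b b (x - b)) \<le> B / A * norm (x - b)"
            using \<rho>1(2)[OF bC KC(1)[OF x]] KC(3)[OF x] R(1) by (simp add: wx mul_uminus_left)
          also have "\<dots> \<le> B / A * R" using KC(3)[OF x] A B by (intro mult_left_mono) auto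
          finally have E2: "norm (w - chart_deriv \<Psi> b b (x - b)) \<le> s" using BA by simp
          have E3: "norm (high_proj m b') \<le> n * s"
          proof -
            have "\<bar>high_proj m b' \<bullet> X i\<bar> \<le> s" if i: "i \<in> {1..n}" for i
            proof (cases "m \<le> deg i")
              case True
              then have "\<epsilon> ^ deg i \<le> \<epsilon> ^ m" using \<epsilon>(1) e(1) by (intro power_decreasing) auto
              then show ?thesis using hb[OF b' i] ems i True by (simp add: proj_inner_X)
            qed (use i s in \<open>simp add: proj_inner_X\<close>)
            then show ?thesis using norm_le_coords[of "high_proj m b'" s] by (simp add: dim_n)
          qed
          \<comment> \<open>Three errors add up: of the product against the sum, of the piece against its
            tangent plane, and the size of the box.\<close>
          have "high_proj m (mul w b') - q = high_proj m (mul w b' - w - b') +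
              (high_proj m (w - chart_deriv \<Psi> b b (x - b)) + high_proj m b')"
            unfolding q_def by (simp add: linear_diff[OF linear_proj])
          also have "norm \<dots> \<le> s + (s + n * s)"
            using E1 E2 E3 norm_proj_le order_trans
            by (intro norm_triangle_mono) blast+
          finally have q2: "norm (high_proj m (mul w b') - q) \<le> (n + 2) * s" by (simp add: algebra_simps)
          have low_t: "\<bar>mul w b' \<bullet> X i\<bar> \<le> t i" if i: "i \<in> low m" for i
          proof -
            have i': "i \<in> {1..n}" using i high_low(6) by blast
            have "mul w b' \<bullet> X i = (mul w b' - w - b') \<bullet> X i + w \<bullet> X i + b' \<bullet> X i"
              by (simp add: inner_diff_left)
            moreover have "\<bar>(mul w b' - w - b') \<bullet> X i\<bar> \<le> \<epsilon> ^ deg i"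
              using coord_le_norm[OF i', of "mul w b' - w - b'"] E1 sR R_le_low[OF i] by simp
            moreover have "\<bar>w \<bullet> X i\<bar> \<le> M * \<epsilon> ^ deg i"
            proof -
              have "M * R \<le> M * \<epsilon> ^ deg i" using R_le_low[OF i] M1 by (intro mult_left_mono) auto
              then show ?thesis using coord_le_norm[OF i', of w] wM by simp
            qed
            ultimately show ?thesis
              using hb[OF b' i'] unfolding t_def by (simp add: algebra_simps abs_le_iff)
          qed
          show ?thesis using T(2) low_t qP q1 q2 by blast
        qed
        obtain Z where Z: "finite Z" "Z \<subseteq> K"
          "real (card Z) * (\<kappa> * (\<Prod>i=1..n. \<epsilon> ^ deg i)) \<le> measure lebesgue T"
          "K \<subseteq> (\<Union>z\<in>Z. {y. d z y < \<epsilon>})"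
          using pack[rule_format, OF \<epsilon>(1) _ K1 T(1) KT] e(1) by auto
        have cover: "\<forall>x\<in>S \<inter> ball b R. \<exists>z\<in>Z. d (mul (\<Psi> b) z) (\<Psi> x) < \<epsilon>"
        proof
          fix x assume "x \<in> S \<inter> ball b R"
          then have "?F b x \<in> K" by (auto simp: K_def)
          then obtain z where z: "z \<in> Z" "d z (?F b x) < \<epsilon>" using Z(4) by blast
          then have "d (mul (\<Psi> b) z) (mul (\<Psi> b) (?F b x)) < \<epsilon>" by (simp add: left_invariant)
          then show "\<exists>z\<in>Z. d (mul (\<Psi> b) z) (\<Psi> x) < \<epsilon>" using z(1) by (auto simp: mul_cancel_uminus)
        qed
        have "(\<Prod>i=1..n. \<epsilon> ^ deg i) = (\<Prod>i\<in>low m. \<epsilon> ^ deg i) * (\<Prod>i\<in>high m. \<epsilon> ^ deg i)"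
          using prod.union_disjoint[OF high_low(2,1), of m m] high_low(3,4)[of m] by (simp add: Int_commute)
        moreover have "(\<Prod>i\<in>low m. t i) = (M + 2) ^ card (low m) * (\<Prod>i\<in>low m. \<epsilon> ^ deg i)"
          by (simp add: t_def prod.distrib)
        ultimately have "real (card Z) * (\<kappa> * ((\<Prod>i\<in>low m. \<epsilon> ^ deg i) * (\<Prod>i\<in>high m. \<epsilon> ^ deg i))) \<le>
          (8 * real n) ^ n * ((M + 2) ^ card (low m) * (\<Prod>i\<in>low m. \<epsilon> ^ deg i)) *
            (((M + n + 2) * R) ^ k * ((n + 2) * s) ^ ?e)"
          using Z(3) T(3) by simp
        then have "(\<Prod>i\<in>low m. \<epsilon> ^ deg i) * (real (card Z) * (\<kappa> * (\<Prod>i\<in>high m. \<epsilon> ^ deg i))) \<le>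
          (\<Prod>i\<in>low m. \<epsilon> ^ deg i) * (\<kappa> * (C2 * (R ^ k * s ^ ?e)))"
          using \<kappa> unfolding C2_def by (simp add: power_mult_distrib mult_ac)
        moreover have "0 < (\<Prod>i\<in>low m. \<epsilon> ^ deg i)" using \<epsilon>(1) by (simp add: prod_pos)
        ultimately have "real (card Z) * (\<kappa> * (\<Prod>i\<in>high m. \<epsilon> ^ deg i)) \<le> \<kappa> * (C2 * (R ^ k * s ^ ?e))"
          by (rule mult_left_le_imp_le)
        then have "\<kappa> * (real (card Z) * (\<Prod>i\<in>high m. \<epsilon> ^ deg i)) \<le> \<kappa> * (C2 * (R ^ k * s ^ ?e))"
          by (simp only: mult.left_commute)
        then have "real (card Z) * (\<Prod>i\<in>high m. \<epsilon> ^ deg i) \<le> C2 * (R ^ k * s ^ ?e)"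
          using \<kappa> by simp
        then show ?thesis using Z(1) cover by blast
      qed
      then obtain Zf where Zf: "\<And>b. b \<in> S \<Longrightarrow> finite (Zf b)"
        "\<And>b x. b \<in> S \<Longrightarrow> x \<in> S \<Longrightarrow> x \<in> ball b R \<Longrightarrow> \<exists>z\<in>Zf b. d (mul (\<Psi> b) z) (\<Psi> x) < \<epsilon>"
        "\<And>b. b \<in> S \<Longrightarrow> real (card (Zf b)) * (\<Prod>i\<in>high m. \<epsilon> ^ deg i) \<le> C2 * (R ^ k * s ^ ?e)"
        by (metis IntI)
      obtain Y where Y: "finite Y" "Y \<subseteq> S" "real (card Y) * R ^ dim L \<le> C1" "S \<subseteq> (\<Union>b\<in>Y. ball b R)"
        using C1(2)[rule_format, OF S R0 R(4)] by blast
      define Z where "Z = (\<Union>b\<in>Y. mul (\<Psi> b) ` Zf b)"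
      have "finite Z" using Y Zf(1) by (auto simp: Z_def)
      moreover have "\<Psi> ` S \<subseteq> (\<Union>z\<in>Z. {y. d z y < \<epsilon>})"
      proof
        fix y assume "y \<in> \<Psi> ` S"
        then obtain x where x: "x \<in> S" "y = \<Psi> x" by blast
        then obtain b where b: "b \<in> Y" "x \<in> ball b R" using Y(4) by blast
        then obtain z where "z \<in> Zf b" "d (mul (\<Psi> b) z) (\<Psi> x) < \<epsilon>"
          using Zf(2)[of b x] x(1) Y(2) by blast
        then show "y \<in> (\<Union>z\<in>Z. {y. d z y < \<epsilon>})" using x b by (auto simp: Z_def)
      qed
      moreover have "real (card Z) * R ^ dim L * (\<Prod>i\<in>high m. \<epsilon> ^ deg i) \<le> C1 * C2 * (R ^ k * s ^ ?e)"
      proof -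
        let ?h = "\<Prod>i\<in>high m. \<epsilon> ^ deg i"
        have h: "0 < ?h" using \<epsilon>(1) by (simp add: prod_pos)
        have "card Z \<le> (\<Sum>b\<in>Y. card (mul (\<Psi> b) ` Zf b))" unfolding Z_def by (rule card_UN_le[OF Y(1)])
        also have "\<dots> \<le> (\<Sum>b\<in>Y. card (Zf b))"
          using Zf(1) Y(2) by (intro sum_mono card_image_le) blast
        finally have "real (card Z) * ?h \<le> (\<Sum>b\<in>Y. real (card (Zf b))) * ?h"
          using h by (simp flip: of_nat_sum)
        also have "\<dots> \<le> (\<Sum>b\<in>Y. C2 * (R ^ k * s ^ ?e))"
          unfolding sum_distrib_right using Zf(3) Y(2) by (intro sum_mono) blast
        also have "\<dots> = real (card Y) * (C2 * (R ^ k * s ^ ?e))" by simp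
        finally have "real (card Z) * ?h * R ^ dim L \<le> real (card Y) * (C2 * (R ^ k * s ^ ?e)) * R ^ dim L"
          using R0 by (intro mult_right_mono) auto
        also have "\<dots> = real (card Y) * R ^ dim L * (C2 * (R ^ k * s ^ ?e))" by simp
        also have "\<dots> \<le> C1 * (C2 * (R ^ k * s ^ ?e))"
          using Y(3) C2 R0 s by (intro mult_right_mono) auto
        finally show ?thesis by (simp add: mult_ac)
      qed
      ultimately show ?thesis unfolding R_def s_def by blast
    qed
    ultimately show "\<exists>\<epsilon>0>0. \<forall>\<epsilon>. 0 < \<epsilon> \<longrightarrow> \<epsilon> < \<epsilon>0 \<longrightarrow>
        (\<exists>Z. finite Z \<and> \<Psi> ` S \<subseteq> (\<Union>z\<in>Z. {y. d z y < \<epsilon>}) \<and>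
          real (card Z) * (A * \<epsilon> ^ l) ^ dim L * (\<Prod>i\<in>high m. \<epsilon> ^ deg i)
            \<le> C1 * C2 * ((A * \<epsilon> ^ l) ^ k * (B * \<epsilon> ^ l) ^ ?e))"
      by blast
  qed
qed

end

section \<open>Coefficients of simple multivectors\<close>

text \<open>Replace the arguments one by one: with the others fixed, the arguments at which \<open>H\<close>
  vanishes form a subspace.\<close>

lemma multilinear_vanish_on_span:
  fixes H :: "(nat \<Rightarrow> 'b::real_vector) \<Rightarrow> real"
  assumes lin: "\<And>i \<xi>. i \<in> {1..p} \<Longrightarrow> linear (\<lambda>v. H (\<xi>(i := v)))"
    and van: "\<And>\<xi>. (\<And>i. i \<in> {1..p} \<Longrightarrow> \<xi> i \<in> S) \<Longrightarrow> H \<xi> = 0"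
    and \<xi>: "\<And>i. i \<in> {1..p} \<Longrightarrow> \<xi> i \<in> span S"
  shows "H \<xi> = 0"
proof -
  have "H \<xi> = 0" if "finite J" "J \<subseteq> {1..p}" "\<And>i. i \<in> J \<Longrightarrow> \<xi> i \<in> span S"
    "\<And>i. i \<in> {1..p} - J \<Longrightarrow> \<xi> i \<in> S" for J \<xi>
    using that
  proof (induction J arbitrary: \<xi> rule: finite_induct)
    case empty
    then show ?case by (intro van) auto
  next
    case (insert j J)
    let ?A = "{v. H (\<xi>(j := v)) = 0}"
    have j: "j \<in> {1..p}" using insert.prems by auto
    have "subspace ?A"
      using lin[OF j, of \<xi>] by (rule linear_subspace_kernel)
    moreover have "S \<subseteq> ?A"
    proof
      fix v assume "v \<in> S"
      then show "v \<in> ?A"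
        using insert.prems insert.hyps by (intro CollectI insert.IH) auto
    qed
    ultimately have "span S \<subseteq> ?A" by (rule span_minimal[rotated])
    then have "\<xi> j \<in> ?A" using insert.prems(2) by blast
    then show ?case by simp
  qed
  then show ?thesis using \<xi> by (metis Diff_cancel empty_iff finite_atLeastAtMost order_refl)
qed

text \<open>Only the arguments with index in \<open>{1..p}\<close> matter, which is what \<open>cong\<close> expresses.\<close>

locale alternating_multilinear =
  fixes p :: nat and H :: "(nat \<Rightarrow> 'b::real_vector) \<Rightarrow> real"
  assumes lin: "\<And>i \<xi>. i \<in> {1..p} \<Longrightarrow> linear (\<lambda>v. H (\<xi>(i := v)))"
    and perm: "\<And>\<sigma> \<xi>. \<sigma> permutes {1..p} \<Longrightarrow> H (\<xi> \<circ> \<sigma>) = of_int (sign \<sigma>) * H \<xi>"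
    and cong: "\<And>\<xi> \<xi>'. (\<And>i. i \<in> {1..p} \<Longrightarrow> \<xi> i = \<xi>' i) \<Longrightarrow> H \<xi> = H \<xi>'"
begin

lemma eq_0_if_repeated:
  assumes "i \<in> {1..p}" "j \<in> {1..p}" "i \<noteq> j" "\<xi> i = \<xi> j"
  shows "H \<xi> = 0"
proof -
  have "H (\<xi> \<circ> Transposition.transpose i j) = - H \<xi>"
    using perm[OF permutes_swap_id[OF assms(1,2)]] assms(3) by (simp add: sign_swap_id)
  moreover have "\<xi> \<circ> Transposition.transpose i j = \<xi>"
    using assms(4) by (auto simp: fun_eq_iff Transposition.transpose_def)
  ultimately show ?thesis by simp
qed

lemma eq_0_on_span_of_family:
  assumes "H \<eta> = 0" and \<xi>: "\<And>i. i \<in> {1..p} \<Longrightarrow> \<xi> i \<in> span (\<eta> ` {1..p})"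
  shows "H \<xi> = 0"
proof (rule multilinear_vanish_on_span[OF lin _ \<xi>])
  fix \<xi> assume "\<And>i. i \<in> {1..p} \<Longrightarrow> \<xi> i \<in> \<eta> ` {1..p}"
  then have "\<forall>i\<in>{1..p}. \<exists>k\<in>{1..p}. \<xi> i = \<eta> k" by blast
  then obtain f where f: "\<And>i. i \<in> {1..p} \<Longrightarrow> f i \<in> {1..p}" "\<And>i. i \<in> {1..p} \<Longrightarrow> \<xi> i = \<eta> (f i)"
    by metis
  show "H \<xi> = 0"
  proof (cases "inj_on f {1..p}")
    case True
    define \<sigma> where "\<sigma> i = (if i \<in> {1..p} then f i else i)" for i
    have "inj_on \<sigma> {1..p} \<longleftrightarrow> inj_on f {1..p}" by (rule inj_on_cong) (simp add: \<sigma>_def)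
    then have "inj_on \<sigma> {1..p}" using True by blast
    moreover have "\<sigma> ` {1..p} \<subseteq> {1..p}" using f(1) by (auto simp: \<sigma>_def)
    ultimately have "bij_betw \<sigma> {1..p} {1..p}"
      using endo_inj_surj[of "{1..p}" \<sigma>] by (simp add: bij_betw_def)
    then have "\<sigma> permutes {1..p}" by (rule bij_imp_permutes) (auto simp: \<sigma>_def)
    then have "H (\<eta> \<circ> \<sigma>) = 0" using perm assms(1) by simp
    moreover have "H \<xi> = H (\<eta> \<circ> \<sigma>)" using f(2) by (intro cong) (auto simp: \<sigma>_def)
    ultimately show ?thesis by simp
  next
    case False
    then obtain i j where "i \<in> {1..p}" "j \<in> {1..p}" "i \<noteq> j" "f i = f j"
      unfolding inj_on_def by blast
    then show ?thesis using f(2) by (intro eq_0_if_repeated[of i j]) auto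
  qed
qed

end

text \<open>Enumerate \<open>I\<close> in increasing order.\<close>

lemma ex_multi_index:
  assumes "I \<subseteq> {1..n}" "card I = p"
  obtains \<alpha> where "\<alpha> \<in> multi_indices n p" "\<alpha> ` {1..p} = I"
proof -
  have "finite I" using assms(1) finite_subset by blast
  then obtain h where h: "bij_betw h {..<p} I" "strict_mono_on {..<p} h"
    using ex_bij_betw_strict_mono_card assms(2) by metis
  define \<alpha> where "\<alpha> = restrict (\<lambda>i. h (i - 1)) {1..p}"
  have "(\<lambda>i. i - 1) ` {1..p} = {..<p}"
  proof
    show "{..<p} \<subseteq> (\<lambda>i. i - 1) ` {1..p}"
      by (intro subsetI, rule_tac x = "Suc x" in image_eqI) auto
  qed auto
  then have img: "\<alpha> ` {1..p} = I"
    using bij_betw_imp_surj_on[OF h(1)] by (metis (no_types, lifting) \<alpha>_def image_cong image_image restrict_apply')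
  moreover have "\<alpha> \<in> multi_indices n p"
    unfolding multi_indices_def
  proof (intro CollectI conjI PiE_I)
    show "strict_mono_on {1..p} \<alpha>"
    proof (rule strict_mono_onI)
      fix r s assume rs: "r \<in> {1..p}" "s \<in> {1..p}" "r < s"
      then have "h (r - 1) < h (s - 1)" by (intro strict_mono_onD[OF h(2)]) auto
      then show "\<alpha> r < \<alpha> s" using rs by (simp add: \<alpha>_def)
    qed
    show "\<alpha> i \<in> {1..n}" if "i \<in> {1..p}" for i using img assms(1) that by blast
    show "\<alpha> i = undefined" if "i \<notin> {1..p}" for i using that by (auto simp: \<alpha>_def restrict_def)
  qed
  ultimately show ?thesis using that by blast
qed

lemma finite_multi_indices: "finite (multi_indices n p)"
  unfolding multi_indices_def
  by (rule finite_subset[of _ "{1..p} \<rightarrow>\<^sub>E {1..n}"]) (auto intro: finite_PiE)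

lemma multi_index_inj: "\<alpha> \<in> multi_indices n p \<Longrightarrow> inj_on \<alpha> {1..p}"
  by (auto simp: multi_indices_def strict_mono_on_imp_inj_on)

lemma multi_index_range: "\<alpha> \<in> multi_indices n p \<Longrightarrow> i \<in> {1..p} \<Longrightarrow> \<alpha> i \<in> {1..n}"
  by (auto simp: multi_indices_def)

text \<open>\<open>\<sigma>\<close> is increasing, because \<open>\<alpha>\<close> and \<open>\<beta>\<close> are, and the identity is the only increasing
  permutation.\<close>

lemma multi_index_permuted_eq:
  assumes \<alpha>: "\<alpha> \<in> multi_indices n p" and \<beta>: "\<beta> \<in> multi_indices n p" and \<sigma>: "\<sigma> permutes {1..p}"
    and eq: "\<And>i. i \<in> {1..p} \<Longrightarrow> \<beta> i = \<alpha> (\<sigma> i)"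
  shows "\<sigma> = id" "\<alpha> = \<beta>"
proof -
  have mono: "\<sigma> i < \<sigma> j" if "i \<in> {1..p}" "j \<in> {1..p}" "i < j" for i j
  proof -
    have "\<alpha> (\<sigma> i) < \<alpha> (\<sigma> j)"
      using \<beta> that eq by (auto simp: multi_indices_def strict_mono_on_def)
    moreover have "\<sigma> i \<in> {1..p}" "\<sigma> j \<in> {1..p}" using that by (simp_all only: permutes_in_image[OF \<sigma>])
    ultimately show ?thesis
      using \<alpha> strict_mono_on_less[of "{1..p}" \<alpha> "\<sigma> i" "\<sigma> j"] by (simp add: multi_indices_def)
  qed
  have "i \<le> \<sigma> i" if "i \<in> {1..p}" for i
    using that
  proof (induction i)
    case (Suc i)
    show ?case
    proof (cases "i = 0")
      case True
      then show ?thesis using permutes_in_image[OF \<sigma>, of "Suc i"] Suc.prems by auto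
    next
      case False
      then show ?thesis using Suc mono[of i "Suc i"] by auto
    qed
  qed simp
  then show "\<sigma> = id" using permutes_natset_ge[OF \<sigma>] by blast
  then have "\<beta> i = \<alpha> i" if "i \<in> {1..p}" for i using eq that by simp
  then show "\<alpha> = \<beta>"
    by (intro PiE_ext[of \<alpha> "{1..p}" "\<lambda>_. {1..n}" \<beta>]) (use \<alpha> \<beta> in \<open>auto simp: multi_indices_def\<close>)
qed

lemma alternating_multilinear_wedge:
  "alternating_multilinear p (wedge p w)"
proof (rule alternating_multilinear.intro)
  fix i and \<xi> :: "nat \<Rightarrow> 'a \<Rightarrow>\<^sub>L real" assume i: "i \<in> {1..p}"
  define k where "k \<sigma> = of_int (sign \<sigma>) * (\<Prod>j\<in>{1..p} - {i}. blinfun_apply (\<xi> j) (w (\<sigma> j)))" for \<sigma>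
  have "(\<Prod>j=1..p. blinfun_apply ((\<xi>(i := v)) j) (w (\<sigma> j))) =
      (\<Prod>j\<in>{1..p} - {i}. blinfun_apply (\<xi> j) (w (\<sigma> j))) * blinfun_apply v (w (\<sigma> i))" for \<sigma> v
    using i by (subst prod.remove[OF _ i]) (auto intro!: prod.cong simp: mult.commute)
  then have "wedge p w (\<xi>(i := v)) = (\<Sum>\<sigma> | \<sigma> permutes {1..p}. k \<sigma> * blinfun_apply v (w (\<sigma> i)))" for v
    unfolding wedge_def k_def by (simp only: mult.assoc)
  then show "linear (\<lambda>v. wedge p w (\<xi>(i := v)))"
    by (intro linearI) (simp_all add: blinfun.add_left blinfun.scaleR_left sum_distrib_left
        distrib_left sum.distrib mult.left_commute)
next
  fix \<sigma> and \<xi> :: "nat \<Rightarrow> 'a \<Rightarrow>\<^sub>L real" assume \<sigma>: "\<sigma> permutes {1..p}"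
  let ?F = "\<lambda>\<pi>. of_int (sign \<pi>) * (\<Prod>i=1..p. blinfun_apply ((\<xi> \<circ> \<sigma>) i) (w (\<pi> i)))"
  have "wedge p w (\<xi> \<circ> \<sigma>) = (\<Sum>\<pi> | \<pi> permutes {1..p}. ?F (\<pi> \<circ> \<sigma>))"
    unfolding wedge_def by (rule sum_permutations_compose_right[OF \<sigma>])
  also have "\<dots> = (\<Sum>\<pi> | \<pi> permutes {1..p}.
      of_int (sign \<sigma>) * (of_int (sign \<pi>) * (\<Prod>i=1..p. blinfun_apply (\<xi> i) (w (\<pi> i)))))"
  proof (rule sum.cong[OF refl])
    fix \<pi> assume "\<pi> \<in> {\<pi>. \<pi> permutes {1..p}}"
    then have \<pi>: "\<pi> permutes {1..p}" by simp
    have "sign (\<pi> \<circ> \<sigma>) = sign \<pi> * sign \<sigma>"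
      using \<sigma> \<pi> by (intro sign_compose) (auto intro: permutation_permutes[THEN iffD2])
    moreover have "(\<Prod>i=1..p. blinfun_apply ((\<xi> \<circ> \<sigma>) i) (w ((\<pi> \<circ> \<sigma>) i))) =
        (\<Prod>i=1..p. blinfun_apply (\<xi> i) (w (\<pi> i)))"
      using prod.permute[OF \<sigma>, of "\<lambda>i. blinfun_apply (\<xi> i) (w (\<pi> i))"] by (simp add: o_def)
    ultimately show "?F (\<pi> \<circ> \<sigma>) =
        of_int (sign \<sigma>) * (of_int (sign \<pi>) * (\<Prod>i=1..p. blinfun_apply (\<xi> i) (w (\<pi> i))))"
      by simp
  qed
  also have "\<dots> = of_int (sign \<sigma>) * wedge p w \<xi>"
    by (simp add: wedge_def sum_distrib_left)
  finally show "wedge p w (\<xi> \<circ> \<sigma>) = of_int (sign \<sigma>) * wedge p w \<xi>" .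
next
  fix \<xi> \<xi>' :: "nat \<Rightarrow> 'a \<Rightarrow>\<^sub>L real" assume "\<And>i. i \<in> {1..p} \<Longrightarrow> \<xi> i = \<xi>' i"
  then show "wedge p w \<xi> = wedge p w \<xi>'" by (simp add: wedge_def)
qed

lemma alternating_multilinear_diff_sum:
  assumes "alternating_multilinear p F" "finite I" "\<And>\<alpha>. \<alpha> \<in> I \<Longrightarrow> alternating_multilinear p (G \<alpha>)"
  shows "alternating_multilinear p (\<lambda>\<xi>. F \<xi> - (\<Sum>\<alpha>\<in>I. c \<alpha> * G \<alpha> \<xi>))"
proof (rule alternating_multilinear.intro)
  fix i \<xi> assume i: "i \<in> {1..p}"
  have "linear (\<lambda>v. \<Sum>\<alpha>\<in>I. c \<alpha> * G \<alpha> (\<xi>(i := v)))"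
  proof (rule linear_compose_sum, rule ballI)
    fix \<alpha> assume "\<alpha> \<in> I"
    then have "linear (\<lambda>v. G \<alpha> (\<xi>(i := v)))" by (rule alternating_multilinear.lin[OF assms(3) i])
    from linear_compose_scale_right[OF this, of "c \<alpha>"]
    show "linear (\<lambda>v. c \<alpha> * G \<alpha> (\<xi>(i := v)))" by simp
  qed
  from linear_compose_sub[OF alternating_multilinear.lin[OF assms(1) i] this]
  show "linear (\<lambda>v. F (\<xi>(i := v)) - (\<Sum>\<alpha>\<in>I. c \<alpha> * G \<alpha> (\<xi>(i := v))))" .
next
  fix \<sigma> \<xi> assume \<sigma>: "\<sigma> permutes {1..p}"
  show "F (\<xi> \<circ> \<sigma>) - (\<Sum>\<alpha>\<in>I. c \<alpha> * G \<alpha> (\<xi> \<circ> \<sigma>)) = of_int (sign \<sigma>) * (F \<xi> - (\<Sum>\<alpha>\<in>I. c \<alpha> * G \<alpha> \<xi>))"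
    using alternating_multilinear.perm[OF assms(1) \<sigma>] alternating_multilinear.perm[OF assms(3) \<sigma>]
    by (simp add: right_diff_distrib sum_distrib_left mult.left_commute)
next
  fix \<xi> \<xi>' :: "nat \<Rightarrow> 'a" assume eq: "\<And>i. i \<in> {1..p} \<Longrightarrow> \<xi> i = \<xi>' i"
  show "F \<xi> - (\<Sum>\<alpha>\<in>I. c \<alpha> * G \<alpha> \<xi>) = F \<xi>' - (\<Sum>\<alpha>\<in>I. c \<alpha> * G \<alpha> \<xi>')"
    using alternating_multilinear.cong[OF assms(1) eq] alternating_multilinear.cong[OF assms(3) eq]
    by simp
qed

text \<open>After expansion in the \<open>\<zeta>\<^sub>k\<close> only families \<open>\<zeta> \<circ> f\<close> remain. They give \<open>0\<close> when \<open>f\<close> repeats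
  an index, and otherwise \<open>f\<close> is a permuted increasing multi-index.\<close>

lemma alternating_multilinear_eq_0:
  assumes H: "alternating_multilinear p H"
    and incr: "\<And>\<beta>. \<beta> \<in> multi_indices n p \<Longrightarrow> H (\<zeta> \<circ> \<beta>) = 0"
    and \<xi>: "\<And>i. i \<in> {1..p} \<Longrightarrow> \<xi> i \<in> span (\<zeta> ` {1..n})"
  shows "H \<xi> = 0"
proof -
  interpret alternating_multilinear p H by fact
  show ?thesis
  proof (rule multilinear_vanish_on_span[OF lin _ \<xi>])
    fix \<xi> assume "\<And>i. i \<in> {1..p} \<Longrightarrow> \<xi> i \<in> \<zeta> ` {1..n}"
    then have "\<forall>i\<in>{1..p}. \<exists>k\<in>{1..n}. \<xi> i = \<zeta> k" by blast
    then obtain f where f: "\<And>i. i \<in> {1..p} \<Longrightarrow> f i \<in> {1..n}" "\<And>i. i \<in> {1..p} \<Longrightarrow> \<xi> i = \<zeta> (f i)"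
      by metis
    show "H \<xi> = 0"
    proof (cases "inj_on f {1..p}")
      case True
      then have "card (f ` {1..p}) = p" by (simp add: card_image)
      then obtain \<beta> where \<beta>: "\<beta> \<in> multi_indices n p" "\<beta> ` {1..p} = f ` {1..p}"
        using ex_multi_index[of "f ` {1..p}" n p] f(1) by blast
      show ?thesis
      proof (rule eq_0_on_span_of_family[OF incr[OF \<beta>(1)]])
        fix i assume "i \<in> {1..p}"
        then have "\<xi> i \<in> \<zeta> ` f ` {1..p}" using f(2) by blast
        then show "\<xi> i \<in> span ((\<zeta> \<circ> \<beta>) ` {1..p})"
          unfolding image_comp[symmetric] \<beta>(2) by (rule span_base)
      qed
    next
      case False
      then obtain i j where "i \<in> {1..p}" "j \<in> {1..p}" "i \<noteq> j" "f i = f j"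
        unfolding inj_on_def by blast
      then show ?thesis using f(2) by (intro eq_0_if_repeated[of i j]) auto
    qed
  qed
qed

lemma wedge_dual_basis:
  assumes dual: "\<And>k j. k \<in> {1..n} \<Longrightarrow> j \<in> {1..n} \<Longrightarrow> blinfun_apply (\<zeta> k) (Y j) = (if k = j then 1 else 0)"
    and \<alpha>: "\<alpha> \<in> multi_indices n p" and \<beta>: "\<beta> \<in> multi_indices n p"
  shows "wedge p (\<lambda>k. Y (\<alpha> k)) (\<zeta> \<circ> \<beta>) = (if \<alpha> = \<beta> then 1 else 0)"
proof -
  have "of_int (sign \<sigma>) * (\<Prod>i=1..p. blinfun_apply ((\<zeta> \<circ> \<beta>) i) (Y (\<alpha> (\<sigma> i)))) =
      (if \<sigma> = id then (if \<alpha> = \<beta> then 1 else 0) else (0::real))" if \<sigma>: "\<sigma> permutes {1..p}" for \<sigma>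
  proof -
    have \<sigma>in: "\<sigma> i \<in> {1..p}" if "i \<in> {1..p}" for i using that by (simp only: permutes_in_image[OF \<sigma>])
    have prod: "(\<Prod>i=1..p. blinfun_apply ((\<zeta> \<circ> \<beta>) i) (Y (\<alpha> (\<sigma> i)))) =
        (\<Prod>i=1..p. if \<beta> i = \<alpha> (\<sigma> i) then 1 else 0)"
      using dual multi_index_range[OF \<beta>] multi_index_range[OF \<alpha>] \<sigma>in by (intro prod.cong) auto
    show ?thesis
    proof (cases "\<forall>i\<in>{1..p}. \<beta> i = \<alpha> (\<sigma> i)")
      case True
      then have "\<sigma> = id" "\<alpha> = \<beta>" using multi_index_permuted_eq[OF \<alpha> \<beta> \<sigma>] by auto
      then show ?thesis unfolding prod by (simp add: sign_id)
    next
      case False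
      then have "(\<Prod>i=1..p. if \<beta> i = \<alpha> (\<sigma> i) then 1 else 0) = (0::real)"
        by (subst prod_zero_iff) auto
      moreover have "\<not> (\<sigma> = id \<and> \<alpha> = \<beta>)" using False by auto
      ultimately show ?thesis unfolding prod by auto
    qed
  qed
  then have "wedge p (\<lambda>k. Y (\<alpha> k)) (\<zeta> \<circ> \<beta>) =
      (\<Sum>\<sigma> | \<sigma> permutes {1..p}. if \<sigma> = id then (if \<alpha> = \<beta> then 1 else 0) else 0)"
    unfolding wedge_def by (intro sum.cong) auto
  also have "\<dots> = (if \<alpha> = \<beta> then 1 else 0)"
    by (subst sum.delta) (auto simp: finite_permutations permutes_id)
  finally show ?thesis .
qed

text \<open>Evaluation at the dual covectors \<open>\<zeta> \<circ> \<beta>\<close> shows which coefficients are possible. That these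
  work follows from \<open>alternating_multilinear_eq_0\<close> applied to the difference of the two sides;
  this spares a regrouping of the expanded determinant.\<close>

lemma wedge_coefficients:
  assumes dual: "\<And>k j. k \<in> {1..n} \<Longrightarrow> j \<in> {1..n} \<Longrightarrow> blinfun_apply (\<zeta> k) (Y j) = (if k = j then 1 else 0)"
    and span: "span (\<zeta> ` {1..n}) = UNIV"
  shows "(THE c. c \<in> extensional (multi_indices n p) \<and>
        wedge p w = (\<lambda>\<xi>. \<Sum>\<alpha>\<in>multi_indices n p. c \<alpha> * wedge p (\<lambda>k. Y (\<alpha> k)) \<xi>)) =
    restrict (\<lambda>\<alpha>. wedge p w (\<zeta> \<circ> \<alpha>)) (multi_indices n p)"
proof (rule the_equality)
  let ?M = "multi_indices n p"
  have eval: "(\<Sum>\<alpha>\<in>?M. c \<alpha> * wedge p (\<lambda>k. Y (\<alpha> k)) (\<zeta> \<circ> \<beta>)) = c \<beta>" if "\<beta> \<in> ?M" for c \<beta>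
  proof -
    have "(\<Sum>\<alpha>\<in>?M. c \<alpha> * wedge p (\<lambda>k. Y (\<alpha> k)) (\<zeta> \<circ> \<beta>)) = (\<Sum>\<alpha>\<in>?M. if \<alpha> = \<beta> then c \<alpha> else 0)"
      using wedge_dual_basis[OF dual _ that] by (intro sum.cong) auto
    then show ?thesis using that finite_multi_indices by simp
  qed
  let ?c = "restrict (\<lambda>\<alpha>. wedge p w (\<zeta> \<circ> \<alpha>)) ?M"
  have diff: "wedge p w \<xi> - (\<Sum>\<alpha>\<in>?M. ?c \<alpha> * wedge p (\<lambda>k. Y (\<alpha> k)) \<xi>) = 0" for \<xi>
  proof (rule alternating_multilinear_eq_0[of p "\<lambda>\<xi>. wedge p w \<xi> - (\<Sum>\<alpha>\<in>?M. ?c \<alpha> * wedge p (\<lambda>k. Y (\<alpha> k)) \<xi>)" n \<zeta>])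
    show "alternating_multilinear p (\<lambda>\<xi>. wedge p w \<xi> - (\<Sum>\<alpha>\<in>?M. ?c \<alpha> * wedge p (\<lambda>k. Y (\<alpha> k)) \<xi>))"
      by (intro alternating_multilinear_diff_sum alternating_multilinear_wedge finite_multi_indices)
    fix \<beta> assume "\<beta> \<in> ?M"
    then show "wedge p w (\<zeta> \<circ> \<beta>) - (\<Sum>\<alpha>\<in>?M. ?c \<alpha> * wedge p (\<lambda>k. Y (\<alpha> k)) (\<zeta> \<circ> \<beta>)) = 0"
      using eval[of \<beta> ?c] by simp
  qed (use span in auto)
  have "wedge p w = (\<lambda>\<xi>. \<Sum>\<alpha>\<in>?M. ?c \<alpha> * wedge p (\<lambda>k. Y (\<alpha> k)) \<xi>)"
    by (rule ext) (rule iffD1[OF right_minus_eq diff])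
  then show "?c \<in> extensional ?M \<and> wedge p w = (\<lambda>\<xi>. \<Sum>\<alpha>\<in>?M. ?c \<alpha> * wedge p (\<lambda>k. Y (\<alpha> k)) \<xi>)"
    by (intro conjI restrict_extensional)
  fix c assume c: "c \<in> extensional ?M \<and> wedge p w = (\<lambda>\<xi>. \<Sum>\<alpha>\<in>?M. c \<alpha> * wedge p (\<lambda>k. Y (\<alpha> k)) \<xi>)"
  show "c = ?c"
  proof (rule extensionalityI[of _ ?M])
    show "c \<beta> = ?c \<beta>" if "\<beta> \<in> ?M" for \<beta>
    proof -
      have "wedge p w (\<zeta> \<circ> \<beta>) = (\<Sum>\<alpha>\<in>?M. c \<alpha> * wedge p (\<lambda>k. Y (\<alpha> k)) (\<zeta> \<circ> \<beta>))"
        using conjunct2[OF c] by (rule fun_cong)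
      then show ?thesis using eval[OF that, of c] that by simp
    qed
  qed (use c in auto)
qed

lemma orthogonal_projection_onto:
  fixes W :: "'a::euclidean_space set"
  assumes "subspace W"
  obtains G where "linear G" "\<And>v. G v \<in> W" "\<And>u v. u \<in> W \<Longrightarrow> G v \<bullet> u = v \<bullet> u"
proof -
  obtain B where B: "B \<subseteq> W" "pairwise orthogonal B" "\<And>x. x \<in> B \<Longrightarrow> norm x = 1"
      "independent B" "card B = dim W" "span B = W"
    using orthonormal_basis_subspace[OF assms] by metis
  have fin: "finite B" using B(4) by (rule independent_imp_finite)
  define G where "G v = (\<Sum>b\<in>B. (v \<bullet> b) *\<^sub>R b)" for v
  have "linear G" unfolding G_def
    by (intro linearI) (auto simp: inner_add_left sum.distrib scaleR_add_left scaleR_sum_right)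
  moreover have "G v \<in> W" for v
    unfolding G_def using B(1) assms by (intro subspace_sum subspace_scale) auto
  moreover have "G v \<bullet> u = v \<bullet> u" if "u \<in> W" for u v
  proof -
    have "(G v - v) \<bullet> b = 0" if b: "b \<in> B" for b
    proof -
      have "G v \<bullet> b = (\<Sum>c\<in>B. if c = b then v \<bullet> b else 0)"
        unfolding G_def inner_sum_left using B(2,3) b
        by (intro sum.cong) (auto simp: pairwise_def orthogonal_def norm_eq_1)
      then show ?thesis using fin b by (simp add: inner_diff_left)
    qed
    then have "orthogonal (G v - v) u"
      using that B(6) by (intro orthogonal_to_span[of u B]) (auto simp: orthogonal_def)
    then show ?thesis by (simp add: orthogonal_def inner_diff_left)
  qed
  ultimately show ?thesis using that by blast
qed

section \<open>Degree of a tangent space and ranks of its projections\<close>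

lemma inj_on_if_dim_le_dim_image:
  fixes f :: "'a::euclidean_space \<Rightarrow> 'b::euclidean_space"
  assumes f: "linear f" and W: "subspace W" and dim: "dim W \<le> dim (f ` W)"
  shows "inj_on f W"
proof -
  obtain B where B: "B \<subseteq> W" "independent B" "W \<subseteq> span B" "card B = dim W"
    using basis_exists by blast
  have spanB: "span B = W" using B(1,3) W by (metis span_minimal subset_antisym)
  have finB: "finite B" using B(2) by (rule independent_imp_finite)
  have span: "span (f ` B) = f ` W" using linear_span_image[OF f] spanB by simp
  then have "dim (f ` W) \<le> card (f ` B)" using dim_le_card[of "f ` W" "f ` B"] finB by simp
  then have card: "card (f ` B) = card B" "card (f ` B) \<le> dim (f ` W)"
    using dim B(4) card_image_le[OF finB, of f] by auto
  have "f ` B \<subseteq> f ` W" using B(1) by blast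
  moreover have "f ` W \<subseteq> span (f ` B)" using span by simp
  ultimately have "independent (f ` B)"
    using card_le_dim_spanning[of "f ` B" "f ` W"] finB card(2) by blast
  moreover have "inj_on f B" using finB card(1) by (rule eq_card_imp_inj_on)
  ultimately have "inj_on f (span B)" using f by (intro linear_inj_on_span_independent_image)
  then show ?thesis using spanB by simp
qed

context homogeneous_group
begin

text \<open>The chain rule for the left translations by \<open>x\<close> and by its inverse.\<close>

lemma dmul2_inverse: "dmul2 (- x) x (dmul2 x 0 v) = v" "dmul2 x 0 (dmul2 (- x) x v) = v"
proof -
  have "((\<lambda>y. mul (- x) (mul x y)) has_derivative (\<lambda>v. dmul2 (- x) x (dmul2 x 0 v))) (at 0)"
    using diff_chain_at[OF dmul2[of x 0] dmul2[of "- x" "mul x 0"]] by (simp add: o_def mul_0_right)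
  then have "((\<lambda>y. y) has_derivative (\<lambda>v. dmul2 (- x) x (dmul2 x 0 v))) (at 0)"
    by (simp add: mul_uminus_cancel)
  from has_derivative_unique[OF this has_derivative_ident] show "dmul2 (- x) x (dmul2 x 0 v) = v"
    by metis
  have "((\<lambda>y. mul x (mul (- x) y)) has_derivative (\<lambda>v. dmul2 x 0 (dmul2 (- x) x v))) (at x)"
    using diff_chain_at[OF dmul2[of "- x" x] dmul2[of x "mul (- x) x"]] by (simp add: o_def mul_uminus_left)
  then have "((\<lambda>y. y) has_derivative (\<lambda>v. dmul2 x 0 (dmul2 (- x) x v))) (at x)"
    by (simp add: mul_cancel_uminus)
  from has_derivative_unique[OF this has_derivative_ident] show "dmul2 x 0 (dmul2 (- x) x v) = v"
    by metis
qed

lemma linear_dmul2: "linear (dmul2 x y)"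
  using dmul2 has_derivative_linear by blast

lemma inj_dmul2: "inj_on (dmul2 (- x) x) S"
  by (intro inj_onI) (metis dmul2_inverse(2))

lemma left_inv_field_eq: "left_inv_field mul v x = dmul2 x 0 v"
  unfolding left_inv_field_def using frechet_derivative_at[OF dmul2[of x 0]] by simp

definition covec :: "'a \<Rightarrow> 'a \<Rightarrow> 'a \<Rightarrow>\<^sub>L real" where
  "covec x v = Blinfun (\<lambda>u. dmul2 (- x) x u \<bullet> v)"

lemma covec: "blinfun_apply (covec x v) u = dmul2 (- x) x u \<bullet> v"
proof -
  have "bounded_linear (dmul2 (- x) x)" using linear_dmul2 linear_conv_bounded_linear by blast
  then have "bounded_linear (\<lambda>u. dmul2 (- x) x u \<bullet> v)"
    using bounded_linear_compose[OF bounded_linear_inner_left] by blast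
  then show ?thesis by (simp add: covec_def bounded_linear_Blinfun_apply)
qed

lemma linear_covec: "linear (covec x)"
  by (intro linearI blinfun_eqI)
    (simp_all add: covec blinfun.add_left blinfun.scaleR_left inner_add_right)

lemma pvector_coeffs_wedge:
  "pvector_coeffs mul n X p x (wedge p w) =
    restrict (\<lambda>\<alpha>. wedge p w ((\<lambda>k. covec x (X k)) \<circ> \<alpha>)) (multi_indices n p)"
  unfolding pvector_coeffs_def
proof (rule wedge_coefficients[where Y = "\<lambda>k. left_inv_field mul (X k) x"])
  fix k j assume "k \<in> {1..n}" "j \<in> {1..n}"
  then show "blinfun_apply (covec x (X k)) (left_inv_field mul (X j) x) = (if k = j then 1 else 0)"
    by (simp add: covec left_inv_field_eq dmul2_inverse X_inner)
next
  have "\<phi> \<in> span ((\<lambda>k. covec x (X k)) ` {1..n})" for \<phi>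
  proof -
    have "\<phi> = (\<Sum>k=1..n. blinfun_apply \<phi> (dmul2 x 0 (X k)) *\<^sub>R covec x (X k))"
    proof (rule blinfun_eqI)
      fix u
      have "u = dmul2 x 0 (\<Sum>k=1..n. (dmul2 (- x) x u \<bullet> X k) *\<^sub>R X k)"
        by (simp only: expansion dmul2_inverse)
      also have "\<dots> = (\<Sum>k=1..n. (dmul2 (- x) x u \<bullet> X k) *\<^sub>R dmul2 x 0 (X k))"
        by (simp add: linear_sum[OF linear_dmul2] linear_scale[OF linear_dmul2])
      finally have "blinfun_apply \<phi> u =
          blinfun_apply \<phi> (\<Sum>k=1..n. (dmul2 (- x) x u \<bullet> X k) *\<^sub>R dmul2 x 0 (X k))" by simp
      also have "\<dots> = (\<Sum>k=1..n. (dmul2 (- x) x u \<bullet> X k) * blinfun_apply \<phi> (dmul2 x 0 (X k)))"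
        by (simp add: blinfun.sum_right blinfun.scaleR_right)
      finally show "blinfun_apply \<phi> u =
          blinfun_apply (\<Sum>k=1..n. blinfun_apply \<phi> (dmul2 x 0 (X k)) *\<^sub>R covec x (X k)) u"
        by (simp add: blinfun.sum_left blinfun.scaleR_left covec mult.commute)
    qed
    also have "\<dots> \<in> span ((\<lambda>k. covec x (X k)) ` {1..n})"
      by (intro span_sum span_scale span_base imageI)
    finally show ?thesis .
  qed
  then show "span ((\<lambda>k. covec x (X k)) ` {1..n}) = UNIV" by blast
qed

text \<open>Suppose that the coefficient is zero. Then \<open>wedge p w\<close> vanishes on all covectors spanned
  by those with indices in \<open>\<alpha>\<close>. By assumption these restrict to all functionals on the
  translated span of \<open>w\<close>, in particular to the basis dual to \<open>w\<close>, for which the value is \<open>1\<close>.\<close>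

lemma wedge_coefficient_nonzero:
  assumes inj: "inj_on w {1..p}" and ind: "independent (w ` {1..p})"
    and dual: "\<And>a. \<exists>e\<in>span (X ` \<alpha> ` {1..p}). \<forall>u\<in>dmul2 (- x) x ` span (w ` {1..p}). e \<bullet> u = a \<bullet> u"
  shows "wedge p w ((\<lambda>k. covec x (X k)) \<circ> \<alpha>) \<noteq> 0"
proof
  assume zero: "wedge p w ((\<lambda>k. covec x (X k)) \<circ> \<alpha>) = 0"
  interpret alternating_multilinear p "wedge p w" by (rule alternating_multilinear_wedge)
  define u where "u j = dmul2 (- x) x (w j)" for j
  have u: "u j \<in> dmul2 (- x) x ` span (w ` {1..p})" if "j \<in> {1..p}" for j
    using that by (auto simp: u_def intro!: span_base imageI)
  have uimg: "u ` {1..p} = dmul2 (- x) x ` w ` {1..p}" by (auto simp: u_def)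
  have indu: "independent (u ` {1..p})"
    unfolding uimg by (rule linear_independent_injective_image[OF linear_dmul2 ind inj_dmul2])
  have inju: "inj_on u {1..p}"
    using comp_inj_on[OF inj inj_dmul2[of x]] by (simp add: o_def u_def[abs_def])
  have "\<exists>e\<in>span (X ` \<alpha> ` {1..p}). \<forall>j\<in>{1..p}. e \<bullet> u j = (if i = j then 1 else 0)"
    if i: "i \<in> {1..p}" for i
  proof -
    obtain f where f: "linear f" "\<And>v. v \<in> u ` {1..p} \<Longrightarrow> f v = (if v = u i then 1 else (0::real))"
      using linear_independent_extend[OF indu, of "\<lambda>v. if v = u i then 1 else 0"] by blast
    define a where "a = adjoint f 1"
    have fa: "f v = a \<bullet> v" for v using adjoint_works[OF f(1), of v 1] by (simp add: a_def inner_commute)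
    obtain e where e: "e \<in> span (X ` \<alpha> ` {1..p})"
      "\<forall>u\<in>dmul2 (- x) x ` span (w ` {1..p}). e \<bullet> u = a \<bullet> u" using dual by blast
    have "e \<bullet> u j = (if i = j then 1 else 0)" if j: "j \<in> {1..p}" for j
    proof -
      have "e \<bullet> u j = f (u j)" using bspec[OF e(2) u[OF j]] fa[of "u j"] by (simp only:)
      also have "\<dots> = (if u j = u i then 1 else 0)" using f(2) j by blast
      finally show ?thesis using inj_on_eq_iff[OF inju j i] by (simp add: eq_commute)
    qed
    then show ?thesis using e(1) by blast
  qed
  then obtain e where e: "\<And>i. i \<in> {1..p} \<Longrightarrow> e i \<in> span (X ` \<alpha> ` {1..p})"
    "\<And>i j. i \<in> {1..p} \<Longrightarrow> j \<in> {1..p} \<Longrightarrow> e i \<bullet> u j = (if i = j then 1 else 0)"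
    by metis
  have "wedge p w (\<lambda>i. covec x (e i)) = 0"
  proof (rule eq_0_on_span_of_family[OF zero])
    fix i assume "i \<in> {1..p}"
    then have "covec x (e i) \<in> covec x ` span (X ` \<alpha> ` {1..p})" using e(1) by blast
    also have "\<dots> = span (covec x ` X ` \<alpha> ` {1..p})"
      by (rule linear_span_image[OF linear_covec, symmetric])
    also have "covec x ` X ` \<alpha> ` {1..p} = ((\<lambda>k. covec x (X k)) \<circ> \<alpha>) ` {1..p}" by auto
    finally show "covec x (e i) \<in> span (((\<lambda>k. covec x (X k)) \<circ> \<alpha>) ` {1..p})" .
  qed
  moreover have "wedge p w (\<lambda>i. covec x (e i)) = 1"
  proof -
    have "of_int (sign \<sigma>) * (\<Prod>i=1..p. blinfun_apply (covec x (e i)) (w (\<sigma> i))) =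
        (if \<sigma> = id then 1 else (0::real))" if \<sigma>: "\<sigma> permutes {1..p}" for \<sigma>
    proof -
      have \<sigma>in: "\<sigma> i \<in> {1..p}" if "i \<in> {1..p}" for i
        using that by (simp only: permutes_in_image[OF \<sigma>])
      have prod: "(\<Prod>i=1..p. blinfun_apply (covec x (e i)) (w (\<sigma> i))) =
          (\<Prod>i=1..p. if i = \<sigma> i then 1 else 0)"
        using e(2) \<sigma>in by (intro prod.cong) (auto simp: covec u_def inner_commute)
      show ?thesis
      proof (cases "\<sigma> = id")
        case True
        then show ?thesis unfolding prod by (simp add: sign_id)
      next
        case False
        then obtain i where "\<sigma> i \<noteq> i" by (metis eq_id_iff)
        moreover have "i \<in> {1..p}" using \<sigma> \<open>\<sigma> i \<noteq> i\<close> unfolding permutes_def by blast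
        ultimately have "(\<Prod>i=1..p. if i = \<sigma> i then 1 else 0) = (0::real)"
          by (intro prod_zero bexI[of _ i]) auto
        then show ?thesis unfolding prod using False by simp
      qed
    qed
    then have "wedge p w (\<lambda>i. covec x (e i)) = (\<Sum>\<sigma> | \<sigma> permutes {1..p}. if \<sigma> = id then 1 else 0)"
      unfolding wedge_def by (intro sum.cong) auto
    also have "\<dots> = 1"
      by (subst sum.delta) (auto simp: finite_permutations permutes_id)
    finally show ?thesis .
  qed
  ultimately show False by simp
qed

text \<open>Let \<open>G\<close> be the orthogonal projection onto \<open>W\<close>, so that \<open>G (X i)\<close> represents the \<open>i\<close>-th
  coordinate functional on \<open>W\<close>. The vectors \<open>G (X i)\<close> with \<open>deg i > l\<close> are independent, since
  \<open>W\<close> projects onto the span of these \<open>X i\<close>. Those with \<open>deg i \<ge> l\<close> span \<open>W\<close>, since a vector of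
  \<open>W\<close> orthogonal to all of them projects to \<open>0\<close>. Extending the first family inside the second to
  a basis of \<open>W\<close> gives \<open>I\<close>.\<close>

lemma ex_dual_coordinates:
  assumes W: "subspace W" "dim W = p"
    and surj: "card (high (Suc l)) \<le> dim (high_proj (Suc l) ` W)" and inj: "p \<le> dim (high_proj l ` W)"
  obtains I where "high (Suc l) \<subseteq> I" "I \<subseteq> high l" "card I = p"
    "\<And>a. \<exists>e\<in>span (X ` I). \<forall>u\<in>W. e \<bullet> u = a \<bullet> u"
proof -
  obtain G where G: "linear G" "\<And>v. G v \<in> W" "\<And>u v. u \<in> W \<Longrightarrow> G v \<bullet> u = v \<bullet> u"
    using orthogonal_projection_onto[OF W(1)] by blast
  let ?J = "high (Suc l)" and ?K = "high l"
  have JK: "?J \<subseteq> ?K" by (auto simp: high_def)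
  have range_W: "high_proj (Suc l) ` W = range (high_proj (Suc l))"
  proof (rule subspace_dim_equal)
    show "subspace (high_proj (Suc l) ` W)" using linear_proj W(1) by (rule linear_subspace_image)
    show "dim (range (high_proj (Suc l))) \<le> dim (high_proj (Suc l) ` W)" using surj by (simp add: dim_range_proj)
  qed (use subspace_range_proj in auto)
  have injG: "inj_on G (range (high_proj (Suc l)))"
  proof (rule inj_onI)
    fix a b assume ab: "a \<in> range (high_proj (Suc l))" "b \<in> range (high_proj (Suc l))" "G a = G b"
    let ?v = "a - b"
    have v: "?v \<in> range (high_proj (Suc l))"
      using ab subspace_range_proj by (intro subspace_diff) auto
    then have pv: "high_proj (Suc l) ?v = ?v" by (auto simp: proj_idem)
    have Gv: "?v \<bullet> u = 0" if "u \<in> W" for u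
      using G(3)[OF that, of a] G(3)[OF that, of b] ab(3) by (simp add: inner_diff_left)
    obtain u where "u \<in> W" "?v = high_proj (Suc l) u" using v range_W by blast
    then have "?v \<bullet> ?v = ?v \<bullet> u" using pv by (metis proj_inner_commute)
    then show "a = b" using Gv[OF \<open>u \<in> W\<close>] by simp
  qed
  have spanJ: "span (X ` ?J) \<subseteq> range (high_proj (Suc l))"
    using X_high(3) subspace_range_proj by (rule span_minimal)
  have indGJ: "independent (G ` X ` ?J)"
    using G(1) X_high(2) inj_on_subset[OF injG spanJ] by (rule linear_independent_injective_image)
  have injGX: "inj_on (\<lambda>i. G (X i)) ?J"
    using comp_inj_on[OF X_high(1) inj_on_subset[OF injG X_high(3)]] by (simp add: o_def)
  have GW: "G ` S \<subseteq> W" for S using G(2) by blast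
  have inj_proj: "u = 0" if u: "u \<in> W" "high_proj l u = 0" for u
    using inj_on_if_dim_le_dim_image[OF linear_proj W(1), of l] inj W(2) u subspace_0[OF W(1)]
      linear_0[OF linear_proj, of l] by (metis inj_onD)
  have span_GK: "span (G ` X ` ?K) = W"
  proof (rule ccontr)
    assume ne: "span (G ` X ` ?K) \<noteq> W"
    have "span (G ` X ` ?K) \<subseteq> W" using GW W(1) by (rule span_minimal)
    then have "span (G ` X ` ?K) \<subset> span W" using ne W(1) by (simp add: span_eq_iff[THEN iffD2] psubset_eq)
    then obtain u where u: "u \<noteq> 0" "u \<in> span W" "\<And>y. y \<in> span (G ` X ` ?K) \<Longrightarrow> orthogonal u y"
      using orthogonal_to_subspace_exists_gen by blast
    have uW: "u \<in> W" using u(2) W(1) by (simp add: span_eq_iff[THEN iffD2])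
    have "u \<bullet> X i = 0" if "i \<in> ?K" for i
    proof -
      have "orthogonal u (G (X i))" using that by (intro u(3) span_base) blast
      then show ?thesis using G(3)[OF uW, of "X i"] by (simp add: orthogonal_def inner_commute)
    qed
    then have "high_proj l u = 0" by (simp add: high_proj_def)
    then show False using inj_proj uW u(1) by blast
  qed
  obtain B where B: "G ` X ` ?J \<subseteq> B" "B \<subseteq> G ` X ` ?K" "independent B" "G ` X ` ?K \<subseteq> span B"
    using maximal_independent_subset_extend[of "G ` X ` ?J" "G ` X ` ?K"] indGJ JK by (metis image_mono)
  have spanB: "span B = W"
    using B(2,4) span_GK by (metis span_mono span_minimal subspace_span subset_antisym)
  have cardB: "card B = p"
    using dim_span_eq_card_independent[OF B(3)] spanB W(2) by simp
  have finB: "finite B" using B(3) by (rule independent_imp_finite)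
  have "B - G ` X ` ?J \<subseteq> (\<lambda>i. G (X i)) ` ?K" using B(2) by auto
  then obtain U where U: "U \<subseteq> ?K" "inj_on (\<lambda>i. G (X i)) U" "B - G ` X ` ?J = (\<lambda>i. G (X i)) ` U"
    unfolding subset_image_inj by blast
  have finU: "finite U" using U(1) high_low(1) finite_subset by blast
  have disj: "?J \<inter> U = {}" using U(3) by blast
  have "card (B - G ` X ` ?J) = card U" using U(2,3) by (simp add: card_image)
  moreover have "card (G ` X ` ?J) = card ?J" using injGX by (simp add: image_image card_image)
  moreover have "card B = card (G ` X ` ?J) + card (B - G ` X ` ?J)"
    using B(1) finB card_mono[OF finB B(1)] by (simp add: card_Diff_subset finite_subset)
  ultimately have cardI: "card (?J \<union> U) = p"
    using disj finU high_low(1) cardB by (simp add: card_Un_disjoint)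
  have imgI: "G ` X ` (?J \<union> U) = B" using U(3) B(1) by (auto simp: image_Un image_image)
  show ?thesis
  proof (rule that[of "?J \<union> U"])
    fix a
    have "G a \<in> span (G ` X ` (?J \<union> U))" using G(2) imgI spanB by simp
    then have "G a \<in> G ` span (X ` (?J \<union> U))" by (simp add: linear_span_image[OF G(1)])
    then obtain e where "e \<in> span (X ` (?J \<union> U))" "G a = G e" by blast
    then show "\<exists>e\<in>span (X ` (?J \<union> U)). \<forall>u\<in>W. e \<bullet> u = a \<bullet> u"
      using G(3) by metis
  qed (use JK U(1) cardI in auto)
qed

text \<open>The subtraction on natural numbers is truncated: \<open>deg i - l\<close> is the positive part.\<close>

lemma sum_deg_between:
  assumes "high (Suc l) \<subseteq> I" "I \<subseteq> high l" "card I = p"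
  shows "(\<Sum>i\<in>I. deg i) = l * p + (\<Sum>i=1..n. deg i - l)"
proof -
  have I: "I \<subseteq> {1..n}" using assms(2) high_low(5) by blast
  have "(\<Sum>i\<in>I. deg i) = (\<Sum>i\<in>I. l + (deg i - l))"
    using assms(2) by (intro sum.cong) (auto simp: high_def)
  also have "\<dots> = l * p + (\<Sum>i\<in>I. deg i - l)" using assms(3) by (simp add: sum.distrib)
  also have "(\<Sum>i\<in>I. deg i - l) = (\<Sum>i=1..n. deg i - l)"
    using I assms(1) by (intro sum.mono_neutral_left) (auto simp: high_def)
  finally show ?thesis .
qed

lemma sum_deg_le:
  assumes "\<beta> \<in> multi_indices n p"
  shows "(\<Sum>k=1..p. deg (\<beta> k)) \<le> l * p + (\<Sum>i=1..n. deg i - l)"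
proof -
  have "(\<Sum>k=1..p. deg (\<beta> k)) \<le> (\<Sum>k=1..p. l + (deg (\<beta> k) - l))" by (intro sum_mono) auto
  also have "\<dots> = l * p + (\<Sum>i\<in>\<beta> ` {1..p}. deg i - l)"
    using multi_index_inj[OF assms] by (simp add: sum.distrib sum.reindex)
  also have "\<dots> \<le> l * p + (\<Sum>i=1..n. deg i - l)"
    using multi_index_range[OF assms] by (intro add_left_mono sum_mono2) auto
  finally show ?thesis .
qed

text \<open>The coefficient at the multi-index of \<open>ex_dual_coordinates\<close> is nonzero, and its degree
  attains the bound \<open>sum_deg_le\<close>, which holds for all multi-indices.\<close>

lemma point_degree_ge:
  assumes V: "n = layer_sum V \<iota>" "deg = degree_of V"
    and T: "subspace (tangent_space S x)" "dim (tangent_space S x) = p"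
    and surj: "card (high (Suc l)) \<le> dim (high_proj (Suc l) ` dmul2 (- x) x ` tangent_space S x)"
    and inj: "p \<le> dim (high_proj l ` dmul2 (- x) x ` tangent_space S x)"
  shows "max_degree V \<iota> p \<le> point_degree mul V \<iota> X p S x"
proof -
  let ?T = "tangent_space S x" and ?M = "multi_indices n p"
  have md: "multi_degree V p \<beta> = (\<Sum>k=1..p. deg (\<beta> k))" for \<beta>
    by (simp add: multi_degree_def V(2))
  have "\<exists>\<tau>. is_tangent_pvector p S x \<tau>"
  proof -
    obtain B where B: "B \<subseteq> ?T" "independent B" "?T \<subseteq> span B" "card B = dim ?T"
      using basis_exists by blast
    have spanB: "span B = ?T" using B(1,3) T(1) by (metis span_minimal subset_antisym)
    have "finite B" using B(2) by (rule independent_imp_finite)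
    then obtain w where "bij_betw w {1..p} B"
      using B(4) T(2) by (metis card_atLeastAtMost diff_Suc_1 finite_atLeastAtMost finite_same_card_bij)
    then show ?thesis
      unfolding is_tangent_pvector_def using B(2) spanB
      by (intro exI[of _ "wedge p w"] exI[of _ w]) (auto simp: bij_betw_def)
  qed
  then have "is_tangent_pvector p S x (SOME \<tau>. is_tangent_pvector p S x \<tau>)" by (rule someI_ex)
  then obtain w where w: "inj_on w {1..p}" "independent (w ` {1..p})" "span (w ` {1..p}) = ?T"
    and \<tau>: "(SOME \<tau>. is_tangent_pvector p S x \<tau>) = wedge p w"
    unfolding is_tangent_pvector_def by blast
  have W: "subspace (dmul2 (- x) x ` ?T)" "dim (dmul2 (- x) x ` ?T) = p"
    using linear_subspace_image[OF linear_dmul2 T(1)] dim_image_eq[OF linear_dmul2 inj_dmul2] T(2) by auto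
  obtain I where I: "high (Suc l) \<subseteq> I" "I \<subseteq> high l" "card I = p"
    "\<And>a. \<exists>e\<in>span (X ` I). \<forall>u\<in>dmul2 (- x) x ` ?T. e \<bullet> u = a \<bullet> u"
    using ex_dual_coordinates[OF W surj inj] by blast
  have In: "I \<subseteq> {1..n}" using I(2) high_low(5) by blast
  obtain \<alpha> where \<alpha>: "\<alpha> \<in> ?M" "\<alpha> ` {1..p} = I" using ex_multi_index[OF In I(3)] by blast
  have nz: "pvector_coeffs mul n X p x (wedge p w) \<alpha> \<noteq> 0"
    using wedge_coefficient_nonzero[OF w(1,2), of \<alpha> x] I(4) \<alpha> w(3)
    by (simp add: pvector_coeffs_wedge)
  have "multi_degree V p \<alpha> = (\<Sum>i\<in>I. deg i)"
    using multi_index_inj[OF \<alpha>(1)] \<alpha>(2) sum.reindex[of \<alpha> "{1..p}" deg] by (simp add: md)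
  then have deg\<alpha>: "multi_degree V p \<alpha> = l * p + (\<Sum>i=1..n. deg i - l)"
    using sum_deg_between[OF I(1-3)] by simp
  have "max_degree V \<iota> p \<le> multi_degree V p \<alpha>"
    unfolding max_degree_def V(1)[symmetric] deg\<alpha>
    using \<alpha>(1) finite_multi_indices sum_deg_le by (intro Max.boundedI) (auto simp: md)
  also have "\<dots> \<le> point_degree mul V \<iota> X p S x"
    unfolding point_degree_def Let_def V(1)[symmetric] \<tau>
    using \<alpha>(1) nz finite_multi_indices[of n p] by (intro Max_ge) auto
  finally show ?thesis .
qed

end

section \<open>Points of low degree\<close>

text \<open>A curve in \<open>S\<close> is mapped by \<open>\<Phi>\<close> into \<open>L\<close>, which is closed, so its velocity is mapped into
  \<open>L\<close>. Conversely, lines in \<open>L\<close> are mapped by \<open>\<Psi>\<close> to curves in \<open>S\<close>.\<close>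

lemma tangent_space_eq_chart_image:
  fixes S U W L :: "'a::euclidean_space set"
  assumes U: "open U" and W: "open W" and hom: "homeomorphism U W \<Phi> \<Psi>"
    and \<Phi>: "Ck_on 1 \<Phi> U" and \<Psi>: "Ck_on 1 \<Psi> W" and L: "subspace L"
    and img: "\<Phi> ` (S \<inter> U) = W \<inter> L" and b: "b \<in> W" "b \<in> L"
  shows "tangent_space S (\<Psi> b) = frechet_derivative \<Psi> (at b) ` L"
    and "dim (tangent_space S (\<Psi> b)) = dim L"
proof -
  let ?D = "frechet_derivative \<Psi> (at b)" and ?E = "frechet_derivative \<Phi> (at (\<Psi> b))"
  have \<Psi>U: "\<Psi> y \<in> U" if "y \<in> W" for y using hom that by (auto simp: homeomorphism_def)
  have \<Phi>\<Psi>: "\<Phi> (\<Psi> y) = y" if "y \<in> W" for y using hom that by (auto simp: homeomorphism_def)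
  have \<Psi>\<Phi>: "\<Psi> (\<Phi> x) = x" if "x \<in> U" for x using hom that by (auto simp: homeomorphism_def)
  have \<Psi>S: "\<Psi> y \<in> S" if "y \<in> W" "y \<in> L" for y
  proof -
    have "y \<in> \<Phi> ` (S \<inter> U)" using img that by blast
    then obtain x where "x \<in> S" "x \<in> U" "y = \<Phi> x" by blast
    then show ?thesis using \<Psi>\<Phi> by simp
  qed
  have dD: "(\<Psi> has_derivative frechet_derivative \<Psi> (at y)) (at y)" if "y \<in> W" for y
    using Ck_on_1D(1)[OF \<Psi> that] .
  have dE: "(\<Phi> has_derivative ?E) (at (\<Psi> b))" using Ck_on_1D(1)[OF \<Phi> \<Psi>U[OF b(1)]] .
  have linD: "linear ?D" using dD[OF b(1)] has_derivative_linear by blast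
  have linE: "linear ?E" using dE has_derivative_linear by blast
  have ED: "?E (?D v) = v" for v
  proof -
    have "((\<Phi> \<circ> \<Psi>) has_derivative (?E \<circ> ?D)) (at b)"
      by (rule diff_chain_at[OF dD[OF b(1)] dE])
    then have "((\<lambda>y. y) has_derivative (?E \<circ> ?D)) (at b)"
      by (rule has_derivative_transform_within_open[OF _ W b(1)]) (simp add: \<Phi>\<Psi>)
    from has_derivative_unique[OF this has_derivative_ident] show ?thesis by (metis comp_apply)
  qed
  have DE: "?D (?E v) = v" for v
  proof -
    have "((\<Psi> \<circ> \<Phi>) has_derivative (?D \<circ> ?E)) (at (\<Psi> b))"
      using dE dD[OF b(1)] by (intro diff_chain_at) (simp_all add: \<Phi>\<Psi> b)
    then have "((\<lambda>y. y) has_derivative (?D \<circ> ?E)) (at (\<Psi> b))"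
      by (rule has_derivative_transform_within_open[OF _ U \<Psi>U[OF b(1)]]) (simp add: \<Psi>\<Phi>)
    from has_derivative_unique[OF this has_derivative_ident] show ?thesis by (metis comp_apply)
  qed
  show eq: "tangent_space S (\<Psi> b) = ?D ` L"
  proof
    show "?D ` L \<subseteq> tangent_space S (\<Psi> b)"
    proof
      fix u assume "u \<in> ?D ` L"
      then obtain v where v: "v \<in> L" "u = ?D v" by blast
      have line: "continuous_on UNIV (\<lambda>t::real. b + t *\<^sub>R v)" by (intro continuous_intros)
      have "open ((\<lambda>t::real. b + t *\<^sub>R v) -` W)" using W line by (simp add: continuous_on_open_vimage)
      moreover have "0 \<in> (\<lambda>t::real. b + t *\<^sub>R v) -` W" using b by simp
      ultimately obtain \<epsilon> where \<epsilon>: "\<epsilon> > 0" "ball 0 \<epsilon> \<subseteq> (\<lambda>t::real. b + t *\<^sub>R v) -` W"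
        using open_contains_ball by blast
      have inW: "b + t *\<^sub>R v \<in> W" if "t \<in> {-\<epsilon><..<\<epsilon>}" for t
      proof -
        have "t \<in> ball 0 \<epsilon>" using that by (auto simp: dist_norm)
        then show ?thesis using \<epsilon>(2) by blast
      qed
      define \<gamma> where "\<gamma> t = \<Psi> (b + t *\<^sub>R v)" for t :: real
      have d\<gamma>: "(\<gamma> has_derivative (\<lambda>s. frechet_derivative \<Psi> (at (b + t *\<^sub>R v)) (s *\<^sub>R v))) (at t)"
        if "t \<in> {-\<epsilon><..<\<epsilon>}" for t
      proof -
        have "((\<lambda>t. b + t *\<^sub>R v) has_derivative (\<lambda>s. s *\<^sub>R v)) (at t)"
          by (auto intro!: derivative_eq_intros)
        from diff_chain_at[OF this dD[OF inW[OF that]]] show ?thesis by (simp add: o_def \<gamma>_def[abs_def])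
      qed
      have "Ck_on 1 \<gamma> {-\<epsilon><..<\<epsilon>}"
        unfolding One_nat_def Ck_on.simps
      proof (intro conjI ballI allI)
        fix t assume "t \<in> {-\<epsilon><..<\<epsilon>}"
        then show "\<gamma> differentiable at t" using d\<gamma> differentiable_def by blast
      next
        fix s :: real
        have c: "continuous_on {-\<epsilon><..<\<epsilon>} (\<lambda>t. frechet_derivative \<Psi> (at (b + t *\<^sub>R v)) (s *\<^sub>R v))"
          by (rule continuous_on_compose2[OF Ck_on_1D(2)[OF \<Psi>]])
            (use inW in \<open>auto intro!: continuous_intros\<close>)
        have e: "frechet_derivative \<gamma> (at t) s = frechet_derivative \<Psi> (at (b + t *\<^sub>R v)) (s *\<^sub>R v)"
          if "t \<in> {-\<epsilon><..<\<epsilon>}" for t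
          using frechet_derivative_at[OF d\<gamma>[OF that]] by metis
        show "continuous_on {-\<epsilon><..<\<epsilon>} (\<lambda>t. frechet_derivative \<gamma> (at t) s)"
          by (rule iffD2[OF continuous_on_cong[OF refl e] c])
      qed
      moreover have "(\<gamma> has_vector_derivative u) (at 0)"
        using d\<gamma>[of 0] \<epsilon>(1) linear_scale[OF linD] by (simp add: has_vector_derivative_def v(2))
      moreover have "\<gamma> ` {-\<epsilon><..<\<epsilon>} \<subseteq> S"
        using inW \<Psi>S L b v(1) by (auto simp: \<gamma>_def subspace_add subspace_scale)
      ultimately show "u \<in> tangent_space S (\<Psi> b)"
        unfolding tangent_space_def using \<epsilon>(1) by (intro CollectI exI[of _ \<gamma>] exI[of _ \<epsilon>]) (simp add: \<gamma>_def)
    qed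
    show "tangent_space S (\<Psi> b) \<subseteq> ?D ` L"
    proof
      fix u assume "u \<in> tangent_space S (\<Psi> b)"
      then obtain \<gamma> \<epsilon> where \<gamma>: "\<epsilon> > 0" "\<gamma> ` {-\<epsilon><..<\<epsilon>} \<subseteq> S" "\<gamma> 0 = \<Psi> b"
        "(\<gamma> has_vector_derivative u) (at 0)"
        unfolding tangent_space_def by blast
      have "isCont \<gamma> 0" using \<gamma>(4) has_vector_derivative_continuous by blast
      then have "\<forall>\<^sub>F t in at 0. \<gamma> t \<in> U"
        using U \<Psi>U[OF b(1)] \<gamma>(3) unfolding isCont_def by (metis topological_tendstoD)
      moreover have "\<forall>\<^sub>F t in at 0. t \<in> {-\<epsilon><..<\<epsilon>}"
        using \<gamma>(1) by (intro eventually_at_in_open') auto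
      ultimately have ev: "\<forall>\<^sub>F t in at 0. \<Phi> (\<gamma> t) \<in> L"
      proof eventually_elim
        case (elim t)
        then have "\<Phi> (\<gamma> t) \<in> \<Phi> ` (S \<inter> U)" using \<gamma>(2) by blast
        then show ?case using img by blast
      qed
      have "((\<Phi> \<circ> \<gamma>) has_derivative (?E \<circ> (\<lambda>t. t *\<^sub>R u))) (at 0)"
        using \<gamma>(3,4) dE by (intro diff_chain_at) (simp_all add: has_vector_derivative_def)
      then have "((\<lambda>t. \<Phi> (\<gamma> t)) has_derivative (\<lambda>t. t *\<^sub>R ?E u)) (at 0)"
        by (simp add: o_def linear_scale[OF linE])
      then have "((\<lambda>t. norm (\<Phi> (\<gamma> t) - \<Phi> (\<gamma> 0) - t *\<^sub>R ?E u) / norm t) \<longlongrightarrow> 0) (at 0)"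
        unfolding has_derivative_at by simp
      then have "((\<lambda>t. norm ((1 / t) *\<^sub>R (\<Phi> (\<gamma> t) - \<Phi> (\<gamma> 0)) - ?E u)) \<longlongrightarrow> 0) (at 0)"
      proof (rule Lim_transform_eventually)
        have "norm (v - t *\<^sub>R w) / norm t = norm ((1 / t) *\<^sub>R v - w)" if "t \<noteq> 0" for t and v w :: 'a
        proof -
          have "(1 / t) *\<^sub>R v - w = (1 / t) *\<^sub>R (v - t *\<^sub>R w)" using that by (simp add: scaleR_diff_right)
          then show ?thesis by simp
        qed
        then show "\<forall>\<^sub>F t in at 0. norm (\<Phi> (\<gamma> t) - \<Phi> (\<gamma> 0) - t *\<^sub>R ?E u) / norm t =
            norm ((1 / t) *\<^sub>R (\<Phi> (\<gamma> t) - \<Phi> (\<gamma> 0)) - ?E u)"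
          by (simp add: eventually_at_filter)
      qed
      then have lim: "((\<lambda>t. (1 / t) *\<^sub>R (\<Phi> (\<gamma> t) - \<Phi> (\<gamma> 0))) \<longlongrightarrow> ?E u) (at 0)"
        by (rule LIM_zero_cancel[OF tendsto_norm_zero_cancel])
      have "?E u \<in> L"
      proof (rule Lim_in_closed_set[OF closed_subspace[OF L] _ _ lim])
        show "\<forall>\<^sub>F t in at 0. (1 / t) *\<^sub>R (\<Phi> (\<gamma> t) - \<Phi> (\<gamma> 0)) \<in> L"
          using ev by eventually_elim (use L b \<gamma>(3) \<Phi>\<Psi> in \<open>simp add: subspace_scale subspace_diff\<close>)
      qed simp
      then show "u \<in> ?D ` L" using imageI[of "?E u" L ?D] by (simp only: DE)
    qed
  qed
  have "inj_on ?D (span L)" by (intro inj_onI) (metis ED)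
  then show "dim (tangent_space S (\<Psi> b)) = dim L"
    unfolding eq using dim_image_eq[OF linD] by blast
qed

context homogeneous_group
begin

text \<open>The first alternative on \<open>m\<close> is a projection to the degrees above \<open>l\<close> that is not onto,
  the second a projection to the degrees from \<open>l\<close> on that is not injective. The exponents of \<open>\<epsilon>\<close>
  in \<open>chart_cover_estimate\<close> cancel, and what remains is the factor \<open>A\<^sup>k\<^sup>-\<^sup>p B\<^sup>e\<^sup>-\<^sup>k = \<delta>\<close>, where
  \<open>p = dim L\<close> and \<open>e\<close> is the number of basis vectors of degree at least \<open>m\<close>.\<close>

lemma degenerate_piece_null:
  assumes \<Psi>: "Ck_on 1 \<Psi> U" and ball: "cball a r \<subseteq> U" and L: "subspace L"
    and S: "S \<subseteq> L \<inter> cball a r"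
    and rank: "\<And>b. b \<in> S \<Longrightarrow> dim (high_proj m ` chart_deriv \<Psi> b b ` L) \<le> k"
    and l: "1 \<le> l" and p: "0 < dim L"
    and m: "m = Suc l \<and> Suc k = card (high m) \<or> m = l \<and> Suc k = dim L \<and> k \<le> card (high m)"
  shows "hausdorff_measure d (l * dim L + (\<Sum>i=1..n. deg i - l)) (\<Psi> ` S) = 0"
proof (rule hausdorff_measure_0_ball_covers[OF metric])
  let ?e = "card (high m)" and ?p = "dim L" and ?s = "\<Sum>i=1..n. deg i - l"
  show "0 < l * ?p + ?s" using l p by simp
  have k: "k \<le> ?e" using m by auto
  obtain C0 where C0: "C0 > 0" and est: "\<forall>A B S. 1 \<le> A \<longrightarrow> 0 < B \<longrightarrow> B \<le> 1 \<longrightarrow> m = Suc l \<and> A = 1 \<or> m = l \<and> B = 1 \<longrightarrow>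
      S \<subseteq> L \<inter> cball a r \<longrightarrow> (\<forall>b\<in>S. dim (high_proj m ` chart_deriv \<Psi> b b ` L) \<le> k) \<longrightarrow>
      (\<exists>\<epsilon>0>0. \<forall>\<epsilon>. 0 < \<epsilon> \<longrightarrow> \<epsilon> < \<epsilon>0 \<longrightarrow>
        (\<exists>Z. finite Z \<and> \<Psi> ` S \<subseteq> (\<Union>z\<in>Z. {y. d z y < \<epsilon>}) \<and>
          real (card Z) * (A * \<epsilon> ^ l) ^ ?p * (\<Prod>i\<in>high m. \<epsilon> ^ deg i)
            \<le> C0 * ((A * \<epsilon> ^ l) ^ k * (B * \<epsilon> ^ l) ^ (?e - k))))"
    using chart_cover_estimate[OF \<Psi> ball L k l] by (elim exE conjE) (rule that)
  fix \<eta> :: real assume \<eta>: "0 < \<eta>"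
  define \<delta> where "\<delta> = min 1 (\<eta> / C0)"
  have \<delta>: "0 < \<delta>" "\<delta> \<le> 1" "C0 * \<delta> \<le> \<eta>"
    using \<eta> C0 by (auto simp: \<delta>_def min_def field_simps)
  \<comment> \<open>The two choices are \<open>(1, \<delta>)\<close> and \<open>(1 / \<delta>, 1)\<close>.\<close>
  obtain A B where AB: "1 \<le> A" "0 < B" "B \<le> 1" "m = Suc l \<and> A = 1 \<or> m = l \<and> B = 1"
    "A ^ k * B ^ (?e - k) = \<delta> * A ^ ?p"
  proof -
    from m consider (1) "m = Suc l" "Suc k = ?e" | (2) "m = l" "Suc k = ?p" by blast
    then show ?thesis
    proof cases
      case 1
      then have "?e - k = 1" by simp
      then show ?thesis using that[of 1 \<delta>] 1 \<delta> by simp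
    next
      case 2
      have "(1 / \<delta>) ^ k = \<delta> * (1 / \<delta>) ^ ?p" using \<delta>(1) by (simp flip: 2(2))
      then show ?thesis using that[of "1 / \<delta>" 1] 2 \<delta> by simp
    qed
  qed
  obtain \<epsilon>0 where \<epsilon>0: "\<epsilon>0 > 0" and cov: "\<forall>\<epsilon>. 0 < \<epsilon> \<longrightarrow> \<epsilon> < \<epsilon>0 \<longrightarrow>
        (\<exists>Z. finite Z \<and> \<Psi> ` S \<subseteq> (\<Union>z\<in>Z. {y. d z y < \<epsilon>}) \<and>
          real (card Z) * (A * \<epsilon> ^ l) ^ ?p * (\<Prod>i\<in>high m. \<epsilon> ^ deg i)
            \<le> C0 * ((A * \<epsilon> ^ l) ^ k * (B * \<epsilon> ^ l) ^ (?e - k)))"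
    using est[rule_format, OF AB(1-4) S rank] by blast
  have lm: "l \<le> m" "m \<le> Suc l" using m by auto
  have "(\<Sum>i\<in>high m. deg i) = (\<Sum>i\<in>high m. l + (deg i - l))"
    using lm(1) by (intro sum.cong) (auto simp: high_def)
  also have "\<dots> = l * ?e + (\<Sum>i\<in>high m. deg i - l)" by (simp add: sum.distrib)
  also have "(\<Sum>i\<in>high m. deg i - l) = ?s"
    using lm(2) high_low(5) by (intro sum.mono_neutral_left) (auto simp: high_def)
  finally have sum_hi: "(\<Sum>i\<in>high m. deg i) = l * ?e + ?s" .
  have "\<exists>Z. finite Z \<and> \<Psi> ` S \<subseteq> (\<Union>z\<in>Z. {y. d z y < \<epsilon>}) \<and>
      real (card Z) * \<epsilon> ^ (l * ?p + ?s) \<le> \<eta>" if \<epsilon>: "0 < \<epsilon>" "\<epsilon> < \<epsilon>0" for \<epsilon>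
  proof -
    obtain Z where Z: "finite Z" "\<Psi> ` S \<subseteq> (\<Union>z\<in>Z. {y. d z y < \<epsilon>})"
      "real (card Z) * (A * \<epsilon> ^ l) ^ ?p * (\<Prod>i\<in>high m. \<epsilon> ^ deg i)
        \<le> C0 * ((A * \<epsilon> ^ l) ^ k * (B * \<epsilon> ^ l) ^ (?e - k))"
      using cov[rule_format, OF \<epsilon>] by (elim exE conjE) (rule that)
    define Q where "Q = A ^ ?p * \<epsilon> ^ (l * ?e)"
    have Q: "0 < Q" using AB(1) \<epsilon>(1) by (simp add: Q_def)
    have "real (card Z) * (A * \<epsilon> ^ l) ^ ?p * (\<Prod>i\<in>high m. \<epsilon> ^ deg i) =
        real (card Z) * \<epsilon> ^ (l * ?p + ?s) * Q"
      by (simp add: Q_def power_mult_distrib power_add sum_hi mult_ac flip: power_sum power_mult)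
    moreover have "C0 * ((A * \<epsilon> ^ l) ^ k * (B * \<epsilon> ^ l) ^ (?e - k)) = C0 * \<delta> * Q"
    proof -
      have "(A * \<epsilon> ^ l) ^ k * (B * \<epsilon> ^ l) ^ (?e - k) =
          (A ^ k * B ^ (?e - k)) * ((\<epsilon> ^ l) ^ k * (\<epsilon> ^ l) ^ (?e - k))"
        by (simp add: power_mult_distrib mult_ac)
      also have "(\<epsilon> ^ l) ^ k * (\<epsilon> ^ l) ^ (?e - k) = \<epsilon> ^ (l * ?e)"
        using k by (metis le_add_diff_inverse power_add power_mult)
      finally show ?thesis by (simp add: AB(5) Q_def mult_ac)
    qed
    ultimately have "real (card Z) * \<epsilon> ^ (l * ?p + ?s) * Q \<le> C0 * \<delta> * Q" using Z(3) by (simp only:)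
    then have "real (card Z) * \<epsilon> ^ (l * ?p + ?s) \<le> C0 * \<delta>" using Q by simp
    then show ?thesis using Z(1,2) \<delta>(3) by (intro exI[of _ Z]) simp
  qed
  then show "\<exists>\<epsilon>0>0. \<forall>\<epsilon>. 0 < \<epsilon> \<longrightarrow> \<epsilon> < \<epsilon>0 \<longrightarrow>
      (\<exists>Z. finite Z \<and> \<Psi> ` S \<subseteq> (\<Union>z\<in>Z. {y. d z y < \<epsilon>}) \<and>
        real (card Z) * \<epsilon> ^ (l * ?p + ?s) \<le> \<eta>)"
    using \<epsilon>0 by blast
qed

text \<open>The largest \<open>l\<close> such that at least \<open>p\<close> basis vectors have degree \<open>l\<close> or more.\<close>

lemma ex_threshold_degree:
  assumes "1 \<le> p" "p \<le> n"
  obtains l where "1 \<le> l" "card (high (Suc l)) < p" "p \<le> card (high l)"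
proof -
  have "high 1 = {1..n}" using deg_pos unfolding high_def by blast
  then have 1: "p \<le> card (high 1)" using assms by simp
  define N where "N = Suc (Max (insert 0 (deg ` {1..n})))"
  have bound: "l < N" if "p \<le> card (high l)" for l
  proof (rule ccontr)
    assume "\<not> l < N"
    moreover have "deg i < N" if "i \<in> {1..n}" for i using that by (auto simp: N_def less_Suc_eq_le)
    ultimately have "high l = {}" by (fastforce simp: high_def)
    then show False using that assms(1) by simp
  qed
  obtain l where l: "p \<le> card (high l)" "\<And>l'. p \<le> card (high l') \<Longrightarrow> l' \<le> l"
    using ex_has_greatest_nat[of "\<lambda>l. p \<le> card (high l)" 1 "\<lambda>l. l" N] 1 bound by auto
  show ?thesis
  proof (rule that)
    show "1 \<le> l" using l(2) 1 by blast
    show "card (high (Suc l)) < p" using l(2)[of "Suc l"] by fastforce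
    show "p \<le> card (high l)" by fact
  qed
qed

lemma max_degree_eq:
  assumes V: "n = layer_sum V \<iota>" "deg = degree_of V"
    and l: "card (high (Suc l)) \<le> p" "p \<le> card (high l)"
  shows "max_degree V \<iota> p = l * p + (\<Sum>i=1..n. deg i - l)"
proof -
  have md: "multi_degree V p \<beta> = (\<Sum>k=1..p. deg (\<beta> k))" for \<beta>
    by (simp add: multi_degree_def V(2))
  have "high (Suc l) \<subseteq> high l" by (auto simp: high_def)
  then obtain I where I: "high (Suc l) \<subseteq> I" "I \<subseteq> high l" "card I = p"
    using exists_subset_between[OF l] high_low(1) by blast
  have "I \<subseteq> {1..n}" using I(2) high_low(5) by blast
  then obtain \<alpha> where \<alpha>: "\<alpha> \<in> multi_indices n p" "\<alpha> ` {1..p} = I" using ex_multi_index I(3) by blast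
  have "multi_degree V p \<alpha> = (\<Sum>i\<in>I. deg i)"
    using multi_index_inj[OF \<alpha>(1)] \<alpha>(2) sum.reindex[of \<alpha> "{1..p}" deg] by (simp add: md)
  then have deg\<alpha>: "multi_degree V p \<alpha> = l * p + (\<Sum>i=1..n. deg i - l)"
    using sum_deg_between[OF I] by simp
  show ?thesis
    unfolding max_degree_def V(1)[symmetric]
  proof (rule Max_eqI)
    show "x \<le> l * p + (\<Sum>i=1..n. deg i - l)" if "x \<in> multi_degree V p ` multi_indices n p" for x
      using that sum_deg_le by (auto simp: md)
    show "l * p + (\<Sum>i=1..n. deg i - l) \<in> multi_degree V p ` multi_indices n p"
      using \<alpha>(1) by (intro image_eqI[of _ _ \<alpha>]) (simp_all only: deg\<alpha>)
  qed (simp add: finite_multi_indices)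
qed

text \<open>In one chart, every point of low degree has one of the two rank defects, by
  \<open>point_degree_ge\<close>.\<close>

lemma low_degree_points_null:
  assumes V: "n = layer_sum V \<iota>" "deg = degree_of V" and S: "C1_submanifold p S"
  shows "hausdorff_measure d (max_degree V \<iota> p)
    {x \<in> S. point_degree mul V \<iota> X p S x < max_degree V \<iota> p} = 0"
    (is "hausdorff_measure d ?D ?Sc = 0")
proof (rule hausdorff_measure_0_local)
  fix x assume "x \<in> ?Sc"
  then have x: "x \<in> S" "point_degree mul V \<iota> X p S x < ?D" by auto
  obtain U W \<Phi> \<Psi> and L :: "'a set" where U: "open U" "x \<in> U" and W: "open W"
    and hom: "homeomorphism U W \<Phi> \<Psi>" and \<Phi>: "Ck_on 1 \<Phi> U" and \<Psi>: "Ck_on 1 \<Psi> W"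
    and L: "subspace L" "dim L = p" and img: "\<Phi> ` (S \<inter> U) = W \<inter> L"
    using bspec[OF S[unfolded C1_submanifold_def] x(1)] by (elim exE conjE) (rule that)
  have pn: "p \<le> n" using dim_subset_UNIV[of L] L(2) dim_n by simp
  have p1: "1 \<le> p"
  proof (rule ccontr)
    assume "\<not> 1 \<le> p"
    then have "p = 0" by simp
    then have "multi_degree V p ` multi_indices (layer_sum V \<iota>) p = {0}"
      by (auto simp: multi_degree_def multi_indices_def image_iff strict_mono_on_def)
    then have "?D = 0" by (simp add: max_degree_def)
    then show False using x(2) by simp
  qed
  obtain l where l: "1 \<le> l" "card (high (Suc l)) < p" "p \<le> card (high l)"
    using ex_threshold_degree[OF p1 pn] by blast
  have D: "?D = l * dim L + (\<Sum>i=1..n. deg i - l)"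
    using max_degree_eq[OF V, of l p] l L(2) by simp
  have \<Phi>x: "\<Phi> x \<in> W" using hom U(2) by (auto simp: homeomorphism_def)
  obtain r where r: "r > 0" "cball (\<Phi> x) r \<subseteq> W" using W \<Phi>x open_contains_cball by blast
  define T where "T = U \<inter> \<Phi> -` ball (\<Phi> x) r"
  have "open T" unfolding T_def
    using hom U(1) by (intro continuous_open_preimage) (auto simp: homeomorphism_def)
  moreover have "x \<in> T" using U(2) r(1) by (simp add: T_def)
  moreover have "hausdorff_measure d ?D (?Sc \<inter> T) = 0"
  proof -
    define Q where "Q = {b \<in> L \<inter> cball (\<Phi> x) r. \<Psi> b \<in> ?Sc}"
    \<comment> \<open>The last condition guards against truncated subtraction: a projection to the zero space
      is onto.\<close>
    define Q1 where "Q1 = {b \<in> Q. dim (high_proj (Suc l) ` chart_deriv \<Psi> b b ` L) \<le> card (high (Suc l)) - 1 \<and> card (high (Suc l)) \<ge> 1}"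
    define Q2 where "Q2 = {b \<in> Q. dim (high_proj l ` chart_deriv \<Psi> b b ` L) \<le> p - 1}"
    have cover: "?Sc \<inter> T \<subseteq> \<Psi> ` Q"
    proof
      fix y assume y: "y \<in> ?Sc \<inter> T"
      then have yU: "y \<in> U" "y \<in> S" by (auto simp: T_def)
      then have "\<Phi> y \<in> L" using img by blast
      moreover have "\<Psi> (\<Phi> y) = y" using hom yU by (auto simp: homeomorphism_def)
      moreover have "\<Phi> y \<in> cball (\<Phi> x) r" using y by (auto simp: T_def)
      ultimately show "y \<in> \<Psi> ` Q" using y by (intro image_eqI[of _ _ "\<Phi> y"]) (auto simp: Q_def)
    qed
    have split: "Q \<subseteq> Q1 \<union> Q2"
    proof (rule ccontr)
      assume "\<not> Q \<subseteq> Q1 \<union> Q2"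
      then obtain b where b: "b \<in> Q" "b \<notin> Q1" "b \<notin> Q2" by blast
      have bW: "b \<in> W" "b \<in> L" using b(1) r(2) by (auto simp: Q_def)
      note tan = tangent_space_eq_chart_image[OF U(1) W hom \<Phi> \<Psi> L(1) img bW]
      have cd: "chart_deriv \<Psi> b b ` L = dmul2 (- \<Psi> b) (\<Psi> b) ` tangent_space S (\<Psi> b)"
        unfolding tan(1) chart_deriv_def by (simp add: image_image)
      have "subspace (tangent_space S (\<Psi> b))"
        unfolding tan(1) using Ck_on_1D(1)[OF \<Psi> bW(1)] has_derivative_linear L(1)
        by (blast intro: linear_subspace_image)
      moreover have "dim (tangent_space S (\<Psi> b)) = p" using tan(2) L(2) by simp
      moreover have "card (high (Suc l)) \<le> dim (high_proj (Suc l) ` dmul2 (- \<Psi> b) (\<Psi> b) ` tangent_space S (\<Psi> b))"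
        using b(1,2) cd by (auto simp: Q1_def)
      moreover have "p \<le> dim (high_proj l ` dmul2 (- \<Psi> b) (\<Psi> b) ` tangent_space S (\<Psi> b))"
        using b(1,3) cd by (auto simp: Q2_def)
      ultimately have "?D \<le> point_degree mul V \<iota> X p S (\<Psi> b)"
        by (rule point_degree_ge[OF V])
      then show False using b(1) by (simp add: Q_def)
    qed
    have "hausdorff_measure d ?D (\<Psi> ` Q2) = 0"
      unfolding D
      by (rule degenerate_piece_null[OF \<Psi> r(2) L(1), of Q2 l "p - 1" l])
        (use l p1 L(2) in \<open>auto simp: Q2_def Q_def\<close>)
    moreover have "hausdorff_measure d ?D (\<Psi> ` Q1) = 0"
    proof (cases "card (high (Suc l)) \<ge> 1")
      case True
      then show ?thesis
        unfolding D
        by (intro degenerate_piece_null[OF \<Psi> r(2) L(1), of Q1 "Suc l" "card (high (Suc l)) - 1" l])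
          (use l p1 L(2) in \<open>auto simp: Q1_def Q_def\<close>)
    next
      case False
      then have "Q1 = {}" by (auto simp: Q1_def)
      then show ?thesis by (simp add: hausdorff_measure_0_empty)
    qed
    ultimately have "hausdorff_measure d ?D (\<Psi> ` Q1 \<union> \<Psi> ` Q2) = 0"
      by (intro hausdorff_measure_0_Un)
    then show ?thesis
      by (rule hausdorff_measure_0_mono) (use cover split in blast)
  qed
  ultimately show "\<exists>T. open T \<and> x \<in> T \<and> hausdorff_measure d ?D (?Sc \<inter> T) = 0" by blast
qed

end

lemma homogeneous_group_of_stratified:
  assumes str: "stratified_group mul V \<iota>" and gb: "graded_basis V \<iota> X"
    and hd: "homogeneous_distance mul V \<iota> X d"
  shows "homogeneous_group mul d (layer_sum V \<iota>) X (degree_of V)"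
proof (rule homogeneous_group.intro)
  let ?n = "layer_sum V \<iota>"
  have lie: "lie_group_in_exp_coords mul" using str by (simp add: stratified_group_def)
  show "group mul 0 uminus" using lie by (simp add: lie_group_in_exp_coords_def)
  show "Ck_on 1 (\<lambda>(x, y). mul x y) UNIV" using lie unfolding lie_group_in_exp_coords_def by blast
  show "Metric_space UNIV d" "continuous_on UNIV (\<lambda>(x, y). d x y)"
    using hd by (simp_all add: homogeneous_distance_def)
  show "d (mul z x) (mul z y) = d x y" for x y z using hd by (simp add: homogeneous_distance_def)
  show on: "orthonormal_on {1..?n} X"
    using gb by (simp add: graded_basis_def orthonormal_on_def)
  have mono: "layer_sum V j \<le> layer_sum V k" if "j \<le> k" for j k
    unfolding layer_sum_def using that by (intro sum_mono2) auto
  show "?n = DIM('a)"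
  proof -
    have inj: "inj_on X {1..?n}" and ind: "independent (X ` {1..?n})"
      using orthonormal_on_independent[OF on] by auto
    have "x \<in> span (X ` {1..?n})" for x
    proof -
      obtain u where u: "u \<in> (\<Pi>\<^sub>E j\<in>{1..\<iota>}. V j)" "x = (\<Sum>j=1..\<iota>. u j)"
        using str unfolding stratified_group_def by blast
      have "u j \<in> span (X ` {1..?n})" if j: "j \<in> {1..\<iota>}" for j
      proof -
        have "u j \<in> span (X ` {layer_sum V (j - 1) + 1..layer_sum V j})"
          using u(1) j gb by (auto simp: graded_basis_def)
        moreover have "{layer_sum V (j - 1) + 1..layer_sum V j} \<subseteq> {1..?n}"
          using mono[of j \<iota>] j by auto
        ultimately show ?thesis using span_mono[OF image_mono] by blast
      qed
      then show ?thesis unfolding u(2) by (rule span_sum)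
    qed
    then have "span (X ` {1..?n}) = UNIV" by blast
    then have "DIM('a) = card (X ` {1..?n})" using dim_span_eq_card_independent[OF ind] by simp
    then show ?thesis using inj by (simp add: card_image)
  qed
  show "1 \<le> degree_of V i" if i: "i \<in> {1..?n}" for i
  proof -
    \<comment> \<open>The layer that contains the index \<open>i\<close>.\<close>
    define k where "k = (LEAST k. i \<le> layer_sum V k)"
    have k: "i \<le> layer_sum V k" unfolding k_def by (rule LeastI[of _ \<iota>]) (use i in simp)
    have k0: "k \<noteq> 0"
    proof
      assume "k = 0"
      then show False using k i by (simp add: layer_sum_def)
    qed
    have "\<not> i \<le> layer_sum V (k - 1)" unfolding k_def by (rule not_less_Least) (use k0 k_def in auto)
    then have lt: "layer_sum V (k - 1) < i" by simp
    have uniq: "k' = k" if k': "layer_sum V (k' - 1) < i" "i \<le> layer_sum V k'" for k'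
    proof (rule ccontr)
      assume "k' \<noteq> k"
      then consider "k' \<le> k - 1" | "k \<le> k' - 1" by linarith
      then show False
        using mono[of k' "k - 1"] mono[of k "k' - 1"] k k' lt by cases auto
    qed
    have "degree_of V i = k"
      unfolding degree_of_def by (rule the_equality) (use k lt uniq in blast)+
    then show ?thesis using k0 by simp
  qed
  show "d 0 (\<Sum>i=1..?n. (r ^ degree_of V i * (x \<bullet> X i)) *\<^sub>R X i) = r * d 0 x" if "0 < r" for r x
  proof -
    have "d (dilation V \<iota> X r 0) (dilation V \<iota> X r x) = r * d 0 x"
      using hd that unfolding homogeneous_distance_def by blast
    then show ?thesis by (simp add: dilation_def)
  qed
qed

theorem theorem1p2:
  fixes mul :: "'a::euclidean_space \<Rightarrow> 'a \<Rightarrow> 'a"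
    and V :: "nat \<Rightarrow> 'a set" and \<iota> p :: nat and X :: "nat \<Rightarrow> 'a"
    and d :: "'a \<Rightarrow> 'a \<Rightarrow> real" and \<Sigma> :: "'a set"
  assumes "stratified_group mul V \<iota>"
    and "graded_metric V \<iota>"
    and "graded_basis V \<iota> X"
    and "homogeneous_distance mul V \<iota> X d"
    and "C1_submanifold p \<Sigma>"
  shows "hausdorff_measure d (max_degree V \<iota> p)
           {x \<in> \<Sigma>. point_degree mul V \<iota> X p \<Sigma> x < max_degree V \<iota> p} = 0"
  by (rule homogeneous_group.low_degree_points_null
      [OF homogeneous_group_of_stratified[OF assms(1,3,4)] refl refl assms(5)])

end
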